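(* Let $T>0$, $\nu>0$. Suppose that $F_0\in H$, $G_0\in H$ and $v\in\bigcup_{\delta_0>0}L^{2+\frac{6}{\delta_0}}(0,T;\mathbb{L}^{3+\delta_0}(D))$. Let $F$ and $G$ be the solutions of, respectively, the problems $$\frac{\partial F}{\partial t}=-\nu AF-B(v(t),F),\quad t\in(0,T),\qquad F(0,\cdot)=F_0,$$ $$\frac{\partial G}{\partial t}=-\nu AG+\operatorname{curl}\big(v(T-t)\times G\big),\quad t\in(0,T),\qquad G(0,\cdot)=G_0.$$ Then $$(F(t),G(T-t))_H=(F(0),G(T))_H,\qquad t\in[0,T].$$
   Context: $D$ is either $\mathbb{R}^3$ or an open, bounded, connected set in $\mathbb{R}^3$ with boundary $\Gamma$ of class $C^3$ and outer normal $\vec n$. $\mathbb{L}^p(D)=L^p(D,\mathbb{R}^3)$. $H=\{f\in\mathbb{L}^2(D):\operatorname{div}f=0,\ (f\cdot\vec n)|_\Gamma=0\}$ with the $L^2$ norm $|\cdot|_H$, $V=\mathbb{H}_0^{1,2}(D)\cap H$ with the $H^{1,2}$ norm, and $V\subset H\cong H'\subset V'$ is the Gelfand triple. $\mathrm{P}$ is the Helmholtz projection onto divergence-free fields, $\times$ the vector product. The Stokes operator $A\in\mathcal{L}(V,V')$ is defined by $\langle Au,w\rangle=\sum_{i,j=1}^3\int_D\nabla_iu^j\nabla_iw^j\,dx$, $u,w\in V$. For $\delta_0>0$, $B:\mathbb{L}^{3+\delta_0}(D)\times V\to V'$ is the bounded bilinear operator extending $B(v,f)=\mathrm{P}(v\times\operatorname{curl}f)$,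 i.e. $\langle B(v,f),\phi\rangle_{V',V}=-(v\times\phi,\operatorname{curl}f)_{\mathbb{L}^2(D)}$ for $f,\phi\in V$. The term $\operatorname{curl}(v\times G)$ is the element of $V'$ given by $\langle\operatorname{curl}(v\times G),\phi\rangle_{V',V}=(v\times G,\operatorname{curl}\phi)_{\mathbb{L}^2(D)}$, $\phi\in V$. A solution of either problem is an element of $L^2(0,T;V)\cap L^\infty(0,T;H)\cap C([0,T];H_{\rm w})$, where $H_{\rm w}$ is $H$ with the weak topology, satisfying the equation in the distribution sense and the initial condition as an element of $C([0,T];H_{\rm w})$; under the stated assumption on $v$ such solutions exist and are unique. *)

theory Defs
  imports "HOL-Analysis.Analysis"
begin

text \<open>
  Elements of function spaces over a domain \<open>D\<close> are represented by functions on the whole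
  space; only their values on \<open>D\<close> matter, and two functions that agree almost everywhere on \<open>D\<close>
  represent the same element.  A space is therefore a set of functions together with a seminorm.
\<close>

type_synonym field3 = "real^3 \<Rightarrow> real^3"


subsection \<open>Smooth functions and domains\<close>

primrec Ck :: "nat \<Rightarrow> ('a::euclidean_space \<Rightarrow> 'b::real_normed_vector) \<Rightarrow> bool" where
  "Ck 0 f \<longleftrightarrow> continuous_on UNIV f"
| "Ck (Suc k) f \<longleftrightarrow>
     f differentiable_on UNIV \<and> (\<forall>b\<in>Basis. Ck k (\<lambda>x. frechet_derivative f (at x) b))"

definition test_functions :: "'a::euclidean_space set \<Rightarrow> ('a \<Rightarrow> 'b::real_normed_vector) set" where
  "test_functions S =
     {\<phi>. (\<forall>k. Ck k \<phi>) \<and> (\<exists>K. compact K \<and> K \<subseteq> S \<and> (\<forall>x. x \<notin> K \<longrightarrow> \<phi> x = 0))}"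

text \<open>After a rotation (or reflection) of the coordinates, \<open>D\<close> is locally, near each of its
  boundary points, the region above the graph of a function of class \<open>C\<^sup>k\<close>.\<close>

definition Ck_boundary :: "nat \<Rightarrow> (real^3) set \<Rightarrow> bool" where
  "Ck_boundary k D \<longleftrightarrow>
     (\<forall>p\<in>frontier D. \<exists>r>0. \<exists>(R :: real^3 \<Rightarrow> real^3) (\<gamma> :: real^2 \<Rightarrow> real).
        orthogonal_transformation R \<and> Ck k \<gamma> \<and>
        D \<inter> ball p r = {x \<in> ball p r. R x $ 3 > \<gamma> (vector [R x $ 1, R x $ 2])})"

definition admissible_domain :: "(real^3) set \<Rightarrow> bool" where
  "admissible_domain D \<longleftrightarrow>
     D = UNIV \<or> (open D \<and> bounded D \<and> connected D \<and> Ck_boundary 3 D)"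


subsection \<open>Lebesgue and Sobolev spaces on a domain\<close>

definition Lp_on :: "(real^3) set \<Rightarrow> real \<Rightarrow> (real^3 \<Rightarrow> 'b::euclidean_space) set" where
  "Lp_on D p = {f \<in> borel_measurable (lebesgue_on D).
                  integrable (lebesgue_on D) (\<lambda>x. norm (f x) powr p)}"

definition Lp_norm :: "(real^3) set \<Rightarrow> real \<Rightarrow> (real^3 \<Rightarrow> 'b::euclidean_space) \<Rightarrow> real" where
  "Lp_norm D p f = (LINT x|lebesgue_on D. norm (f x) powr p) powr (1 / p)"

definition L2_inner :: "(real^3) set \<Rightarrow> field3 \<Rightarrow> field3 \<Rightarrow> real" where
  "L2_inner D f g = (LINT x|lebesgue_on D. f x \<bullet> g x)"

definition locally_integrable :: "(real^3) set \<Rightarrow> (real^3 \<Rightarrow> real) \<Rightarrow> bool" where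
  "locally_integrable D f \<longleftrightarrow> (\<forall>K. compact K \<and> K \<subseteq> D \<longrightarrow> integrable (lebesgue_on K) f)"

definition partial_deriv :: "3 \<Rightarrow> (real^3 \<Rightarrow> real) \<Rightarrow> real^3 \<Rightarrow> real" where
  "partial_deriv i \<phi> x = frechet_derivative \<phi> (at x) (axis i 1)"

definition grad :: "(real^3 \<Rightarrow> real) \<Rightarrow> field3" where
  "grad \<phi> x = (\<chi> i. partial_deriv i \<phi> x)"

definition is_weak_partial ::
    "(real^3) set \<Rightarrow> 3 \<Rightarrow> (real^3 \<Rightarrow> real) \<Rightarrow> (real^3 \<Rightarrow> real) \<Rightarrow> bool" where
  "is_weak_partial D i f g \<longleftrightarrow>
     locally_integrable D f \<and> locally_integrable D g \<and>
     (\<forall>\<phi>\<in>test_functions D. (LINT x|lebesgue_on D. f x * partial_deriv i \<phi> x)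
                          = - (LINT x|lebesgue_on D. g x * \<phi> x))"

text \<open>Weak derivatives are unique almost everywhere on \<open>D\<close>, so that the choice of a
  representative is immaterial below.\<close>

definition weak_partial :: "(real^3) set \<Rightarrow> 3 \<Rightarrow> (real^3 \<Rightarrow> real) \<Rightarrow> real^3 \<Rightarrow> real" where
  "weak_partial D i f = (SOME g. is_weak_partial D i f g)"

definition weak_curl :: "(real^3) set \<Rightarrow> field3 \<Rightarrow> field3" where
  "weak_curl D f x =
     (let d = (\<lambda>i j. weak_partial D i (\<lambda>y. f y $ j) x)
      in vector [d 2 3 - d 3 2, d 3 1 - d 1 3, d 1 2 - d 2 1])"

definition is_weak_div :: "(real^3) set \<Rightarrow> field3 \<Rightarrow> (real^3 \<Rightarrow> real) \<Rightarrow> bool" where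
  "is_weak_div D f g \<longleftrightarrow>
     locally_integrable D g \<and>
     (\<forall>\<phi>\<in>test_functions D. (LINT x|lebesgue_on D. f x \<bullet> grad \<phi> x)
                          = - (LINT x|lebesgue_on D. g x * \<phi> x))"

definition weak_div :: "(real^3) set \<Rightarrow> field3 \<Rightarrow> real^3 \<Rightarrow> real" where
  "weak_div D f = (SOME g. is_weak_div D f g)"

text \<open>A square integrable field has no pointwise boundary values.  If its weak divergence is
  square integrable, its normal component on the boundary is defined by Green's formula, as the
  functional \<open>\<phi> \<mapsto> \<integral>\<^sub>\<Gamma> (f \<bullet> n) \<phi> = \<integral>\<^sub>D (f \<bullet> \<nabla>\<phi> + (div f) \<phi>)\<close>, where \<open>n\<close> is the outer normal and \<open>\<phi>\<close>
  is smooth up to the boundary.\<close>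

definition normal_trace :: "(real^3) set \<Rightarrow> field3 \<Rightarrow> (real^3 \<Rightarrow> real) \<Rightarrow> real" where
  "normal_trace D f \<phi> = (LINT x|lebesgue_on D. f x \<bullet> grad \<phi> x + weak_div D f x * \<phi> x)"

definition H_space :: "(real^3) set \<Rightarrow> field3 set" where
  "H_space D = {f \<in> Lp_on D 2. is_weak_div D f (\<lambda>_. 0) \<and>
                  (\<forall>\<phi>\<in>test_functions UNIV. normal_trace D f \<phi> = 0)}"

definition H12 :: "(real^3) set \<Rightarrow> field3 set" where
  "H12 D = {f \<in> Lp_on D 2. \<forall>i j. \<exists>g\<in>Lp_on D 2. is_weak_partial D i (\<lambda>x. f x $ j) g}"

definition H12_norm :: "(real^3) set \<Rightarrow> field3 \<Rightarrow> real" where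
  "H12_norm D f = sqrt ((Lp_norm D 2 f)\<^sup>2 +
     (\<Sum>i\<in>UNIV. \<Sum>j\<in>UNIV. (Lp_norm D 2 (weak_partial D i (\<lambda>x. f x $ j)))\<^sup>2))"

definition H12_0 :: "(real^3) set \<Rightarrow> field3 set" where
  "H12_0 D = {f \<in> H12 D. \<exists>\<phi>. (\<forall>n. \<phi> n \<in> test_functions D) \<and>
                (\<lambda>n. H12_norm D (\<lambda>x. \<phi> n x - f x)) \<longlonglongrightarrow> 0}"

definition V_space :: "(real^3) set \<Rightarrow> field3 set" where
  "V_space D = H12_0 D \<inter> H_space D"


subsection \<open>Functions of time with values in a seminormed function space\<close>

text \<open>In this section \<open>X\<close> is the underlying set of a function space and \<open>N\<close> its seminorm.\<close>

definition strongly_measurable_on ::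
    "real set \<Rightarrow> field3 set \<Rightarrow> (field3 \<Rightarrow> real) \<Rightarrow> (real \<Rightarrow> field3) \<Rightarrow> bool" where
  "strongly_measurable_on I X N u \<longleftrightarrow>
     (AE t in lebesgue_on I. u t \<in> X) \<and>
     (\<exists>s. (\<forall>n. simple_function (lebesgue_on I) (s n) \<and> s n ` I \<subseteq> X) \<and>
          (AE t in lebesgue_on I. (\<lambda>n. N (\<lambda>x. s n t x - u t x)) \<longlonglongrightarrow> 0))"

definition Bochner_Lp ::
    "real \<Rightarrow> real set \<Rightarrow> field3 set \<Rightarrow> (field3 \<Rightarrow> real) \<Rightarrow> (real \<Rightarrow> field3) set" where
  "Bochner_Lp p I X N = {u. strongly_measurable_on I X N u \<and>
                            integrable (lebesgue_on I) (\<lambda>t. N (u t) powr p)}"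

definition Bochner_Linf ::
    "real set \<Rightarrow> field3 set \<Rightarrow> (field3 \<Rightarrow> real) \<Rightarrow> (real \<Rightarrow> field3) set" where
  "Bochner_Linf I X N = {u. strongly_measurable_on I X N u \<and>
                            (\<exists>C. AE t in lebesgue_on I. N (u t) \<le> C)}"

definition bounded_functionals :: "field3 set \<Rightarrow> (field3 \<Rightarrow> real) \<Rightarrow> (field3 \<Rightarrow> real) set" where
  "bounded_functionals X N =
     {l. (\<forall>f\<in>X. \<forall>g\<in>X. \<forall>a b. l (\<lambda>x. a *\<^sub>R f x + b *\<^sub>R g x) = a * l f + b * l g) \<and>
         (\<exists>C. \<forall>f\<in>X. \<bar>l f\<bar> \<le> C * N f)}"

definition weakly_continuous_functions ::
    "real set \<Rightarrow> field3 set \<Rightarrow> (field3 \<Rightarrow> real) \<Rightarrow> (real \<Rightarrow> field3) set" where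
  "weakly_continuous_functions I X N = {u. (\<forall>t\<in>I. u t \<in> X) \<and>
     (\<forall>l\<in>bounded_functionals X N. continuous_on I (\<lambda>t. l (u t)))}"


subsection \<open>The operators and the notion of solution\<close>

text \<open>Elements of the dual of \<open>V\<close> are given by their action on a field \<open>\<phi>\<close> in \<open>V\<close>.\<close>

definition stokes_op :: "(real^3) set \<Rightarrow> field3 \<Rightarrow> field3 \<Rightarrow> real" where
  "stokes_op D u \<phi> = (\<Sum>i\<in>UNIV. \<Sum>j\<in>UNIV. LINT x|lebesgue_on D.
     weak_partial D i (\<lambda>y. u y $ j) x * weak_partial D i (\<lambda>y. \<phi> y $ j) x)"

definition B_op :: "(real^3) set \<Rightarrow> field3 \<Rightarrow> field3 \<Rightarrow> field3 \<Rightarrow> real" where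
  "B_op D w f \<phi> = - L2_inner D (\<lambda>x. cross3 (w x) (\<phi> x)) (weak_curl D f)"

definition curl_cross_op :: "(real^3) set \<Rightarrow> field3 \<Rightarrow> field3 \<Rightarrow> field3 \<Rightarrow> real" where
  "curl_cross_op D w g \<phi> = L2_inner D (\<lambda>x. cross3 (w x) (g x)) (weak_curl D \<phi>)"

text \<open>Solutions of \<open>\<partial>u/\<partial>t = R(t, u)\<close>, \<open>u(0) = u0\<close>, with \<open>R\<close> taking values in the dual of \<open>V\<close>.  The
  equation is understood in the sense of distributions on \<open>(0, T)\<close> with values in the dual of
  \<open>V\<close>, and \<open>H\<close> is embedded into the dual of \<open>V\<close> by means of the inner product of \<open>H\<close>.\<close>

definition is_solution ::
    "(real^3) set \<Rightarrow> real \<Rightarrow> (real \<Rightarrow> field3 \<Rightarrow> field3 \<Rightarrow> real) \<Rightarrow> field3 \<Rightarrow> (real \<Rightarrow> field3) \<Rightarrow> bool" where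
  "is_solution D T R u0 u \<longleftrightarrow>
     u \<in> Bochner_Lp 2 {0<..<T} (V_space D) (H12_norm D) \<and>
     u \<in> Bochner_Linf {0<..<T} (H_space D) (Lp_norm D 2) \<and>
     u \<in> weakly_continuous_functions {0..T} (H_space D) (Lp_norm D 2) \<and>
     (\<forall>\<psi>\<in>test_functions {0<..<T}. \<forall>\<phi>\<in>V_space D.
        - (LINT t|lebesgue_on {0<..<T}. deriv \<psi> t * L2_inner D (u t) \<phi>)
        = (LINT t|lebesgue_on {0<..<T}. \<psi> t * R t (u t) \<phi>)) \<and>
     (AE x in lebesgue_on D. u 0 x = u0 x)"

end

theory Submission
  imports Defs
begin

text \<open>
  Put \<open>K(t) = G(T - t)\<close>.  Formally the derivative of \<open>(F(t), K(t))\<close> vanishes: the two Stokes terms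
  cancel because the Stokes form is symmetric, and with
  \<open>b(w, g, f) = \<integral> (w \<times> g) \<bullet> curl f\<close> the first order term of \<open>F\<close>, tested with \<open>K\<close>, and that of \<open>K\<close>,
  tested with \<open>F\<close>, are both \<open>b(v, K, F)\<close>, with opposite signs.  The substance of the proof is the
  product rule.

  The derivative of \<open>F\<close> is in general only in \<open>L\<^sup>s(0,T;V')\<close> with some \<open>s < 2\<close>, so the duality between
  \<open>L\<^sup>2(0,T;V)\<close> and \<open>L\<^sup>2(0,T;V')\<close> does not give a meaning to its pairing with \<open>K\<close>.  What replaces
  it is that both derivatives \<open>r(t)\<close> satisfy, for every \<open>e > 0\<close>,
  \<open>|r(t)\<phi> - r(t)\<psi>| \<le> e m(t) + C\<^sub>e \<parallel>\<phi> - \<psi>\<parallel>\<^sub>V\<^sup>2\<close> with a fixed integrable \<open>m\<close>, as long as the test fields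
  stay in a fixed ball of \<open>H\<close> (\<open>rate_bound\<close>).  This is where the exponents of the hypothesis on
  \<open>v\<close> enter: \<open>w \<times> g\<close> is estimated in \<open>L\<^sup>2\<close> by the \<open>L\<^sup>3\<^sup>+\<^sup>\<delta>\<close> norm of \<open>w\<close> and the interpolated norms
  \<open>\<parallel>g\<parallel>\<^sub>H\<close> to the power \<open>\<delta>/(3+\<delta>)\<close> and \<open>\<parallel>g\<parallel>\<^sub>V\<close> to the power \<open>3/(3+\<delta>)\<close> (\<open>cross_product_estimate\<close>,
  by Hoelder's inequality and the Sobolev inequality in \<open>L\<^sup>6\<close>), and then the exponent \<open>2 + 6/\<delta>\<close>
  in time is exactly the one for which Young's inequality closes (\<open>B_drift_modulus\<close>,
  \<open>curl_drift_modulus\<close>).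

  The product rule is then a statement on Riemann sums.  Between two times \<open>s < t\<close> at which both
  paths have values in \<open>V\<close>, the increment of \<open>(F, K)\<close> is the integral of \<open>r\<^sub>F(\<tau>)K(t) + r\<^sub>K(\<tau>)F(s)\<close>,
  while \<open>r\<^sub>F(\<tau>)K(\<tau>) + r\<^sub>K(\<tau>)F(\<tau>) = 0\<close>.  Hence the increment is controlled by
  \<open>\<parallel>K(t) - K(\<tau>)\<parallel>\<^sub>V\<^sup>2\<close> and \<open>\<parallel>F(s) - F(\<tau>)\<parallel>\<^sub>V\<^sup>2\<close>, and, after a comparison of the paths with uniformly continuous
  approximations, by quantities whose sum over a well chosen partition is small: the points of
  the partition are chosen such that the error there is at most its mean value
  (\<open>partition_estimate\<close>).  So \<open>(F, K)\<close> is constant on a set of full measure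
  (\<open>evolution_pairing_AE_constant\<close>).

  To reach every \<open>t\<close>, the product of two weakly continuous paths has to be continuous, for which one
  of the paths must be strongly continuous.  The same partition estimate, applied to
  \<open>\<parallel>F(t) - F(c)\<parallel>\<^sub>H\<^sup>2\<close> with a base point \<open>c\<close> in a short interval at which \<open>\<parallel>F\<parallel>\<^sub>V\<^sup>2\<close> is at most its mean,
  gives this directly (\<open>evolution_strongly_continuous\<close>).
\<close>

section \<open>Smooth cut-off functions\<close>

lemma Ck_SucD: "Ck (Suc k) f \<Longrightarrow> Ck k f"
proof (induction k arbitrary: f)
  case 0
  then show ?case by (auto intro: differentiable_imp_continuous_on)
next
  case (Suc k)
  then show ?case by auto
qed

lemma Ck_const [simp]: "Ck k (\<lambda>_. c)"
  by (induction k arbitrary: c) auto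

lemma Ck_SucI:
  assumes "\<And>x. (f has_derivative f' x) (at x)" and "\<And>b. b \<in> Basis \<Longrightarrow> Ck k (\<lambda>x. f' x b)"
  shows "Ck (Suc k) f"
proof -
  have "frechet_derivative f (at x) = f' x" for x
    using frechet_derivative_at[OF assms(1)[of x]] by simp
  moreover have "f differentiable_on UNIV"
    using assms(1) by (auto simp: differentiable_on_def differentiable_def)
  ultimately show ?thesis using assms(2) by simp
qed

lemma Ck_SucE:
  assumes "Ck (Suc k) f"
  shows "(f has_derivative frechet_derivative f (at x)) (at x)"
    and "b \<in> Basis \<Longrightarrow> Ck k (\<lambda>x. frechet_derivative f (at x) b)"
  using assms by (auto simp: differentiable_on_def frechet_derivative_works[symmetric])

lemma Ck_add: "Ck k f \<Longrightarrow> Ck k g \<Longrightarrow> Ck k (\<lambda>x. f x + g x)"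
proof (induction k arbitrary: f g)
  case 0
  then show ?case by (auto intro: continuous_intros)
next
  case (Suc k)
  show ?case
    by (rule Ck_SucI[OF has_derivative_add[OF Ck_SucE(1)[OF Suc.prems(1)] Ck_SucE(1)[OF Suc.prems(2)]]])
      (intro Suc.IH Ck_SucE(2)[OF Suc.prems(1)] Ck_SucE(2)[OF Suc.prems(2)])
qed

lemma Ck_mult:
  fixes f g :: "'a::euclidean_space \<Rightarrow> real"
  shows "Ck k f \<Longrightarrow> Ck k g \<Longrightarrow> Ck k (\<lambda>x. f x * g x)"
proof (induction k arbitrary: f g)
  case 0
  then show ?case by (auto intro: continuous_intros)
next
  case (Suc k)
  show ?case
    by (rule Ck_SucI[OF has_derivative_mult[OF Ck_SucE(1)[OF Suc.prems(1)] Ck_SucE(1)[OF Suc.prems(2)]]])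
      (intro Ck_add Suc.IH Ck_SucE(2)[OF Suc.prems(1)] Ck_SucE(2)[OF Suc.prems(2)] Ck_SucD[OF Suc.prems(1)]
        Ck_SucD[OF Suc.prems(2)])
qed

lemma Ck_diff:
  fixes f g :: "'a::euclidean_space \<Rightarrow> real"
  shows "Ck k f \<Longrightarrow> Ck k g \<Longrightarrow> Ck k (\<lambda>x. f x - g x)"
  using Ck_add[of k f "\<lambda>x. - 1 * g x"] Ck_mult[of k "\<lambda>_. - 1" g] by simp

lemma Ck_prod:
  fixes f :: "'i \<Rightarrow> 'a::euclidean_space \<Rightarrow> real"
  shows "(\<And>i. i \<in> I \<Longrightarrow> Ck k (f i)) \<Longrightarrow> Ck k (\<lambda>x. \<Prod>i\<in>I. f i x)"
  by (induction I rule: infinite_finite_induct) (auto intro: Ck_mult)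

lemma Ck_SucI_real:
  fixes f :: "real \<Rightarrow> real"
  assumes "\<And>x. (f has_real_derivative f' x) (at x)" and "Ck k f'"
  shows "Ck (Suc k) f"
  by (rule Ck_SucI[OF assms(1)[unfolded has_field_derivative_def]]) (use assms(2) in simp)

text \<open>
  Applied with \<open>v\<close> a basis vector this makes functions of one coordinate smooth, and
  with \<open>v\<close> a real number it covers the affine substitutions on the line.
\<close>

lemma Ck_compose_inner:
  fixes \<eta> :: "real \<Rightarrow> real" and v :: "'a::euclidean_space"
  shows "Ck k \<eta> \<Longrightarrow> Ck k (\<lambda>x. \<eta> (x \<bullet> v + c))"
proof (induction k arbitrary: \<eta>)
  case 0
  then have "continuous_on UNIV \<eta>" by simp
  then show ?case
    by (auto intro!: continuous_on_compose2[of UNIV \<eta>] continuous_intros)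
next
  case (Suc k)
  let ?d = "\<lambda>y. frechet_derivative \<eta> (at y) 1"
  have lin: "frechet_derivative \<eta> (at y) z = z * ?d y" for y z
    using linear_cmul[OF has_derivative_linear[OF Ck_SucE(1)[OF Suc.prems]], of y z 1] by simp
  have d: "((\<lambda>x. \<eta> (x \<bullet> v + c)) has_derivative (\<lambda>b. (b \<bullet> v) * ?d (x \<bullet> v + c))) (at x)" for x
  proof -
    have 1: "((\<lambda>x. x \<bullet> v + c) has_derivative (\<lambda>b. b \<bullet> v)) (at x)"
      by (auto intro!: derivative_eq_intros)
    have eq: "(\<lambda>b. frechet_derivative \<eta> (at (x \<bullet> v + c)) (b \<bullet> v)) = (\<lambda>b. (b \<bullet> v) * ?d (x \<bullet> v + c))"
      by (rule ext) (rule lin)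
    show ?thesis
      using has_derivative_compose[OF 1 Ck_SucE(1)[OF Suc.prems]] unfolding eq .
  qed
  show ?case
    by (rule Ck_SucI[OF d]) (auto intro!: Ck_mult Suc.IH Ck_SucE(2)[OF Suc.prems])
qed

text \<open>
  The functions \<open>x\<^sup>-\<^sup>n exp(-1/x)\<close>, extended by zero, are considered for all
  \<open>n\<close> together because this family is closed under differentiation up to linear
  combinations.
\<close>

definition flat_exp :: "nat \<Rightarrow> real \<Rightarrow> real" where
  "flat_exp n x = (if x > 0 then inverse x ^ n * exp (- inverse x) else 0)"

text \<open>
  At the origin the difference quotient is \<open>y\<^sup>n\<^sup>+\<^sup>1 / exp y\<close> with
  \<open>y = 1/x\<close> tending to infinity.
\<close>

lemma flat_exp_DERIV:
  "(flat_exp n has_real_derivative flat_exp (n + 2) x - real n * flat_exp (n + 1) x) (at x)"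
proof -
  consider "x > 0" | "x < 0" | "x = 0" by linarith
  then show ?thesis
  proof cases
    case 1
    have pow: "inverse x ^ m = inverse x * inverse x ^ (m - Suc 0) \<or> m = 0" for m
      by (cases m) auto
    have "((\<lambda>x. inverse x ^ n * exp (- inverse x)) has_real_derivative
        flat_exp (n + 2) x - real n * flat_exp (n + 1) x) (at x)"
      using 1 pow[of "n - 1"] by (cases n) (auto intro!: derivative_eq_intros simp: flat_exp_def power2_eq_square algebra_simps)
    then show ?thesis
      by (rule DERIV_cong_ev[THEN iffD1, rotated -1])
        (use 1 in \<open>auto simp: flat_exp_def eventually_nhds intro!: exI[of _ "{0<..}"]\<close>)
  next
    case 2
    have "((\<lambda>x. 0) has_real_derivative flat_exp (n + 2) x - real n * flat_exp (n + 1) x) (at x)"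
      using 2 by (auto simp: flat_exp_def)
    then show ?thesis
      by (rule DERIV_cong_ev[THEN iffD1, rotated -1])
        (use 2 in \<open>auto simp: flat_exp_def eventually_nhds intro!: exI[of _ "{..<0}"]\<close>)
  next
    case 3
    have "((\<lambda>y. y ^ Suc n / exp y) \<longlongrightarrow> (0::real)) at_top"
      by (rule tendsto_power_div_exp_0)
    then have "((\<lambda>x. inverse x ^ Suc n / exp (inverse x)) \<longlongrightarrow> 0) (at_right (0::real))"
      by (rule filterlim_compose[OF _ filterlim_inverse_at_top_right])
    then have r: "((\<lambda>h. (flat_exp n (0 + h) - flat_exp n 0) / h) \<longlongrightarrow> 0) (at_right (0::real))"
      by (rule Lim_transform_eventually)
        (auto simp: flat_exp_def eventually_at_right_less exp_minus field_simps
          intro!: eventually_at_rightI[of 0 1])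
    have l: "((\<lambda>h. (flat_exp n (0 + h) - flat_exp n 0) / h) \<longlongrightarrow> 0) (at_left (0::real))"
      by (rule Lim_transform_eventually[OF tendsto_const])
        (auto simp: flat_exp_def intro!: eventually_at_leftI[of "-1"])
    have "((\<lambda>h. (flat_exp n (0 + h) - flat_exp n 0) / h) \<longlongrightarrow> 0) (at (0::real))"
      using l r by (simp add: filterlim_split_at)
    then show ?thesis using 3 by (simp add: DERIV_def flat_exp_def)
  qed
qed

lemma Ck_flat_exp: "Ck k (flat_exp n)"
proof (induction k arbitrary: n)
  case 0
  show ?case
    using DERIV_isCont[OF flat_exp_DERIV[of n]] by (simp add: continuous_at_imp_continuous_on)
next
  case (Suc k)
  show ?case
    by (rule Ck_SucI_real[OF flat_exp_DERIV]) (intro Ck_diff Ck_mult Ck_const Suc.IH)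
qed

text \<open>
  The primitive of the bump \<open>exp(-1/x) exp(-1/(1-x))\<close>, normalized.
\<close>

lemma smooth_step_exists:
  obtains \<sigma> \<beta> :: "real \<Rightarrow> real"
  where "\<And>k. Ck k \<sigma>" "\<And>x. (\<sigma> has_real_derivative \<beta> x) (at x)" "continuous_on UNIV \<beta>"
    "\<And>x. \<beta> x \<ge> 0" "\<And>x. x \<notin> {0..1} \<Longrightarrow> \<beta> x = 0" "\<And>x. x \<le> 0 \<Longrightarrow> \<sigma> x = 0" "\<And>x. x \<ge> 1 \<Longrightarrow> \<sigma> x = 1"
    "\<And>x. 0 \<le> \<sigma> x \<and> \<sigma> x \<le> 1"
proof -
  define b where "b x = flat_exp 0 x * flat_exp 0 (1 - x)" for x
  have Ckb: "Ck k b" for k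
    unfolding b_def
    using Ck_mult[OF Ck_flat_exp Ck_compose_inner[OF Ck_flat_exp, where v="-1::real" and c=1], of k 0 0] by simp
  have cb: "continuous_on UNIV b" using Ckb[of 0] by simp
  have bnn: "b x \<ge> 0" for x by (simp add: b_def flat_exp_def)
  have bz: "b x = 0" if "x \<le> 0 \<or> x \<ge> 1" for x using that by (auto simp: b_def flat_exp_def)
  have bpos: "b x > 0" if "0 < x" "x < 1" for x using that by (auto simp: b_def flat_exp_def)
  have "\<exists>S. \<forall>x::real. -\<infinity> < ereal x \<longrightarrow> ereal x < \<infinity> \<longrightarrow> (S has_vector_derivative b x) (at x)"
    by (rule einterval_antiderivative) (use cb in \<open>auto simp: continuous_on_eq_continuous_at\<close>)
  then obtain S where S: "(S has_real_derivative b x) (at x)" for x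
    by (auto simp: has_real_derivative_iff_has_vector_derivative)
  have mono: "S x \<le> S y" if "x \<le> y" for x y
    using DERIV_nonneg_imp_nondecreasing[OF that, of S] S bnn by blast
  have S01: "S 0 < S 1"
    by (rule DERIV_pos_imp_increasing_open[of 0 1 S])
      (use S bpos in \<open>auto intro!: DERIV_isCont continuous_at_imp_continuous_on\<close>)
  have S0: "S x = S 0" if "x \<le> 0" for x
  proof (cases "x = 0")
    case False
    with that have "x < 0" by simp
    then have "S 0 = S x"
      by (rule DERIV_isconst_end) (use S bz in \<open>auto intro!: DERIV_isCont continuous_at_imp_continuous_on\<close>, metis S bz less_imp_le)
    then show ?thesis by simp
  qed simp
  have S1: "S x = S 1" if "x \<ge> 1" for x
  proof (cases "x = 1")
    case False
    with that have "1 < x" by simp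
    then show "S x = S 1"
      by (rule DERIV_isconst_end) (use S bz in \<open>auto intro!: DERIV_isCont continuous_at_imp_continuous_on\<close>, metis S bz less_imp_le)
  qed simp
  define d where "d = S 1 - S 0"
  have d: "d > 0" using S01 by (simp add: d_def)
  show ?thesis
  proof
    show dv: "((\<lambda>x. (S x - S 0) / d) has_real_derivative b x / d) (at x)" for x
      using d by (auto intro!: derivative_eq_intros S)
    show "Ck k (\<lambda>x. (S x - S 0) / d)" for k
    proof (rule Ck_SucD, rule Ck_SucI_real[OF dv])
      show "Ck k (\<lambda>x. b x / d)"
        using Ck_mult[OF Ckb Ck_const[of k "1/d"]] by simp
    qed
    show "continuous_on UNIV (\<lambda>x. b x / d)" using cb d by (auto intro!: continuous_intros)
    show "0 \<le> (S x - S 0) / d \<and> (S x - S 0) / d \<le> 1" for x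
    proof -
      have "S 0 \<le> S x \<and> S x \<le> S 1"
        using mono[of 0 x] mono[of x 1] S0[of x] S1[of x] S01 by (metis linear less_imp_le order_refl)
      then show ?thesis using d by (auto simp: d_def)
    qed
    show "(S x - S 0) / d = 0" if "x \<le> 0" for x
      using S0[OF that] by (metis diff_self div_0)
    show "(S x - S 0) / d = 1" if "x \<ge> 1" for x
      unfolding S1[OF that] using d unfolding d_def by (metis divide_self less_numeral_extra(3))
  qed (use bnn bz d in \<open>auto\<close>)
qed

text \<open>
  Lets the domain of integration be changed as long as nothing is integrated over the difference.
\<close>

lemma lebesgue_on_integral_cong_support:
  fixes f :: "'a::euclidean_space \<Rightarrow> 'b::{banach,second_countable_topology}"
  assumes "S \<in> sets lebesgue" "S' \<in> sets lebesgue"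
    and "\<And>x. x \<in> S \<Longrightarrow> x \<in> S' \<Longrightarrow> f x = g x"
    and "\<And>x. x \<in> S \<Longrightarrow> x \<notin> S' \<Longrightarrow> f x = 0" "\<And>x. x \<in> S' \<Longrightarrow> x \<notin> S \<Longrightarrow> g x = 0"
  shows "(LINT x|lebesgue_on S. f x) = (LINT x|lebesgue_on S'. g x)"
    and "integrable (lebesgue_on S) f \<longleftrightarrow> integrable (lebesgue_on S') g"
proof -
  have "(\<lambda>x. indicator S x *\<^sub>R f x) = (\<lambda>x. indicator S' x *\<^sub>R g x)"
    using assms(3-5) by (auto simp: indicator_def fun_eq_iff)
  then show "(LINT x|lebesgue_on S. f x) = (LINT x|lebesgue_on S'. g x)"
    and "integrable (lebesgue_on S) f \<longleftrightarrow> integrable (lebesgue_on S') g"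
    using assms(1,2) by (simp_all add: integral_restrict_space integrable_restrict_space)
qed

lemma integrable_mult_bounded_measurable:
  fixes f g :: "'a \<Rightarrow> real"
  assumes "integrable M f" "g \<in> borel_measurable M" "\<And>x. \<bar>g x\<bar> \<le> B"
  shows "integrable M (\<lambda>x. f x * g x)"
proof (rule Bochner_Integration.integrable_bound)
  show "integrable M (\<lambda>x. B * f x)" using assms(1) by simp
  show "(\<lambda>x. f x * g x) \<in> borel_measurable M" using assms by auto
  have "0 \<le> B" using assms(3) abs_ge_zero order_trans by blast
  then have "norm (f x * g x) \<le> norm (B * f x)" for x
    using mult_right_mono[OF assms(3)[of x] abs_ge_zero[of "f x"]] by (simp add: abs_mult mult.commute)
  then show "AE x in M. norm (f x * g x) \<le> norm (B * f x)" by blast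
qed

lemma kernel_average:
  fixes k f :: "real \<Rightarrow> real"
  assumes k: "continuous_on {a..b} k" "\<And>x. x \<in> {a..b} \<Longrightarrow> k x \<ge> 0" "(k has_integral 1) {a..b}"
    and f: "continuous_on {a..b} f" "\<And>x. x \<in> {a..b} \<Longrightarrow> \<bar>f x - c\<bar> \<le> e"
  shows "\<bar>integral {a..b} (\<lambda>x. k x * f x) - c\<bar> \<le> e"
proof -
  have i: "(\<lambda>x. k x * f x) integrable_on {a..b}"
    by (intro integrable_continuous_real continuous_intros k f)
  have kc: "((\<lambda>x. k x * c) has_integral c) {a..b}"
    using has_integral_mult_left[OF k(3), of c] by simp
  have "integral {a..b} (\<lambda>x. k x * f x) - c = integral {a..b} (\<lambda>x. k x * f x - k x * c)"
    using integral_unique[OF kc] by (subst Henstock_Kurzweil_Integration.integral_diff[OF i]) (use kc in blast, simp)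
  also have "norm \<dots> \<le> integral {a..b} (\<lambda>x. k x * e)"
  proof (rule Henstock_Kurzweil_Integration.integral_norm_bound_integral)
    show "(\<lambda>x. k x * f x - k x * c) integrable_on {a..b}" "(\<lambda>x. k x * e) integrable_on {a..b}"
      by (intro integrable_continuous_real continuous_intros k f)+
    show "norm (k x * f x - k x * c) \<le> k x * e" if "x \<in> {a..b}" for x
      using f(2)[OF that] k(2)[OF that]
      by (simp add: right_diff_distrib[symmetric] abs_mult mult_left_mono)
  qed
  also have "\<dots> = e" using integral_unique[OF has_integral_mult_left[OF k(3), of e]] by simp
  finally show ?thesis by simp
qed

text \<open>
  The windows are differences of two steps, one rising in \<open>[s, s + 1/m]\<close> and one in
  \<open>[t - 1/m, t]\<close>.  They approximate the indicator of \<open>(s, t)\<close>, while their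
  derivatives approximate a unit mass at \<open>s\<close> minus a unit mass at \<open>t\<close>;
  both facts are needed to evaluate an equation in the sense of distributions at \<open>s\<close>
  and \<open>t\<close>.
\<close>

lemma smooth_window_exists:
  fixes s t :: real
  assumes "s < t"
  obtains w w' :: "nat \<Rightarrow> real \<Rightarrow> real"
  where "\<And>n k. Ck k (w n)" "\<And>n x. (w n has_real_derivative w' n x) (at x)"
    "\<And>n x. x \<notin> {s..t} \<Longrightarrow> w n x = 0" "\<And>n x. \<bar>w n x\<bar> \<le> 1"
    "\<And>x. (\<lambda>n. w n x) \<longlonglongrightarrow> indicator {s<..<t} x"
    "\<And>f S. continuous_on {s..t} f \<Longrightarrow> S \<in> sets lebesgue \<Longrightarrow> {s..t} \<subseteq> S
       \<Longrightarrow> (\<lambda>n. LINT x|lebesgue_on S. w' n x * f x) \<longlonglongrightarrow> f s - f t"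
proof -
  obtain \<sigma> \<beta> :: "real \<Rightarrow> real" where
    Cks: "\<And>k. Ck k \<sigma>" and ds: "\<And>x. (\<sigma> has_real_derivative \<beta> x) (at x)" and cb: "continuous_on UNIV \<beta>"
    and b0: "\<And>x. \<beta> x \<ge> 0" and bz: "\<And>x. x \<notin> {0..1} \<Longrightarrow> \<beta> x = 0"
    and s0: "\<And>x. x \<le> 0 \<Longrightarrow> \<sigma> x = 0" and s1: "\<And>x. x \<ge> 1 \<Longrightarrow> \<sigma> x = 1"
    and s01: "\<And>x. 0 \<le> \<sigma> x \<and> \<sigma> x \<le> 1"
    using smooth_step_exists by blast
  (* the two flanks of the windows must not overlap *)
  obtain N :: nat where N: "1 / (t - s) < real N" using reals_Archimedean2 by blast
  define m where "m n = real (Suc (n + N))" for n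
  have mpos: "m n > 0" for n by (simp add: m_def)
  have "1 < m n * (t - s)" for n
  proof -
    have "1 < real N * (t - s)" using N assms by (simp add: field_simps)
    also have "\<dots> \<le> m n * (t - s)" using assms by (intro mult_right_mono) (auto simp: m_def)
    finally show ?thesis .
  qed
  then have mst: "s + 1 / m n \<le> t" "s \<le> t - 1 / m n" for n
    using mpos[of n] by (auto simp: field_simps less_imp_le)
  have minf: "filterlim m at_top sequentially"
    unfolding m_def by real_asymp
  have m0: "(\<lambda>n. 1 / m n) \<longlonglongrightarrow> 0" unfolding m_def by real_asymp
  define w where "w n x = \<sigma> (m n * (x - s)) - \<sigma> (m n * (x - t) + 1)" for n x
  define w' where "w' n x = m n * \<beta> (m n * (x - s)) - m n * \<beta> (m n * (x - t) + 1)" for n x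
  have d1: "((\<lambda>x. \<sigma> (m n * (x - s))) has_real_derivative m n * \<beta> (m n * (x - s))) (at x)" for n x
  proof -
    have "((\<lambda>x. m n * (x - s)) has_real_derivative m n) (at x)" by (auto intro!: derivative_eq_intros)
    from DERIV_chain2[OF ds this] show ?thesis by (simp add: mult.commute)
  qed
  have d2: "((\<lambda>x. \<sigma> (m n * (x - t) + 1)) has_real_derivative m n * \<beta> (m n * (x - t) + 1)) (at x)" for n x
  proof -
    have "((\<lambda>x. m n * (x - t) + 1) has_real_derivative m n) (at x)" by (auto intro!: derivative_eq_intros)
    from DERIV_chain2[OF ds this] show ?thesis by (simp add: mult.commute)
  qed
  show ?thesis
  proof
    show "Ck k (w n)" for n k
    proof -
      have "Ck k (\<lambda>x. \<sigma> (x \<bullet> m n + - (m n * s)) - \<sigma> (x \<bullet> m n + (1 - m n * t)))"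
        by (intro Ck_diff Ck_compose_inner Cks)
      moreover have "(\<lambda>x. \<sigma> (x \<bullet> m n + - (m n * s)) - \<sigma> (x \<bullet> m n + (1 - m n * t))) = w n"
        by (auto simp: w_def fun_eq_iff algebra_simps)
      ultimately show ?thesis by simp
    qed
    show "(w n has_real_derivative w' n x) (at x)" for n x
      unfolding w_def w'_def by (intro DERIV_diff d1 d2)
    show "w n x = 0" if "x \<notin> {s..t}" for n x
    proof (cases "x < s")
      case True
      have "m n * (x - s) \<le> 0" using True mpos[of n] by (simp add: mult_nonneg_nonpos less_imp_le)
      moreover have "m n * (x - t) \<le> m n * (- (1 / m n))"
        using True mst(2)[of n] mpos[of n] by (intro mult_left_mono) auto
      then have "m n * (x - t) + 1 \<le> 0" using mpos[of n] by simp
      ultimately show ?thesis by (simp add: w_def s0)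
    next
      case False
      then have x: "x > t" using that by auto
      have "m n * (x - s) \<ge> m n * (1 / m n)"
        using x mst(1)[of n] mpos[of n] by (intro mult_left_mono) auto
      then have "m n * (x - s) \<ge> 1" using mpos[of n] by simp
      moreover have "m n * (x - t) \<ge> 0" using x mpos[of n] by simp
      ultimately show ?thesis by (simp add: w_def s1)
    qed
    show "\<bar>w n x\<bar> \<le> 1" for n x
      unfolding w_def abs_le_iff using s01[of "m n * (x - s)"] s01[of "m n * (x - t) + 1"] by linarith
    show "(\<lambda>n. w n x) \<longlonglongrightarrow> indicator {s<..<t} x" for x
    proof -
      have a: "(\<lambda>n. \<sigma> (m n * (x - s))) \<longlonglongrightarrow> (if x > s then 1 else 0)"
      proof (cases "x > s")
        case True
        have "\<forall>\<^sub>F n in sequentially. m n \<ge> 1 / (x - s)"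
          using minf by (simp add: filterlim_at_top)
        then have "\<forall>\<^sub>F n in sequentially. \<sigma> (m n * (x - s)) = 1"
          by eventually_elim (use True in \<open>auto simp: field_simps intro!: s1\<close>)
        then show ?thesis using True by (simp add: tendsto_eventually)
      next
        case False
        have "m n * (x - s) \<le> 0" for n
          using False mpos[of n] by (simp add: mult_nonneg_nonpos less_imp_le)
        then show ?thesis using False by (simp add: s0)
      qed
      have b: "(\<lambda>n. \<sigma> (m n * (x - t) + 1)) \<longlonglongrightarrow> (if x < t then 0 else 1)"
      proof (cases "x < t")
        case True
        have "\<forall>\<^sub>F n in sequentially. m n \<ge> 1 / (t - x)"
          using minf by (simp add: filterlim_at_top)
        then have "\<forall>\<^sub>F n in sequentially. \<sigma> (m n * (x - t) + 1) = 0"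
          by eventually_elim (use True in \<open>auto simp: field_simps intro!: s0\<close>)
        then show ?thesis using True by (simp add: tendsto_eventually)
      next
        case False
        have "m n * (x - t) + 1 \<ge> 1" for n
          using False mpos[of n] by simp
        then show ?thesis using False by (simp add: s1)
      qed
      have "(indicator {s<..<t} x :: real) = (if x > s then 1 else 0) - (if x < t then 0 else 1)"
        using assms by (auto simp: indicator_def)
      then show ?thesis
        unfolding w_def using tendsto_diff[OF a b] by simp
    qed
    fix f :: "real \<Rightarrow> real" and S :: "real set"
    assume f: "continuous_on {s..t} f" and S: "S \<in> sets lebesgue" "{s..t} \<subseteq> S"
    define p where "p n x = m n * \<beta> (m n * (x - s))" for n x
    define q where "q n x = m n * \<beta> (m n * (x - t) + 1)" for n x
    have cp: "continuous_on X (p n)" and cq: "continuous_on X (q n)" for X n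
      unfolding p_def q_def
      by (intro continuous_intros continuous_on_compose2[OF cb]; simp)+
    have pz: "p n x = 0" if "x \<notin> {s..s + 1 / m n}" for n x
      unfolding p_def using that mpos[of n] by (subst bz) (auto simp: field_simps)
    have qz: "q n x = 0" if "x \<notin> {t - 1 / m n..t}" for n x
      unfolding q_def using that mpos[of n] by (subst bz) (auto simp: field_simps)
    have p1: "(p n has_integral 1) {s..s + 1 / m n}" for n
    proof -
      have "(p n has_integral \<sigma> (m n * (s + 1 / m n - s)) - \<sigma> (m n * (s - s))) {s..s + 1 / m n}"
        unfolding p_def using mpos[of n] d1[of n]
        by (intro fundamental_theorem_of_calculus)
          (auto simp: has_real_derivative_iff_has_vector_derivative intro: has_vector_derivative_at_within less_imp_le)
      then show ?thesis using s0[of 0] s1[of 1] mpos[of n] by simp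
    qed
    have q1: "(q n has_integral 1) {t - 1 / m n..t}" for n
    proof -
      have "(q n has_integral \<sigma> (m n * (t - t) + 1) - \<sigma> (m n * (t - 1 / m n - t) + 1)) {t - 1 / m n..t}"
        unfolding q_def using mpos[of n] d2[of n]
        by (intro fundamental_theorem_of_calculus)
          (auto simp: has_real_derivative_iff_has_vector_derivative intro: has_vector_derivative_at_within less_imp_le)
      then show ?thesis using s0[of 0] s1[of 1] mpos[of n] by simp
    qed
    have sub: "{s..s + 1 / m n} \<subseteq> {s..t}" "{t - 1 / m n..t} \<subseteq> {s..t}" for n
      using mst[of n] mpos[of n] by auto
    have int: "(LINT x|lebesgue_on S. k x * f x) = integral J (\<lambda>x. k x * f x)"
        "integrable (lebesgue_on S) (\<lambda>x. k x * f x)"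
      if J: "J = {c..d}" "J \<subseteq> {s..t}" "continuous_on UNIV k" "\<And>x. x \<notin> J \<Longrightarrow> k x = 0" for J k c d
    proof -
      have J': "J \<in> sets lebesgue" using J by simp
      have JS: "J \<subseteq> S" using J(2) S(2) by blast
      have "continuous_on J (\<lambda>x. k x * f x)"
        using J f by (auto intro!: continuous_intros intro: continuous_on_subset)
      then have i: "integrable (lebesgue_on J) (\<lambda>x. k x * f x)"
        unfolding J(1) using continuous_imp_integrable_real by blast
      have c: "(LINT x|lebesgue_on S. k x * f x) = (LINT x|lebesgue_on J. k x * f x)"
          "integrable (lebesgue_on S) (\<lambda>x. k x * f x) \<longleftrightarrow> integrable (lebesgue_on J) (\<lambda>x. k x * f x)"
        using lebesgue_on_integral_cong_support[OF S(1) J', of "\<lambda>x. k x * f x" "\<lambda>x. k x * f x"] J(4) JS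
        by auto
      show "(LINT x|lebesgue_on S. k x * f x) = integral J (\<lambda>x. k x * f x)"
        using c(1) lebesgue_integral_eq_integral[OF i J'] by simp
      show "integrable (lebesgue_on S) (\<lambda>x. k x * f x)" using c i by simp
    qed
    have P: "(LINT x|lebesgue_on S. p n x * f x) = integral {s..s + 1 / m n} (\<lambda>x. p n x * f x)"
       "integrable (lebesgue_on S) (\<lambda>x. p n x * f x)" for n
      using int[OF refl sub(1) cp, of n n, OF pz] by blast+
    have Q: "(LINT x|lebesgue_on S. q n x * f x) = integral {t - 1 / m n..t} (\<lambda>x. q n x * f x)"
       "integrable (lebesgue_on S) (\<lambda>x. q n x * f x)" for n
      using int[OF refl sub(2) cq, of n n, OF qz] by blast+
    have ev: "\<forall>\<^sub>F n in sequentially. \<forall>x\<in>{s..t}. \<bar>x - z\<bar> \<le> 1 / m n \<longrightarrow> \<bar>f x - f z\<bar> \<le> e"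
      if e0: "e > 0" and z0: "z \<in> {s..t}" for z e
    proof -
      obtain d where d: "d > 0" "\<forall>x\<in>{s..t}. dist x z < d \<longrightarrow> dist (f x) (f z) < e"
        using f[unfolded continuous_on_iff, rule_format, OF z0 e0] by blast
      have "\<forall>\<^sub>F n in sequentially. 1 / m n < d"
        using m0 d(1) by (simp add: order_tendsto_iff)
      then show ?thesis
      proof eventually_elim
        case (elim n)
        show ?case
        proof (intro ballI impI)
          fix x assume "x \<in> {s..t}" "\<bar>x - z\<bar> \<le> 1 / m n"
          then have "dist x z < d" using elim by (simp add: dist_real_def)
          then show "\<bar>f x - f z\<bar> \<le> e" using d(2) \<open>x \<in> {s..t}\<close> by (auto simp: dist_real_def intro: less_imp_le)
        qed
      qed
    qed
    have Pl: "(\<lambda>n. LINT x|lebesgue_on S. p n x * f x) \<longlonglongrightarrow> f s"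
    proof (rule tendstoI)
      fix e :: real assume e: "e > 0"
      show "\<forall>\<^sub>F n in sequentially. dist (LINT x|lebesgue_on S. p n x * f x) (f s) < e"
        using ev[of "e/2" s]
      proof (rule eventually_mono)
        fix n assume h: "\<forall>x\<in>{s..t}. \<bar>x - s\<bar> \<le> 1 / m n \<longrightarrow> \<bar>f x - f s\<bar> \<le> e / 2"
        have "\<bar>integral {s..s + 1 / m n} (\<lambda>x. p n x * f x) - f s\<bar> \<le> e/2"
          using h sub(1)[of n] mpos[of n] b0 f
          by (intro kernel_average cp p1) (auto simp: p_def intro: continuous_on_subset)
        then show "dist (LINT x|lebesgue_on S. p n x * f x) (f s) < e"
          using e P(1) by (simp add: dist_real_def)
      qed (use e assms in auto)
    qed
    have Ql: "(\<lambda>n. LINT x|lebesgue_on S. q n x * f x) \<longlonglongrightarrow> f t"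
    proof (rule tendstoI)
      fix e :: real assume e: "e > 0"
      show "\<forall>\<^sub>F n in sequentially. dist (LINT x|lebesgue_on S. q n x * f x) (f t) < e"
        using ev[of "e/2" t]
      proof (rule eventually_mono)
        fix n assume h: "\<forall>x\<in>{s..t}. \<bar>x - t\<bar> \<le> 1 / m n \<longrightarrow> \<bar>f x - f t\<bar> \<le> e / 2"
        have "\<bar>integral {t - 1 / m n..t} (\<lambda>x. q n x * f x) - f t\<bar> \<le> e/2"
          using h sub(2)[of n] mpos[of n] b0 f
          by (intro kernel_average cq q1) (auto simp: q_def intro: continuous_on_subset)
        then show "dist (LINT x|lebesgue_on S. q n x * f x) (f t) < e"
          using e Q(1) by (simp add: dist_real_def)
      qed (use e assms in auto)
    qed
    have "(LINT x|lebesgue_on S. w' n x * f x)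
        = (LINT x|lebesgue_on S. p n x * f x) - (LINT x|lebesgue_on S. q n x * f x)" for n
      by (subst Bochner_Integration.integral_diff[OF P(2) Q(2), symmetric])
        (simp add: w'_def p_def q_def left_diff_distrib)
    then show "(\<lambda>n. LINT x|lebesgue_on S. w' n x * f x) \<longlonglongrightarrow> f s - f t"
      using tendsto_diff[OF Pl Ql] by simp
  qed
qed

section \<open>From tested identities to pointwise statements\<close>

text \<open>
  Test with windows that approximate the indicator of \<open>(s, t)\<close>: the side with the
  derivative tends to \<open>f t - f s\<close> as \<open>f\<close> is continuous, the other one to
  the integral of \<open>r\<close> by dominated convergence.
\<close>

lemma distributional_derivative_imp_integral:
  fixes f r :: "real \<Rightarrow> real"
  assumes f: "continuous_on {0..T} f" and r: "integrable (lebesgue_on {0<..<T}) r"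
    and eq: "\<And>\<psi>. \<psi> \<in> test_functions {0<..<T} \<Longrightarrow>
       - (LINT t|lebesgue_on {0<..<T}. deriv \<psi> t * f t) = (LINT t|lebesgue_on {0<..<T}. \<psi> t * r t)"
    and st: "0 < s" "s < t" "t < T"
  shows "f t - f s = (LINT \<tau>|lebesgue_on {s<..<t}. r \<tau>)"
proof -
  obtain w w' :: "nat \<Rightarrow> real \<Rightarrow> real" where
    Ck: "\<And>n k. Ck k (w n)" and d: "\<And>n x. (w n has_real_derivative w' n x) (at x)"
    and z: "\<And>n x. x \<notin> {s..t} \<Longrightarrow> w n x = 0" and b: "\<And>n x. \<bar>w n x\<bar> \<le> 1"
    and l: "\<And>x. (\<lambda>n. w n x) \<longlonglongrightarrow> indicator {s<..<t} x"
    and L: "\<And>f S. continuous_on {s..t} f \<Longrightarrow> S \<in> sets lebesgue \<Longrightarrow> {s..t} \<subseteq> S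
       \<Longrightarrow> (\<lambda>n. LINT x|lebesgue_on S. w' n x * f x) \<longlonglongrightarrow> f s - f t"
    using smooth_window_exists[OF st(2)] by blast
  have test: "w n \<in> test_functions {0<..<T}" for n
    unfolding test_functions_def using Ck z st
    by (auto intro!: exI[of _ "{s..t}"] simp: Ck)
  have dw: "deriv (w n) = w' n" for n
    using d by (auto simp: fun_eq_iff intro: DERIV_imp_deriv)
  have wm: "w n \<in> borel_measurable (lebesgue_on {0<..<T})" for n
    using Ck[of 0 n] by (intro continuous_imp_measurable_on_sets_lebesgue) (auto intro: continuous_on_subset)
  have "(\<lambda>n. LINT x|lebesgue_on {0<..<T}. w' n x * f x) \<longlonglongrightarrow> f s - f t"
    using st by (intro L continuous_on_subset[OF f]) auto
  then have 1: "(\<lambda>n. LINT x|lebesgue_on {0<..<T}. w n x * r x) \<longlonglongrightarrow> f t - f s"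
    using eq[OF test] tendsto_minus by (fastforce simp: dw)
  have "(\<lambda>n. LINT x|lebesgue_on {0<..<T}. w n x * r x) \<longlonglongrightarrow>
      (LINT x|lebesgue_on {0<..<T}. indicator {s<..<t} x * r x)"
  proof (rule integral_dominated_convergence[where w="\<lambda>x. \<bar>r x\<bar>"])
    show "AE x in lebesgue_on {0<..<T}. (\<lambda>n. w n x * r x) \<longlonglongrightarrow> indicator {s<..<t} x * r x"
      using l by (auto intro!: tendsto_intros)
    show "AE x in lebesgue_on {0<..<T}. norm (w n x * r x) \<le> \<bar>r x\<bar>" for n
      using b by (auto simp: abs_mult intro!: mult_left_le_one_le)
    show "(\<lambda>x. w n x * r x) \<in> borel_measurable (lebesgue_on {0<..<T})" for n
      using wm r by auto
    have "(indicator {s<..<t} :: real \<Rightarrow> real) \<in> borel_measurable (lebesgue_on {0<..<T})"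
      by (rule borel_measurable_indicator) (auto simp: sets_restrict_space intro!: image_eqI[of _ _ "{s<..<t}"] st less_trans[OF st(1)] less_trans[OF _ st(3)])
    then show "(\<lambda>x. indicator {s<..<t} x * r x) \<in> borel_measurable (lebesgue_on {0<..<T})"
      using r by auto
  qed (use r in auto)
  also have "(LINT x|lebesgue_on {0<..<T}. indicator {s<..<t} x * r x) = (LINT x|lebesgue_on {s<..<t}. r x)"
    using st by (intro lebesgue_on_integral_cong_support) auto
  finally show ?thesis using 1 LIMSEQ_unique by blast
qed

text \<open>
  The measures whose densities are the positive and the negative part of \<open>g\<close> are finite
  and agree on boxes, which generate the Borel sets and are stable under intersection; so the two
  densities agree almost everywhere.
\<close>

lemma AE_zero_if_box_integrals_zero:
  fixes g :: "'a::euclidean_space \<Rightarrow> real"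
  assumes g: "integrable lebesgue g" and z: "\<And>a b. (LINT x|lebesgue. indicator (box a b) x * g x) = 0"
  shows "AE x in lebesgue. g x = 0"
proof -
  obtain g' where g': "g' \<in> borel_measurable lborel" "AE x in lborel. g x = g' x"
    using completion_ex_borel_measurable_real[of g lborel] g by auto
  have ae: "AE x in lebesgue. g x = g' x" using g'(2) by (rule AE_completion)
  have ig': "integrable lborel g'"
  proof -
    have "integrable lebesgue g'"
      by (rule integrable_cong_AE_imp[OF g measurable_completion[OF g'(1)] ae])
    then show ?thesis using g'(1) by (simp add: integrable_completion)
  qed
  have b0: "(LINT x|lborel. indicator (box a b) x * g' x) = 0" for a b
  proof -
    have "(LINT x|lborel. indicator (box a b) x * g' x) = (LINT x|lebesgue. indicator (box a b) x * g' x)"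
      using g'(1) by (simp add: integral_completion)
    also have "\<dots> = (LINT x|lebesgue. indicator (box a b) x * g x)"
    proof (rule integral_cong_AE)
      show "(\<lambda>x. indicator (box a b) x * g' x) \<in> borel_measurable lebesgue"
        using g'(1) by (intro measurable_completion) auto
      show "(\<lambda>x. indicator (box a b) x * g x) \<in> borel_measurable lebesgue"
        using g by (intro borel_measurable_times borel_measurable_indicator) auto
    qed (use ae in auto)
    finally show ?thesis using z by simp
  qed
  define p q where "p x = ennreal (g' x)" and "q x = ennreal (- g' x)" for x
  have pq[measurable]: "p \<in> borel_measurable lborel" "q \<in> borel_measurable lborel"
    using g'(1) unfolding p_def[abs_def] q_def[abs_def] by (auto intro!: measurable_compose[OF _ measurable_ennreal])
  have ind: "ennreal (indicator A x * y) = ennreal y * indicator A x" for A :: "'a set" and x y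
    by (auto simp: indicator_def)
  have inj: "x = y" if "enn2real x = enn2real y" "x \<noteq> \<infinity>" "y \<noteq> \<infinity>" for x y :: ennreal
    using that by (cases x; cases y) auto
  have eq: "emeasure (density lborel p) (box a b) = emeasure (density lborel q) (box a b)"
    and fin: "emeasure (density lborel p) (box a b) \<noteq> \<infinity>" for a b
  proof -
    let ?f = "\<lambda>x. indicator (box a b) x * g' x"
    have i: "integrable lborel ?f"
      using integrable_mult_bounded_measurable[OF ig', of "indicator (box a b)" 1]
      by (simp add: mult.commute indicator_def)
    have P: "emeasure (density lborel p) (box a b) = (\<integral>\<^sup>+x. ennreal (?f x) \<partial>lborel)"
      by (subst emeasure_density) (auto simp: p_def ind)
    have Q: "emeasure (density lborel q) (box a b) = (\<integral>\<^sup>+x. ennreal (- ?f x) \<partial>lborel)"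
      using ind[of "box a b" _ "- g' _"] by (subst emeasure_density) (auto simp: q_def)
    have f: "(\<integral>\<^sup>+x. ennreal (?f x) \<partial>lborel) \<noteq> \<infinity>" "(\<integral>\<^sup>+x. ennreal (- ?f x) \<partial>lborel) \<noteq> \<infinity>"
      using i by (simp_all add: real_integrable_def)
    have "enn2real (\<integral>\<^sup>+x. ennreal (?f x) \<partial>lborel) = enn2real (\<integral>\<^sup>+x. ennreal (- ?f x) \<partial>lborel)"
      using b0[of a b] real_lebesgue_integral_def[OF i] by simp
    then show "emeasure (density lborel p) (box a b) = emeasure (density lborel q) (box a b)"
      unfolding P Q by (rule inj[OF _ f])
    show "emeasure (density lborel p) (box a b) \<noteq> \<infinity>" using f P by simp
  qed
  have "density lborel p = density lborel q"
  proof (rule measure_eqI_generator_eq[where E="range (\<lambda>(a, b). box a b)" and \<Omega>=UNIV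
        and A="\<lambda>n::nat. box (- (real n *\<^sub>R One)) (real n *\<^sub>R One)"])
    show "Int_stable (range (\<lambda>(a, b). box a b :: 'a set))"
      by (auto simp: Int_stable_def box_Int_box)
    show "(\<Union>n::nat. box (- (real n *\<^sub>R One)) (real n *\<^sub>R One)) = (UNIV :: 'a set)"
      by (rule UN_box_eq_UNIV)
  qed (use eq fin in \<open>auto simp: borel_eq_box\<close>)
  then have "AE x in lborel. p x = q x"
    by (rule sigma_finite_measure.density_unique[OF sigma_finite_lborel pq])
  then have "AE x in lborel. g' x = 0"
  proof (rule AE_mp, intro AE_I2 impI)
    fix x assume "p x = q x"
    then show "g' x = 0"
      unfolding p_def q_def by (cases "g' x \<ge> 0") (auto simp: ennreal_neg ennreal_eq_0_iff)
  qed
  then have "AE x in lebesgue. g' x = 0" by (rule AE_completion)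
  with ae show ?thesis by eventually_elim simp
qed

lemma test_function_zero_outside: "\<phi> \<in> test_functions S \<Longrightarrow> x \<notin> S \<Longrightarrow> \<phi> x = 0"
  unfolding test_functions_def by auto

text \<open>
  Products over the coordinates of the one dimensional windows.
\<close>

lemma box_cutoff_exists:
  fixes a b :: "'a::euclidean_space"
  assumes "cbox a b \<subseteq> D" "box a b \<noteq> {}"
  obtains \<phi> :: "nat \<Rightarrow> 'a \<Rightarrow> real"
  where "\<And>n. \<phi> n \<in> test_functions D" "\<And>n x. \<bar>\<phi> n x\<bar> \<le> 1" "\<And>n x. x \<notin> cbox a b \<Longrightarrow> \<phi> n x = 0"
    "\<And>x. (\<lambda>n. \<phi> n x) \<longlonglongrightarrow> indicator (box a b) x"
proof -
  have ab: "a \<bullet> i < b \<bullet> i" if "i \<in> Basis" for i using assms(2) that by (auto simp: box_ne_empty)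
  have "\<forall>i\<in>Basis. \<exists>w :: nat \<Rightarrow> real \<Rightarrow> real. (\<forall>n k. Ck k (w n)) \<and> (\<forall>n x. x \<notin> {a \<bullet> i..b \<bullet> i} \<longrightarrow> w n x = 0)
     \<and> (\<forall>n x. \<bar>w n x\<bar> \<le> 1) \<and> (\<forall>x. (\<lambda>n. w n x) \<longlonglongrightarrow> indicator {a \<bullet> i<..<b \<bullet> i} x)"
    (is "\<forall>i\<in>Basis. \<exists>w. ?P i w")
  proof
    fix i :: 'a assume "i \<in> Basis"
    from smooth_window_exists[OF ab[OF this]] show "\<exists>w. ?P i w" by metis
  qed
  then obtain w where w: "\<And>i. i \<in> Basis \<Longrightarrow> ?P i (w i)" by metis
  define \<phi> where "\<phi> n x = (\<Prod>i\<in>Basis. w i n (x \<bullet> i + 0))" for n x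
  have z: "\<phi> n x = 0" if "x \<notin> cbox a b" for n x
  proof -
    have "\<exists>i\<in>Basis. x \<bullet> i \<notin> {a \<bullet> i..b \<bullet> i}" using that by (auto simp: mem_box)
    then obtain i where "i \<in> Basis" "x \<bullet> i \<notin> {a \<bullet> i..b \<bullet> i}" by blast
    then show ?thesis unfolding \<phi>_def using w[of i] by (intro prod_zero bexI[of _ i]) auto
  qed
  have Ck: "Ck k (\<phi> n)" for k n
    unfolding \<phi>_def using w by (intro Ck_prod Ck_compose_inner) auto
  show ?thesis
  proof
    show "\<phi> n \<in> test_functions D" for n
      unfolding test_functions_def using Ck z assms(1) by (auto intro!: exI[of _ "cbox a b"])
    show "\<bar>\<phi> n x\<bar> \<le> 1" for n x
      unfolding \<phi>_def abs_prod using w by (intro prod_le_1) auto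
    show "(\<lambda>n. \<phi> n x) \<longlonglongrightarrow> indicator (box a b) x" for x
    proof -
      have "(\<lambda>n. \<phi> n x) \<longlonglongrightarrow> (\<Prod>i\<in>Basis. indicator {a \<bullet> i<..<b \<bullet> i} (x \<bullet> i))"
        unfolding \<phi>_def using w by (intro tendsto_prod) auto
      also have "(\<Prod>i\<in>Basis. indicator {a \<bullet> i<..<b \<bullet> i} (x \<bullet> i)) = (indicator (box a b) x :: real)"
      proof (cases "x \<in> box a b")
        case False
        then have "\<exists>i\<in>Basis. x \<bullet> i \<notin> {a \<bullet> i<..<b \<bullet> i}" by (auto simp: mem_box)
        then obtain i where "i \<in> Basis" "x \<bullet> i \<notin> {a \<bullet> i<..<b \<bullet> i}" by blast
        then show ?thesis using False by (auto intro!: prod_zero simp: indicator_def)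
      qed (auto simp: mem_box indicator_def)
      finally show ?thesis .
    qed
  qed (rule z)
qed

text \<open>
  Cut-off functions of boxes show that all integrals of \<open>g\<close> over boxes inside
  \<open>D\<close> vanish, and \<open>D\<close> is a countable union of closed boxes.
\<close>

lemma fundamental_lemma_of_variations:
  fixes g :: "real^3 \<Rightarrow> real"
  assumes D: "open D" and g: "locally_integrable D g"
    and z: "\<And>\<phi>. \<phi> \<in> test_functions D \<Longrightarrow> (LINT x|lebesgue_on D. g x * \<phi> x) = 0"
  shows "AE x in lebesgue_on D. g x = 0"
proof -
  have Dm: "D \<in> sets lebesgue" using D by (simp add: borel_open)
  have bm: "indicat_real (box a b) \<in> borel_measurable lebesgue" for a b :: "real^3"
    by (rule borel_measurable_indicator) simp
  have box0: "AE x in lebesgue. x \<in> cbox c d \<longrightarrow> g x = 0" if cd: "cbox c d \<subseteq> D" for c d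
  proof -
    have gi: "integrable (lebesgue_on (cbox c d)) g"
      using g cd by (simp add: locally_integrable_def compact_cbox)
    have gb: "integrable lebesgue (\<lambda>x. indicator (cbox c d) x * g x)"
      using gi by (simp add: integrable_restrict_space)
    have gbm: "(\<lambda>x. indicator (cbox c d) x * g x) \<in> borel_measurable lebesgue"
      using gb by (rule borel_measurable_integrable)
    define h where "h x = indicator (box c d) x * g x" for x
    have h: "integrable lebesgue h"
      using integrable_mult_bounded_measurable[OF gb bm, of c d 1]
      by (rule Bochner_Integration.integrable_cong[THEN iffD1, OF refl, rotated])
        (auto simp: h_def indicator_def subsetD[OF box_subset_cbox])
    have "(LINT x|lebesgue. indicator (box a b) x * h x) = 0" for a b
    proof -
      obtain a' b' where ab: "box a b \<inter> box c d = box a' b'"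
        using box_Int_box[of a b c d] by blast
      have eq: "indicator (box a b) x * h x = indicator (box a' b') x * g x" for x
        unfolding h_def ab[symmetric] by (auto simp: indicator_def)
      show ?thesis
      proof (cases "box a' b' = {}")
        case True
        then have "(\<lambda>x. indicator (box a b) x * h x) = (\<lambda>_. 0)" unfolding eq by simp
        then show ?thesis by simp
      next
        case False
        have sub: "cbox a' b' \<subseteq> cbox c d"
          using closure_mono[of "box a' b'" "cbox c d"] ab False box_subset_cbox[of c d]
          by (auto simp: closure_box)
        then have subD: "cbox a' b' \<subseteq> D" using cd by blast
        obtain \<phi> :: "nat \<Rightarrow> real^3 \<Rightarrow> real" where \<phi>: "\<And>n. \<phi> n \<in> test_functions D" "\<And>n x. \<bar>\<phi> n x\<bar> \<le> 1"
          "\<And>n x. x \<notin> cbox a' b' \<Longrightarrow> \<phi> n x = 0" "\<And>x. (\<lambda>n. \<phi> n x) \<longlonglongrightarrow> indicator (box a' b') x"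
          using box_cutoff_exists[OF subD False] by blast
        have \<phi>m: "\<phi> n \<in> borel_measurable lebesgue" for n
          using \<phi>(1)[of n] by (auto simp: test_functions_def dest!: spec[of _ 0] intro!: measurable_completion borel_measurable_continuous_onI)
        have int0: "(LINT x|lebesgue. \<phi> n x * (indicator (cbox c d) x * g x)) = 0" for n
        proof -
          have "(LINT x|lebesgue. \<phi> n x * (indicator (cbox c d) x * g x)) = (LINT x|lebesgue_on D. g x * \<phi> n x)"
            using Dm
            by (subst integral_restrict_space, simp, intro Bochner_Integration.integral_cong[OF refl]) (use \<phi>(3)[of _ n] sub cd in \<open>auto simp: indicator_def\<close>)
          then show ?thesis using z[OF \<phi>(1)] by simp
        qed
        have "(\<lambda>n. LINT x|lebesgue. \<phi> n x * (indicator (cbox c d) x * g x)) \<longlonglongrightarrow>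
            (LINT x|lebesgue. indicator (box a' b') x * (indicator (cbox c d) x * g x))"
        proof (rule integral_dominated_convergence[where w="\<lambda>x. norm (indicator (cbox c d) x * g x)"])
          show "(\<lambda>x. indicator (box a' b') x * (indicator (cbox c d) x * g x)) \<in> borel_measurable lebesgue"
            by (rule borel_measurable_times[OF bm gbm])
          show "(\<lambda>x. \<phi> n x * (indicator (cbox c d) x * g x)) \<in> borel_measurable lebesgue" for n
            by (rule borel_measurable_times[OF \<phi>m gbm])
          show "integrable lebesgue (\<lambda>x. norm (indicator (cbox c d) x * g x))" using gb by (rule integrable_norm)
          show "AE x in lebesgue. (\<lambda>n. \<phi> n x * (indicator (cbox c d) x * g x)) \<longlonglongrightarrow> indicator (box a' b') x * (indicator (cbox c d) x * g x)"
            using \<phi>(4) by (auto intro!: tendsto_intros)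
          show "AE x in lebesgue. norm (\<phi> n x * (indicator (cbox c d) x * g x)) \<le> norm (indicator (cbox c d) x * g x)" for n
            using \<phi>(2)[of n] by (auto simp: abs_mult intro!: mult_left_le_one_le)
        qed
        then have "(LINT x|lebesgue. indicator (box a' b') x * (indicator (cbox c d) x * g x)) = 0"
          using int0 by (simp add: LIMSEQ_const_iff)
        moreover have "indicator (box a' b') x * (indicator (cbox c d) x * g x) = indicator (box a b) x * h x" for x
          unfolding eq using sub box_subset_cbox[of a' b'] by (auto simp: indicator_def)
        ultimately show ?thesis by simp
      qed
    qed
    then have "AE x in lebesgue. h x = 0" by (rule AE_zero_if_box_integrals_zero[OF h])
    moreover have "AE x in lebesgue. x \<notin> cbox c d - box c d"
      by (rule AE_not_in) (use negligible_frontier_interval[of c d] in \<open>simp add: negligible_iff_null_sets\<close>)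
    ultimately show ?thesis by eventually_elim (auto simp: h_def indicator_def)
  qed
  obtain \<D> where \<D>: "countable \<D>" "\<D> \<subseteq> Pow D" "\<And>X. X \<in> \<D> \<Longrightarrow> \<exists>a b. X = cbox a b" "\<Union>\<D> = D"
    using open_countable_Union_open_cbox[OF D] by metis
  have "AE x in lebesgue. \<forall>X\<in>\<D>. x \<in> X \<longrightarrow> g x = 0"
  proof (subst AE_ball_countable[OF \<D>(1)], intro ballI)
    fix X assume X: "X \<in> \<D>"
    then obtain a b where "X = cbox a b" using \<D>(3) by blast
    then show "AE x in lebesgue. x \<in> X \<longrightarrow> g x = 0" using box0[of a b] X \<D>(2) by auto
  qed
  then have "AE x in lebesgue. x \<in> D \<longrightarrow> g x = 0"
    by eventually_elim (use \<D>(4) in blast)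
  then show ?thesis using Dm by (simp add: AE_restrict_space_iff)
qed

section \<open>Square integrable functions\<close>

definition sq_integrable :: "'a measure \<Rightarrow> ('a \<Rightarrow> 'b::euclidean_space) \<Rightarrow> bool" where
  "sq_integrable M f \<longleftrightarrow> f \<in> borel_measurable M \<and> integrable M (\<lambda>x. (norm (f x))\<^sup>2)"

definition l2 :: "'a measure \<Rightarrow> ('a \<Rightarrow> 'b::euclidean_space) \<Rightarrow> real" where
  "l2 M f = sqrt (LINT x|M. (norm (f x))\<^sup>2)"

lemma l2_nonneg [simp]: "l2 M f \<ge> 0" by (simp add: l2_def)

lemma l2_power2: "(l2 M f)\<^sup>2 = (LINT x|M. (norm (f x))\<^sup>2)" by (simp add: l2_def)

lemma sq_integrable_bound:
  assumes "sq_integrable M f" "g \<in> borel_measurable M" "AE x in M. norm (g x) \<le> c * norm (f x)"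
  shows "sq_integrable M g"
  unfolding sq_integrable_def
proof
  have "integrable M (\<lambda>x. c\<^sup>2 * (norm (f x))\<^sup>2)" using assms(1) by (auto simp: sq_integrable_def)
  then show "integrable M (\<lambda>x. (norm (g x))\<^sup>2)"
  proof (rule Bochner_Integration.integrable_bound)
    show "AE x in M. norm ((norm (g x))\<^sup>2) \<le> norm (c\<^sup>2 * (norm (f x))\<^sup>2)"
      using assms(3)
    proof eventually_elim
      case (elim x)
      then have "(norm (g x))\<^sup>2 \<le> (c * norm (f x))\<^sup>2" by (intro power_mono) auto
      then show ?case by (simp add: power_mult_distrib)
    qed
  qed (use assms(2) in auto)
qed (use assms in auto)

lemma integrable_norm_mult_norm:
  assumes "sq_integrable M f" "sq_integrable M g"
  shows "integrable M (\<lambda>x. norm (f x) * norm (g x))"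
proof (rule Bochner_Integration.integrable_bound)
  show "integrable M (\<lambda>x. (norm (f x))\<^sup>2 + (norm (g x))\<^sup>2)" using assms by (auto simp: sq_integrable_def)
  show "(\<lambda>x. norm (f x) * norm (g x)) \<in> borel_measurable M"
    using assms by (auto simp: sq_integrable_def)
  have "norm (f x) * norm (g x) \<le> (norm (f x))\<^sup>2 + (norm (g x))\<^sup>2" for x
  proof -
    have "2 * (norm (f x) * norm (g x)) \<le> (norm (f x))\<^sup>2 + (norm (g x))\<^sup>2"
      using sum_squares_bound[of "norm (f x)" "norm (g x)"] by (simp add: mult.assoc)
    moreover have "0 \<le> norm (f x) * norm (g x)" by simp
    ultimately show ?thesis by linarith
  qed
  then show "AE x in M. norm (norm (f x) * norm (g x)) \<le> norm ((norm (f x))\<^sup>2 + (norm (g x))\<^sup>2)" by simp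
qed

text \<open>
  The integral of \<open>(|f| - t |g|)\<^sup>2\<close> is a quadratic polynomial in \<open>t\<close>
  without negative values.
\<close>

lemma l2_Cauchy_Schwarz:
  assumes "sq_integrable M f" "sq_integrable M g"
  shows "(LINT x|M. norm (f x) * norm (g x)) \<le> l2 M f * l2 M g"
proof -
  let ?A = "LINT x|M. (norm (f x))\<^sup>2" and ?B = "LINT x|M. (norm (g x))\<^sup>2" and ?C = "LINT x|M. norm (f x) * norm (g x)"
  have i: "integrable M (\<lambda>x. (norm (f x))\<^sup>2)" "integrable M (\<lambda>x. (norm (g x))\<^sup>2)"
    "integrable M (\<lambda>x. norm (f x) * norm (g x))"
    using assms integrable_norm_mult_norm[OF assms] by (auto simp: sq_integrable_def)
  have C0: "?C \<ge> 0" by simp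
  have B0: "?B \<ge> 0" by simp
  have q: "0 \<le> ?A - 2 * t * ?C + t\<^sup>2 * ?B" for t
  proof -
    have "0 \<le> (LINT x|M. (norm (f x) - t * norm (g x))\<^sup>2)" by simp
    also have "(\<lambda>x. (norm (f x) - t * norm (g x))\<^sup>2)
        = (\<lambda>x. (norm (f x))\<^sup>2 - 2 * t * (norm (f x) * norm (g x)) + t\<^sup>2 * (norm (g x))\<^sup>2)"
      by (auto simp: power2_eq_square algebra_simps)
    also have "(LINT x|M. (norm (f x))\<^sup>2 - 2 * t * (norm (f x) * norm (g x)) + t\<^sup>2 * (norm (g x))\<^sup>2)
        = ?A - 2 * t * ?C + t\<^sup>2 * ?B"
      using i by simp
    finally show ?thesis .
  qed
  have "?C\<^sup>2 \<le> ?A * ?B"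
  proof (cases "?B = 0")
    case True
    have "?C = 0"
    proof (rule ccontr)
      assume "?C \<noteq> 0"
      then have "?C > 0" using C0 by linarith
      then show False using q[of "(?A + 1) / (2 * ?C)"] True by (simp add: field_simps)
    qed
    then show ?thesis using True by simp
  next
    case False
    then have "?B > 0" using B0 by linarith
    then show ?thesis using q[of "?C / ?B"] by (simp add: field_simps power2_eq_square)
  qed
  then have "sqrt (?C\<^sup>2) \<le> sqrt (?A * ?B)" by (rule real_sqrt_le_mono)
  then show ?thesis using C0 by (simp add: l2_def real_sqrt_mult)
qed

lemma integrable_inner_sq:
  assumes "sq_integrable M f" "sq_integrable M g"
  shows "integrable M (\<lambda>x. f x \<bullet> g x)"
proof (rule Bochner_Integration.integrable_bound[OF integrable_norm_mult_norm[OF assms]])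
  show "(\<lambda>x. f x \<bullet> g x) \<in> borel_measurable M" using assms by (auto simp: sq_integrable_def)
qed (auto simp: Cauchy_Schwarz_ineq2)

lemma l2_inner_bound:
  assumes "sq_integrable M f" "sq_integrable M g"
  shows "\<bar>LINT x|M. f x \<bullet> g x\<bar> \<le> l2 M f * l2 M g"
proof -
  have "\<bar>LINT x|M. f x \<bullet> g x\<bar> \<le> (LINT x|M. \<bar>f x \<bullet> g x\<bar>)" by (rule integral_abs_bound)
  also have "\<dots> \<le> (LINT x|M. norm (f x) * norm (g x))"
    by (intro integral_mono integrable_abs integrable_inner_sq integrable_norm_mult_norm assms Cauchy_Schwarz_ineq2)
  finally show ?thesis using l2_Cauchy_Schwarz[OF assms] by linarith
qed

lemma sq_integrable_add:
  assumes "sq_integrable M f" "sq_integrable M g"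
  shows "sq_integrable M (\<lambda>x. f x + g x)"
  unfolding sq_integrable_def
proof
  show "(\<lambda>x. f x + g x) \<in> borel_measurable M" using assms by (auto simp: sq_integrable_def)
  have "(\<lambda>x. (norm (f x + g x))\<^sup>2) = (\<lambda>x. (norm (f x))\<^sup>2 + 2 * (f x \<bullet> g x) + (norm (g x))\<^sup>2)"
    by (simp add: power2_norm_eq_inner inner_add_left inner_add_right inner_commute fun_eq_iff)
  then show "integrable M (\<lambda>x. (norm (f x + g x))\<^sup>2)"
    using assms integrable_inner_sq[OF assms] by (simp add: sq_integrable_def)
qed

lemma sq_integrable_scaleR: "sq_integrable M f \<Longrightarrow> sq_integrable M (\<lambda>x. c *\<^sub>R f x)"
  by (auto simp: sq_integrable_def power_mult_distrib)

lemma sq_integrable_diff: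
  assumes "sq_integrable M f" "sq_integrable M g"
  shows "sq_integrable M (\<lambda>x. f x - g x)"
  using sq_integrable_add[OF assms(1) sq_integrable_scaleR[OF assms(2), of "-1"]] by simp

lemma l2_triangle:
  assumes "sq_integrable M f" "sq_integrable M g"
  shows "l2 M (\<lambda>x. f x + g x) \<le> l2 M f + l2 M g"
proof (rule power2_le_imp_le)
  have i: "integrable M (\<lambda>x. (norm (f x))\<^sup>2)" "integrable M (\<lambda>x. (norm (g x))\<^sup>2)"
    "integrable M (\<lambda>x. f x \<bullet> g x)"
    using assms integrable_inner_sq[OF assms] by (auto simp: sq_integrable_def)
  have "(l2 M (\<lambda>x. f x + g x))\<^sup>2 = (LINT x|M. (norm (f x))\<^sup>2 + 2 * (f x \<bullet> g x) + (norm (g x))\<^sup>2)"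
    by (simp add: l2_power2 power2_norm_eq_inner inner_add_left inner_add_right inner_commute algebra_simps)
  also have "\<dots> = (l2 M f)\<^sup>2 + 2 * (LINT x|M. f x \<bullet> g x) + (l2 M g)\<^sup>2"
    using i by (simp add: l2_power2)
  also have "\<dots> \<le> (l2 M f + l2 M g)\<^sup>2"
    using l2_inner_bound[OF assms] by (simp add: power2_eq_square algebra_simps)
  finally show "(l2 M (\<lambda>x. f x + g x))\<^sup>2 \<le> (l2 M f + l2 M g)\<^sup>2" .
qed simp

lemma l2_scaleR: "l2 M (\<lambda>x. c *\<^sub>R f x) = \<bar>c\<bar> * l2 M f"
  by (simp add: l2_def power_mult_distrib real_sqrt_mult)

lemma l2_diff_triangle:
  assumes "sq_integrable M f" "sq_integrable M g"
  shows "l2 M (\<lambda>x. f x - g x) \<le> l2 M f + l2 M g"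
  using l2_triangle[OF assms(1) sq_integrable_scaleR[OF assms(2), of "-1"]] l2_scaleR[of M "-1" g] by simp

lemma l2_cong_AE:
  assumes "f \<in> borel_measurable M" "g \<in> borel_measurable M" "AE x in M. f x = g x"
  shows "l2 M f = l2 M g"
  unfolding l2_def using assms by (auto intro!: arg_cong[where f=sqrt] integral_cong_AE)

lemma l2_mono:
  assumes "sq_integrable M f" "sq_integrable M g" "AE x in M. norm (g x) \<le> norm (f x)"
  shows "l2 M g \<le> l2 M f"
  unfolding l2_def using assms
  by (auto simp: sq_integrable_def intro!: integral_mono_AE power_mono elim!: eventually_mono)

lemma Lp_on_2_iff: "f \<in> Lp_on D 2 \<longleftrightarrow> sq_integrable (lebesgue_on D) f"
  by (simp add: Lp_on_def sq_integrable_def)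

lemma Lp_norm_2: "Lp_norm D 2 f = l2 (lebesgue_on D) f"
  by (simp add: Lp_norm_def l2_def powr_half_sqrt)

text \<open>
  Completeness of the Lebesgue measure.
\<close>

lemma measurable_lebesgue_on_AE_cong:
  fixes f g :: "'a::euclidean_space \<Rightarrow> 'b::euclidean_space"
  assumes "S \<in> sets lebesgue" "f \<in> borel_measurable (lebesgue_on S)" "AE x in lebesgue_on S. f x = g x"
  shows "g \<in> borel_measurable (lebesgue_on S)"
proof -
  have "(\<lambda>x. indicator S x *\<^sub>R f x) \<in> borel_measurable lebesgue"
    using assms(1,2) by (simp add: borel_measurable_restrict_space_iff)
  moreover have "AE x in lebesgue. indicator S x *\<^sub>R f x = indicator S x *\<^sub>R g x"
    using assms(1,3) by (auto simp: AE_restrict_space_iff elim!: eventually_mono)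
  ultimately have "(\<lambda>x. indicator S x *\<^sub>R g x) \<in> borel_measurable lebesgue"
    by (rule borel_measurable_AE)
  then show ?thesis using assms(1) by (simp add: borel_measurable_restrict_space_iff)
qed

lemma sq_integrable_AE_cong:
  fixes f g :: "'a::euclidean_space \<Rightarrow> 'b::euclidean_space"
  assumes "S \<in> sets lebesgue" "sq_integrable (lebesgue_on S) f" "AE x in lebesgue_on S. f x = g x"
  shows "sq_integrable (lebesgue_on S) g" "l2 (lebesgue_on S) g = l2 (lebesgue_on S) f"
proof -
  have gm: "g \<in> borel_measurable (lebesgue_on S)"
    using measurable_lebesgue_on_AE_cong[OF assms(1) _ assms(3)] assms(2) by (simp add: sq_integrable_def)
  show "sq_integrable (lebesgue_on S) g"
    by (rule sq_integrable_bound[OF assms(2) gm, of 1]) (use assms(3) in \<open>auto elim!: eventually_mono\<close>)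
  show "l2 (lebesgue_on S) g = l2 (lebesgue_on S) f"
    by (rule l2_cong_AE) (use gm assms(2,3) in \<open>auto simp: sq_integrable_def elim!: eventually_mono\<close>)
qed

section \<open>Test functions and weak derivatives\<close>

lemma Ck_linear_compose:
  assumes "bounded_linear L"
  shows "Ck k f \<Longrightarrow> Ck k (\<lambda>x. L (f x))"
proof (induction k arbitrary: f)
  case 0
  then show ?case using bounded_linear.continuous_on[OF assms] by auto
next
  case (Suc k)
  show ?case
    by (rule Ck_SucI[OF bounded_linear.has_derivative[OF assms Ck_SucE(1)[OF Suc.prems]]])
      (rule Suc.IH[OF Ck_SucE(2)[OF Suc.prems]])
qed

lemma test_functionI:
  "(\<And>k. Ck k \<phi>) \<Longrightarrow> compact K \<Longrightarrow> K \<subseteq> S \<Longrightarrow> (\<And>x. x \<notin> K \<Longrightarrow> \<phi> x = 0) \<Longrightarrow> \<phi> \<in> test_functions S"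
  unfolding test_functions_def by blast

lemma test_functionE:
  assumes "\<phi> \<in> test_functions S"
  obtains K where "\<And>k. Ck k \<phi>" "compact K" "K \<subseteq> S" "\<And>x. x \<notin> K \<Longrightarrow> \<phi> x = 0"
  using assms unfolding test_functions_def by blast

lemma test_function_component:
  fixes \<phi> :: "'a::euclidean_space \<Rightarrow> real^'n"
  assumes "\<phi> \<in> test_functions D" shows "(\<lambda>x. \<phi> x $ j) \<in> test_functions D"
proof -
  obtain K where K: "\<And>k. Ck k \<phi>" "compact K" "K \<subseteq> D" "\<And>x. x \<notin> K \<Longrightarrow> \<phi> x = 0"
    using test_functionE[OF assms] by blast
  show ?thesis
    by (rule test_functionI[OF _ K(2,3)]) (simp_all add: K(4) Ck_linear_compose[OF bounded_linear_vec_nth K(1)])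
qed

lemma test_function_mono: "\<phi> \<in> test_functions D \<Longrightarrow> D \<subseteq> D' \<Longrightarrow> \<phi> \<in> test_functions D'"
  unfolding test_functions_def by blast

lemma test_function_mult:
  fixes \<phi> \<psi> :: "'a::euclidean_space \<Rightarrow> real"
  assumes "\<phi> \<in> test_functions D" "\<psi> \<in> test_functions D'"
  shows "(\<lambda>x. \<phi> x * \<psi> x) \<in> test_functions D"
proof -
  obtain K where K: "\<And>k. Ck k \<phi>" "compact K" "K \<subseteq> D" "\<And>x. x \<notin> K \<Longrightarrow> \<phi> x = 0"
    using test_functionE[OF assms(1)] by blast
  obtain K' where K': "\<And>k. Ck k \<psi>" using test_functionE[OF assms(2)] by blast
  show ?thesis
    by (rule test_functionI[OF _ K(2,3)]) (simp_all add: K(4) Ck_mult[OF K(1) K'])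
qed

lemma test_function_has_derivative:
  assumes "\<phi> \<in> test_functions D"
  shows "(\<phi> has_derivative frechet_derivative \<phi> (at x)) (at x)"
  using assms by (rule test_functionE) (rule Ck_SucE(1)[of 0])

lemma test_function_partial_deriv:
  assumes "\<phi> \<in> test_functions D"
  shows "partial_deriv i \<phi> \<in> test_functions D"
proof -
  obtain K where K: "compact K" "K \<subseteq> D" "\<And>x. x \<notin> K \<Longrightarrow> \<phi> x = 0" and c: "\<And>k. Ck k \<phi>"
    using assms by (auto simp: test_functions_def)
  have "Ck k (partial_deriv i \<phi>)" for k
    unfolding partial_deriv_def[abs_def] by (rule Ck_SucE(2)[OF c]) (auto simp: axis_in_Basis_iff)
  moreover have "partial_deriv i \<phi> x = 0" if x: "x \<notin> K" for x
  proof -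
    have "(\<phi> has_derivative (\<lambda>_. 0)) (at x)"
    proof (rule has_derivative_transform_within_open[of "\<lambda>_. 0" _ x UNIV "- K"])
      show "open (- K)" using K(1) by (simp add: compact_imp_closed open_Compl)
    qed (use x K(3) in auto)
    then have "frechet_derivative \<phi> (at x) = (\<lambda>_. 0)" by (simp add: frechet_derivative_at[symmetric])
    then show ?thesis by (simp add: partial_deriv_def)
  qed
  ultimately show ?thesis unfolding test_functions_def using K by blast
qed

lemma test_function_bounded:
  fixes \<phi> :: "'a::euclidean_space \<Rightarrow> real"
  assumes "\<phi> \<in> test_functions D"
  shows "\<exists>B. \<forall>x. \<bar>\<phi> x\<bar> \<le> B"
proof -
  obtain K where K: "compact K" "\<And>x. x \<notin> K \<Longrightarrow> \<phi> x = 0" and c: "\<And>k. Ck k \<phi>"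
    using assms by (auto simp: test_functions_def)
  have c: "continuous_on UNIV \<phi>" using c[of 0] by simp
  have "bounded (\<phi> ` K)"
    using K(1) c by (intro compact_imp_bounded compact_continuous_image) (auto intro: continuous_on_subset)
  then obtain B where B: "\<And>x. x \<in> K \<Longrightarrow> \<bar>\<phi> x\<bar> \<le> B" by (auto simp: bounded_iff)
  have "\<bar>\<phi> x\<bar> \<le> max 0 B" for x using B[of x] K(2)[of x] by (cases "x \<in> K") auto
  then show ?thesis by blast
qed

lemma test_function_borel_measurable:
  fixes \<phi> :: "'a::euclidean_space \<Rightarrow> 'b::real_normed_vector"
  assumes "\<phi> \<in> test_functions D" shows "\<phi> \<in> borel_measurable borel"
proof -
  have "\<And>k. Ck k \<phi>" using assms by (auto simp: test_functions_def)
  from this[of 0] show ?thesis by (simp add: borel_measurable_continuous_onI)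
qed

lemma borel_measurable_imp_lebesgue_on: "f \<in> borel_measurable borel \<Longrightarrow> f \<in> borel_measurable (lebesgue_on S)"
  by (intro measurable_restrict_space1 measurable_completion) simp

lemma integrable_mult_test:
  fixes \<phi> :: "real^3 \<Rightarrow> real"
  assumes D: "open D" and g: "locally_integrable D g" and \<phi>: "\<phi> \<in> test_functions D"
  shows "integrable (lebesgue_on D) (\<lambda>x. g x * \<phi> x)"
proof -
  obtain K where K: "compact K" "K \<subseteq> D" "\<And>x. x \<notin> K \<Longrightarrow> \<phi> x = 0" using \<phi> by (auto simp: test_functions_def)
  obtain B where B: "\<And>x. \<bar>\<phi> x\<bar> \<le> B" using test_function_bounded[OF \<phi>] by blast
  have Dm: "D \<in> sets lebesgue" using D by (simp add: borel_open)
  have Km: "K \<in> sets lebesgue" using K(1) by (auto dest: compact_imp_closed)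
  have "integrable (lebesgue_on K) (\<lambda>x. g x * \<phi> x)"
    using g K \<phi> by (intro integrable_mult_bounded_measurable[OF _ _ B] borel_measurable_imp_lebesgue_on
        test_function_borel_measurable[OF \<phi>]) (simp add: locally_integrable_def)
  then show ?thesis
    using lebesgue_on_integral_cong_support(2)[OF Dm Km, of "\<lambda>x. g x * \<phi> x" "\<lambda>x. g x * \<phi> x"] K by auto
qed

lemma locally_integrable_lincomb:
  "locally_integrable D f \<Longrightarrow> locally_integrable D g \<Longrightarrow> locally_integrable D (\<lambda>x. a * f x + b * g x)"
  by (auto simp: locally_integrable_def)

lemma is_weak_partial_lincomb:
  assumes D: "open D" and f: "is_weak_partial D i f f'" and g: "is_weak_partial D i g g'"
  shows "is_weak_partial D i (\<lambda>x. a * f x + b * g x) (\<lambda>x. a * f' x + b * g' x)"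
  unfolding is_weak_partial_def
proof (intro conjI ballI)
  have l: "locally_integrable D f" "locally_integrable D f'" "locally_integrable D g" "locally_integrable D g'"
    using f g by (auto simp: is_weak_partial_def)
  show "locally_integrable D (\<lambda>x. a * f x + b * g x)" "locally_integrable D (\<lambda>x. a * f' x + b * g' x)"
    using l by (auto intro: locally_integrable_lincomb)
  fix \<phi> :: "real^3 \<Rightarrow> real" assume \<phi>: "\<phi> \<in> test_functions D"
  have lin: "(LINT x|lebesgue_on D. (a * h x + b * k x) * \<psi> x)
      = a * (LINT x|lebesgue_on D. h x * \<psi> x) + b * (LINT x|lebesgue_on D. k x * \<psi> x)"
    if "locally_integrable D h" "locally_integrable D k" "\<psi> \<in> test_functions D" for h k \<psi>
  proof -
    have "(LINT x|lebesgue_on D. (a * h x + b * k x) * \<psi> x)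
       = (LINT x|lebesgue_on D. a * (h x * \<psi> x) + b * (k x * \<psi> x))"
      by (simp add: algebra_simps)
    then show ?thesis
      using integrable_mult_test[OF D that(1,3)] integrable_mult_test[OF D that(2,3)] by simp
  qed
  show "(LINT x|lebesgue_on D. (a * f x + b * g x) * partial_deriv i \<phi> x)
      = - (LINT x|lebesgue_on D. (a * f' x + b * g' x) * \<phi> x)"
    using f g \<phi> unfolding lin[OF l(1,3) test_function_partial_deriv[OF \<phi>]] lin[OF l(2,4) \<phi>]
    by (simp add: is_weak_partial_def)
qed

text \<open>
  The choice of a representative made in \<open>weak_partial\<close> is harmless because of this
  uniqueness; all linearity properties of the Sobolev space rest on it.
\<close>

lemma is_weak_partial_unique:
  assumes D: "open D" and f: "is_weak_partial D i f g" "is_weak_partial D i f h"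
  shows "AE x in lebesgue_on D. g x = h x"
proof -
  have l: "locally_integrable D g" "locally_integrable D h" using f by (auto simp: is_weak_partial_def)
  have "AE x in lebesgue_on D. 1 * g x + (- 1) * h x = 0"
  proof (rule fundamental_lemma_of_variations[OF D locally_integrable_lincomb[OF l]])
    fix \<phi> :: "real^3 \<Rightarrow> real" assume \<phi>: "\<phi> \<in> test_functions D"
    have "(LINT x|lebesgue_on D. g x * \<phi> x) = (LINT x|lebesgue_on D. h x * \<phi> x)"
      using f \<phi> by (simp add: is_weak_partial_def)
    then show "(LINT x|lebesgue_on D. (1 * g x + (- 1) * h x) * \<phi> x) = 0"
      using integrable_mult_test[OF D l(1) \<phi>] integrable_mult_test[OF D l(2) \<phi>]
      by (simp add: left_diff_distrib)
  qed
  then show ?thesis by eventually_elim simp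
qed

lemma weak_partial_AE:
  assumes "open D" "is_weak_partial D i f g"
  shows "AE x in lebesgue_on D. weak_partial D i f x = g x"
  unfolding weak_partial_def by (rule is_weak_partial_unique[OF assms(1) someI[of "is_weak_partial D i f", OF assms(2)] assms(2)])

lemma test_function_line_derivative:
  fixes F :: "real^3 \<Rightarrow> real"
  assumes F: "F \<in> test_functions D"
  shows "((\<lambda>t. F (p + t *\<^sub>R axis i 1)) has_real_derivative partial_deriv i F (p + t *\<^sub>R axis i 1)) (at t)"
proof -
  have 1: "((\<lambda>t. p + t *\<^sub>R axis i 1) has_derivative (\<lambda>t. t *\<^sub>R axis i 1)) (at t)"
    by (auto intro!: derivative_eq_intros)
  have lin: "frechet_derivative F (at y) (s *\<^sub>R axis i 1) = s * partial_deriv i F y" for y s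
    using linear_cmul[OF has_derivative_linear[OF test_function_has_derivative[OF F]]]
    by (simp add: partial_deriv_def)
  show ?thesis
    using has_derivative_compose[OF 1 test_function_has_derivative[OF F]]
    by (simp add: lin has_field_derivative_def mult_commute_abs)
qed

text \<open>
  The integral of a difference quotient vanishes since Lebesgue measure is invariant under
  translations, and the difference quotients converge boundedly to the derivative.
\<close>

lemma integral_partial_deriv_eq_0:
  fixes F :: "real^3 \<Rightarrow> real"
  assumes F: "F \<in> test_functions UNIV"
  shows "(LINT x|lborel. partial_deriv i F x) = 0"
proof -
  let ?e = "axis i 1 :: real^3"
  obtain K where K: "compact K" "\<And>x. x \<notin> K \<Longrightarrow> F x = 0" using F by (auto simp: test_functions_def)
  obtain R where R: "\<And>x. x \<in> K \<Longrightarrow> norm x \<le> R"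
    using compact_imp_bounded[OF K(1)] by (auto simp: bounded_iff)
  obtain B where B: "\<And>x. \<bar>partial_deriv i F x\<bar> \<le> B"
    using test_function_bounded[OF test_function_partial_deriv[OF F]] by blast
  have B0: "B \<ge> 0" using B[of 0] by linarith
  have Fm: "F \<in> borel_measurable lborel" using test_function_borel_measurable[OF F] by simp
  have dm: "partial_deriv i F \<in> borel_measurable lborel"
    using test_function_borel_measurable[OF test_function_partial_deriv[OF F]] by simp
  have line: "((\<lambda>t. F (x + t *\<^sub>R ?e)) has_real_derivative partial_deriv i F (x + t *\<^sub>R ?e)) (at t)" for x t
    by (rule test_function_line_derivative[OF F])
  define h where "h n = 1 / real (Suc n)" for n
  have h: "0 < h n" "h n \<le> 1" for n by (auto simp: h_def)
  have h0: "filterlim h (at 0) sequentially"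
  proof (rule filterlim_atI)
    show "h \<longlonglongrightarrow> 0" unfolding h_def by real_asymp
  qed (use h in \<open>auto simp: less_imp_neq[symmetric] intro!: always_eventually\<close>)
  define q where "q n x = (F (x + h n *\<^sub>R ?e) - F x) / h n" for n x
  have qm: "q n \<in> borel_measurable lborel" for n
    unfolding q_def using Fm by measurable
  have Fi: "integrable lborel F"
  proof -
    obtain B' where B': "\<And>x. \<bar>F x\<bar> \<le> B'" using test_function_bounded[OF F] by blast
    have Ki: "integrable lborel (indicat_real K)"
      using emeasure_compact_finite[OF K(1)] K(1) by (intro integrable_real_indicator) (auto dest: compact_imp_closed)
    have "integrable lborel (\<lambda>x. indicator K x * F x)"
      by (rule integrable_mult_bounded_measurable[OF Ki Fm B'])
    moreover have "(\<lambda>x. indicator K x * F x) = F" using K(2) by (auto simp: indicator_def fun_eq_iff)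
    ultimately show ?thesis by simp
  qed
  have sh: "integrable lborel (\<lambda>x. F (x + c))" "(LINT x|lborel. F (x + c)) = (LINT x|lborel. F x)" for c
  proof -
    have d: "distr lborel borel ((+) c) = (lborel :: (real^3) measure)" by (rule lborel_distr_plus)
    have "integrable (distr lborel borel ((+) c)) F" using Fi d by simp
    then have "integrable lborel (\<lambda>x. F (c + x))" using Fm by (subst (asm) integrable_distr_eq) auto
    then show "integrable lborel (\<lambda>x. F (x + c))" by (simp add: add.commute)
    have "(LINT x|distr lborel borel ((+) c). F x) = (LINT x|lborel. F (c + x))"
      using Fm by (intro integral_distr) auto
    then show "(LINT x|lborel. F (x + c)) = (LINT x|lborel. F x)" using d by (simp add: add.commute)
  qed
  have q0: "(LINT x|lborel. q n x) = 0" for n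
    unfolding q_def using sh Fi by simp
  have "(\<lambda>n. LINT x|lborel. q n x) \<longlonglongrightarrow> (LINT x|lborel. partial_deriv i F x)"
  proof (rule integral_dominated_convergence[where w="\<lambda>x. indicator (cball 0 (R + 1)) x * B"])
    have "integrable lborel (indicator (cball 0 (R + 1)) :: real^3 \<Rightarrow> real)"
      using emeasure_compact_finite[of "cball (0::real^3) (R+1)"] by (intro integrable_real_indicator) auto
    then show "integrable lborel (\<lambda>x::real^3. indicator (cball 0 (R + 1)) x * B)" by simp
    show "AE x in lborel. (\<lambda>n. q n x) \<longlonglongrightarrow> partial_deriv i F x"
    proof (rule AE_I2)
      fix x
      have "((\<lambda>t. (F (x + (0 + t) *\<^sub>R ?e) - F (x + 0 *\<^sub>R ?e)) / t) \<longlongrightarrow> partial_deriv i F x) (at 0)"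
        using line[of x 0] by (simp add: DERIV_def)
      from filterlim_compose[OF this h0] show "(\<lambda>n. q n x) \<longlonglongrightarrow> partial_deriv i F x"
        by (simp add: q_def)
    qed
    show "AE x in lborel. norm (q n x) \<le> indicator (cball 0 (R + 1)) x * B" for n
    proof (rule AE_I2)
      fix x
      show "norm (q n x) \<le> indicator (cball 0 (R + 1)) x * B"
      proof (cases "norm x \<le> R + 1")
        case True
        obtain t where t: "F (x + h n *\<^sub>R ?e) - F (x + 0 *\<^sub>R ?e) = (h n - 0) * partial_deriv i F (x + t *\<^sub>R ?e)"
          using MVT2[OF h(1)[of n], of "\<lambda>t. F (x + t *\<^sub>R ?e)" "\<lambda>t. partial_deriv i F (x + t *\<^sub>R ?e)", OF line] by blast
        then show ?thesis using True B[of "x + t *\<^sub>R ?e"] h(1)[of n]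
          by (simp add: q_def indicator_def)
      next
        case False
        have "norm (x + h n *\<^sub>R ?e) \<ge> norm x - norm (h n *\<^sub>R ?e)"
          by (rule norm_diff_ineq)
        then have "norm (x + h n *\<^sub>R ?e) > R" using False h[of n] by simp
        then have "x + h n *\<^sub>R ?e \<notin> K" "x \<notin> K" using R False by force+
        then show ?thesis using K(2) B0 by (simp add: q_def indicator_def)
      qed
    qed
  qed (use qm dm in auto)
  then show ?thesis using q0 by (simp add: LIMSEQ_const_iff)
qed

lemma integral_lebesgue_on_test:
  fixes F :: "real^3 \<Rightarrow> real"
  assumes "open D" "F \<in> test_functions D"
  shows "(LINT x|lebesgue_on D. F x) = (LINT x|lborel. F x)"
proof -
  have "(LINT x|lebesgue_on D. F x) = (LINT x|lebesgue_on UNIV. F x)"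
    using assms test_function_zero_outside[OF assms(2)]
    by (intro lebesgue_on_integral_cong_support) (auto simp: borel_open)
  also have "\<dots> = (LINT x|lborel. F x)"
    using test_function_borel_measurable[OF assms(2)]
    by (simp add: lebesgue_on_UNIV_eq integral_completion)
  finally show ?thesis .
qed

lemma test_function_locally_integrable:
  fixes \<phi> :: "real^3 \<Rightarrow> real"
  assumes "\<phi> \<in> test_functions S" shows "locally_integrable D \<phi>"
  unfolding locally_integrable_def
proof (intro allI impI)
  fix K assume K: "compact K \<and> K \<subseteq> D"
  have "\<And>k. Ck k \<phi>" using assms by (auto simp: test_functions_def)
  from this[of 0] have "continuous_on K \<phi>" by (auto intro: continuous_on_subset)
  then have 1: "integrable lborel (\<lambda>x. indicator K x *\<^sub>R \<phi> x)" using K by (intro borel_integrable_compact) auto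
  then have "integrable lebesgue (\<lambda>x. indicator K x *\<^sub>R \<phi> x)"
    by (subst integrable_completion) (auto dest: borel_measurable_integrable)
  then show "integrable (lebesgue_on K) \<phi>"
    using K by (subst integrable_restrict_space) (auto dest: compact_imp_closed)
qed

text \<open>
  Integration by parts: the derivative of \<open>\<phi> \<psi>\<close> has integral zero.
\<close>

lemma test_function_is_weak_partial:
  fixes \<phi> :: "real^3 \<Rightarrow> real"
  assumes D: "open D" and \<phi>: "\<phi> \<in> test_functions D"
  shows "is_weak_partial D i \<phi> (partial_deriv i \<phi>)"
  unfolding is_weak_partial_def
proof (intro conjI ballI)
  show l: "locally_integrable D \<phi>" "locally_integrable D (partial_deriv i \<phi>)"
    using \<phi> test_function_partial_deriv test_function_locally_integrable by blast+
  fix \<psi> :: "real^3 \<Rightarrow> real" assume \<psi>: "\<psi> \<in> test_functions D"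
  have pd: "partial_deriv i (\<lambda>x. \<phi> x * \<psi> x) x = \<phi> x * partial_deriv i \<psi> x + partial_deriv i \<phi> x * \<psi> x" for x
    using frechet_derivative_at[OF has_derivative_mult[OF test_function_has_derivative[OF \<phi>] test_function_has_derivative[OF \<psi>], of x]]
    by (simp add: partial_deriv_def fun_eq_iff)
  have t: "(\<lambda>x. \<phi> x * \<psi> x) \<in> test_functions D" by (rule test_function_mult[OF \<phi> \<psi>])
  have "(LINT x|lebesgue_on D. partial_deriv i (\<lambda>x. \<phi> x * \<psi> x) x) = 0"
    using integral_lebesgue_on_test[OF D test_function_partial_deriv[OF t]]
      integral_partial_deriv_eq_0[OF test_function_mono[OF t]] by simp
  then have "(LINT x|lebesgue_on D. \<phi> x * partial_deriv i \<psi> x + partial_deriv i \<phi> x * \<psi> x) = 0"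
    by (simp add: pd)
  then show "(LINT x|lebesgue_on D. \<phi> x * partial_deriv i \<psi> x) = - (LINT x|lebesgue_on D. partial_deriv i \<phi> x * \<psi> x)"
    using integrable_mult_test[OF D l(1) test_function_partial_deriv[OF \<psi>]] integrable_mult_test[OF D l(2) \<psi>]
    by simp
qed

section \<open>First order Sobolev spaces\<close>

text \<open>
  A field together with its matrix of weak derivatives, as one square integrable function.  The
  Sobolev norm is the \<open>L\<^sup>2\<close> norm of the jet, so that the seminorm properties and
  the bounds for the Stokes form are those of \<open>L\<^sup>2\<close>.
\<close>

definition jet :: "(real^3) set \<Rightarrow> field3 \<Rightarrow> real^3 \<Rightarrow> (real^3) \<times> (real^3^3)" where
  "jet D f x = (f x, \<chi> i j. weak_partial D i (\<lambda>y. f y $ j) x)"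

lemma matrix_as_sum:
  fixes a :: "'m::finite \<Rightarrow> 'n::finite \<Rightarrow> real"
  shows "(\<chi> i j. a i j) = (\<Sum>i\<in>UNIV. \<Sum>j\<in>UNIV. a i j *\<^sub>R axis i (axis j 1))"
proof -
  have "(\<Sum>i\<in>UNIV. \<Sum>j\<in>UNIV. a i j *\<^sub>R axis i (axis j (1::real))) $ k $ l = a k l" for k l
  proof -
    have "(\<Sum>i\<in>UNIV. \<Sum>j\<in>UNIV. a i j *\<^sub>R axis i (axis j (1::real))) $ k $ l
        = (\<Sum>i\<in>UNIV. \<Sum>j\<in>UNIV. if i = k then if j = l then a i j else 0 else 0)"
      by (auto simp: axis_def intro!: sum.cong)
    also have "\<dots> = (\<Sum>i\<in>UNIV. if i = k then \<Sum>j\<in>UNIV. if j = l then a i j else 0 else 0)"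
      by (intro sum.cong) auto
    also have "\<dots> = a k l" by simp
    finally show ?thesis .
  qed
  then show ?thesis by (simp add: vec_eq_iff)
qed

lemma sq_integrable_sum: "(\<And>i. i \<in> I \<Longrightarrow> sq_integrable M (f i)) \<Longrightarrow> sq_integrable M (\<lambda>x. \<Sum>i\<in>I. f i x)"
  by (induction I rule: infinite_finite_induct) (auto intro: sq_integrable_add simp: sq_integrable_def[of M "\<lambda>_. 0"])

lemma sq_integrable_scaleR_const:
  "sq_integrable M f \<Longrightarrow> sq_integrable M (\<lambda>x. f x *\<^sub>R c)" for f :: "'a \<Rightarrow> real"
  by (auto simp: sq_integrable_def power_mult_distrib)

lemma sq_integrable_Pair:
  assumes "sq_integrable M f" "sq_integrable M g"
  shows "sq_integrable M (\<lambda>x. (f x, g x))"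
  using assms by (auto simp: sq_integrable_def norm_Pair)

lemma norm_jet: "(norm (jet D f x))\<^sup>2 = (norm (f x))\<^sup>2 + (\<Sum>i\<in>UNIV. \<Sum>j\<in>UNIV. (weak_partial D i (\<lambda>y. f y $ j) x)\<^sup>2)"
proof -
  have "(norm M)\<^sup>2 = (\<Sum>i\<in>UNIV. \<Sum>j\<in>UNIV. (M $ i $ j)\<^sup>2)" for M :: "real^3^3"
    unfolding power2_norm_eq_inner inner_vec_def by (simp add: power2_eq_square)
  then show ?thesis by (simp add: jet_def norm_Pair sum_nonneg)
qed

lemma H12_D:
  assumes D: "open D" and f: "f \<in> H12 D"
  shows "sq_integrable (lebesgue_on D) f"
    and "is_weak_partial D i (\<lambda>y. f y $ j) (weak_partial D i (\<lambda>y. f y $ j))"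
    and "sq_integrable (lebesgue_on D) (weak_partial D i (\<lambda>y. f y $ j))"
proof -
  show "sq_integrable (lebesgue_on D) f" using f by (simp add: H12_def Lp_on_2_iff)
  obtain g where g: "g \<in> Lp_on D 2" "is_weak_partial D i (\<lambda>y. f y $ j) g" using f by (auto simp: H12_def)
  show "is_weak_partial D i (\<lambda>y. f y $ j) (weak_partial D i (\<lambda>y. f y $ j))"
    unfolding weak_partial_def by (rule someI[of "is_weak_partial D i (\<lambda>y. f y $ j)", OF g(2)])
  have ae: "AE x in lebesgue_on D. g x = weak_partial D i (\<lambda>y. f y $ j) x"
    using weak_partial_AE[OF D g(2)] by eventually_elim simp
  have Dm: "D \<in> sets lebesgue" using D by (simp add: borel_open)
  show "sq_integrable (lebesgue_on D) (weak_partial D i (\<lambda>y. f y $ j))"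
    by (rule sq_integrable_AE_cong(1)[OF Dm g(1)[unfolded Lp_on_2_iff] ae])
qed

lemma H12_I:
  assumes "sq_integrable (lebesgue_on D) f"
    and "\<And>i j. is_weak_partial D i (\<lambda>y. f y $ j) (w i j)" "\<And>i j. sq_integrable (lebesgue_on D) (w i j)"
  shows "f \<in> H12 D"
proof -
  have "\<exists>g\<in>Lp_on D 2. is_weak_partial D i (\<lambda>x. f x $ j) g" for i j
    by (rule bexI[of _ "w i j"]) (use assms in \<open>simp_all add: Lp_on_2_iff\<close>)
  then show ?thesis using assms(1) by (simp add: H12_def Lp_on_2_iff)
qed

lemma jet_sq_integrable:
  assumes D: "open D" and f: "f \<in> H12 D"
  shows "sq_integrable (lebesgue_on D) (jet D f)" "sq_integrable (lebesgue_on D) (\<lambda>x. snd (jet D f x))"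
proof -
  show s: "sq_integrable (lebesgue_on D) (\<lambda>x. snd (jet D f x))"
    unfolding jet_def snd_conv matrix_as_sum
    by (intro sq_integrable_sum sq_integrable_scaleR_const H12_D[OF D f])
  have "jet D f = (\<lambda>x. (f x, snd (jet D f x)))" by (simp add: jet_def fun_eq_iff)
  then show "sq_integrable (lebesgue_on D) (jet D f)"
    using sq_integrable_Pair[OF H12_D(1)[OF D f] s] by simp
qed

lemma H12_norm_jet:
  assumes D: "open D" and f: "f \<in> H12 D"
  shows "H12_norm D f = l2 (lebesgue_on D) (jet D f)"
proof -
  have i: "integrable (lebesgue_on D) (\<lambda>x. (norm (f x))\<^sup>2)"
    "\<And>i j. integrable (lebesgue_on D) (\<lambda>x. (weak_partial D i (\<lambda>y. f y $ j) x)\<^sup>2)"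
    using H12_D[OF D f] by (auto simp: sq_integrable_def)
  have "(l2 (lebesgue_on D) (jet D f))\<^sup>2 = (Lp_norm D 2 f)\<^sup>2 +
     (\<Sum>i\<in>UNIV. \<Sum>j\<in>UNIV. (Lp_norm D 2 (weak_partial D i (\<lambda>x. f x $ j)))\<^sup>2)"
    using i by (simp add: l2_power2 norm_jet Lp_norm_2)
  then show ?thesis unfolding H12_norm_def by (metis l2_nonneg real_sqrt_unique)
qed

lemma H12_norm_nonneg [simp]: "H12_norm D f \<ge> 0"
  unfolding H12_norm_def by (intro real_sqrt_ge_zero add_nonneg_nonneg sum_nonneg) auto

text \<open>
  Linearity of the jet holds only almost everywhere, as weak derivatives are chosen arbitrarily in
  their class.
\<close>

lemma H12_lincomb:
  assumes D: "open D" and f: "f \<in> H12 D" and g: "g \<in> H12 D"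
  shows "(\<lambda>x. a *\<^sub>R f x + b *\<^sub>R g x) \<in> H12 D"
    and "AE x in lebesgue_on D. jet D (\<lambda>x. a *\<^sub>R f x + b *\<^sub>R g x) x = a *\<^sub>R jet D f x + b *\<^sub>R jet D g x"
proof -
  let ?h = "\<lambda>x. a *\<^sub>R f x + b *\<^sub>R g x"
  let ?w = "\<lambda>i j x. a * weak_partial D i (\<lambda>y. f y $ j) x + b * weak_partial D i (\<lambda>y. g y $ j) x"
  have w: "is_weak_partial D i (\<lambda>y. ?h y $ j) (?w i j)" for i j
    using is_weak_partial_lincomb[OF D H12_D(2)[OF D f] H12_D(2)[OF D g]] by simp
  have s: "sq_integrable (lebesgue_on D) (?w i j)" for i j
    using sq_integrable_add[OF sq_integrable_scaleR[OF H12_D(3)[OF D f]] sq_integrable_scaleR[OF H12_D(3)[OF D g]], of a i j b i j]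
    by simp
  show "?h \<in> H12 D"
    by (rule H12_I[OF sq_integrable_add[OF sq_integrable_scaleR[OF H12_D(1)[OF D f]] sq_integrable_scaleR[OF H12_D(1)[OF D g]]] w s])
  have "AE x in lebesgue_on D. \<forall>i\<in>UNIV. \<forall>j\<in>UNIV. weak_partial D i (\<lambda>y. ?h y $ j) x = ?w i j x"
    using weak_partial_AE[OF D w] by (intro AE_finite_allI) auto
  then show "AE x in lebesgue_on D. jet D ?h x = a *\<^sub>R jet D f x + b *\<^sub>R jet D g x"
    by eventually_elim (simp add: jet_def vec_eq_iff)
qed

lemma H12_diff:
  assumes D: "open D" and f: "f \<in> H12 D" and g: "g \<in> H12 D"
  shows "(\<lambda>x. f x - g x) \<in> H12 D"
    and "AE x in lebesgue_on D. jet D (\<lambda>x. f x - g x) x = jet D f x - jet D g x"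
  using H12_lincomb[OF assms, of 1 "-1"] by simp_all

text \<open>
  Minkowski's inequality for jets, in the form of which the triangle inequalities below are
  instances.
\<close>

lemma H12_norm_lincomb:
  assumes D: "open D" and f: "f \<in> H12 D" and g: "g \<in> H12 D"
  shows "H12_norm D (\<lambda>x. a *\<^sub>R f x + b *\<^sub>R g x) \<le> \<bar>a\<bar> * H12_norm D f + \<bar>b\<bar> * H12_norm D g"
proof -
  have Dm: "D \<in> sets lebesgue" using D by (simp add: borel_open)
  note j = jet_sq_integrable(1)[OF D]
  have s: "sq_integrable (lebesgue_on D) (\<lambda>x. a *\<^sub>R jet D f x + b *\<^sub>R jet D g x)"
    by (intro sq_integrable_add sq_integrable_scaleR j f g)
  have "H12_norm D (\<lambda>x. a *\<^sub>R f x + b *\<^sub>R g x) = l2 (lebesgue_on D) (\<lambda>x. a *\<^sub>R jet D f x + b *\<^sub>R jet D g x)"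
    unfolding H12_norm_jet[OF D H12_lincomb(1)[OF assms]]
    by (rule sq_integrable_AE_cong(2)[OF Dm s]) (use H12_lincomb(2)[OF assms, of a b] in eventually_elim, simp)
  also have "\<dots> \<le> l2 (lebesgue_on D) (\<lambda>x. a *\<^sub>R jet D f x) + l2 (lebesgue_on D) (\<lambda>x. b *\<^sub>R jet D g x)"
    by (intro l2_triangle sq_integrable_scaleR j f g)
  finally show ?thesis by (simp add: l2_scaleR H12_norm_jet[OF D] f g)
qed

lemma H12_norm_diff:
  assumes D: "open D" and f: "f \<in> H12 D" and g: "g \<in> H12 D"
  shows "H12_norm D (\<lambda>x. f x - g x) \<le> H12_norm D f + H12_norm D g"
  using H12_norm_lincomb[OF assms, of 1 "-1"] by simp

lemma H12_norm_triangle_diff: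
  assumes D: "open D" and f: "f \<in> H12 D" and g: "g \<in> H12 D" and h: "h \<in> H12 D"
  shows "H12_norm D (\<lambda>x. f x - h x) \<le> H12_norm D (\<lambda>x. f x - g x) + H12_norm D (\<lambda>x. g x - h x)"
  using H12_norm_lincomb[OF D H12_diff(1)[OF D f g] H12_diff(1)[OF D g h], of 1 1] by simp

lemma H12_norm_minus_commute: "H12_norm D (\<lambda>x. f x - g x) = H12_norm D (\<lambda>x. g x - f x)"
  if D: "open D" and f: "f \<in> H12 D" and g: "g \<in> H12 D"
  using H12_norm_lincomb[OF D H12_diff(1)[OF D f g] H12_diff(1)[OF D f g], of "-1" 0]
    H12_norm_lincomb[OF D H12_diff(1)[OF D g f] H12_diff(1)[OF D g f], of "-1" 0] by simp

lemma Lp_norm_2_le_H12_norm: "Lp_norm D 2 f \<le> H12_norm D f"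
proof -
  have "(Lp_norm D 2 f)\<^sup>2 \<le> (Lp_norm D 2 f)\<^sup>2 + (\<Sum>i\<in>UNIV. \<Sum>j\<in>UNIV. (Lp_norm D 2 (weak_partial D i (\<lambda>x. f x $ j)))\<^sup>2)"
    by (simp add: sum_nonneg)
  then show ?thesis unfolding H12_norm_def by (rule real_le_rsqrt)
qed

lemma stokes_op_jet:
  assumes D: "open D" and f: "f \<in> H12 D" and g: "g \<in> H12 D"
  shows "stokes_op D f g = (LINT x|lebesgue_on D. snd (jet D f x) \<bullet> snd (jet D g x))"
proof -
  have "integrable (lebesgue_on D) (\<lambda>x. weak_partial D i (\<lambda>y. f y $ j) x * weak_partial D i (\<lambda>y. g y $ j) x)" for i j
    using integrable_inner_sq[OF H12_D(3)[OF D f] H12_D(3)[OF D g]] by simp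
  then show ?thesis
    by (simp add: stokes_op_def jet_def inner_vec_def)
qed

lemma stokes_op_commute: "stokes_op D f g = stokes_op D g f"
  by (simp add: stokes_op_def mult.commute)

lemma stokes_op_bound:
  assumes D: "open D" and f: "f \<in> H12 D" and g: "g \<in> H12 D"
  shows "\<bar>stokes_op D f g\<bar> \<le> H12_norm D f * H12_norm D g"
proof -
  have le: "l2 (lebesgue_on D) (\<lambda>x. snd (jet D h x)) \<le> H12_norm D h" if "h \<in> H12 D" for h
    unfolding H12_norm_jet[OF D that]
    by (rule l2_mono[OF jet_sq_integrable[OF D that]]) (simp add: jet_def norm_snd_le)
  have "\<bar>stokes_op D f g\<bar> \<le> l2 (lebesgue_on D) (\<lambda>x. snd (jet D f x)) * l2 (lebesgue_on D) (\<lambda>x. snd (jet D g x))"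
    unfolding stokes_op_jet[OF assms] by (intro l2_inner_bound jet_sq_integrable D f g)
  also have "\<dots> \<le> H12_norm D f * H12_norm D g"
    by (intro mult_mono le f g) auto
  finally show ?thesis .
qed

lemma stokes_op_diff_right:
  assumes D: "open D" and f: "f \<in> H12 D" and g: "g \<in> H12 D" and h: "h \<in> H12 D"
  shows "stokes_op D f (\<lambda>x. g x - h x) = stokes_op D f g - stokes_op D f h"
proof -
  note s = jet_sq_integrable(2)[OF D]
  have i: "integrable (lebesgue_on D) (\<lambda>x. snd (jet D f x) \<bullet> snd (jet D k x))" if "k \<in> H12 D" for k
    using integrable_inner_sq[OF s[OF f] s[OF that]] .
  have "stokes_op D f (\<lambda>x. g x - h x) = (LINT x|lebesgue_on D. snd (jet D f x) \<bullet> snd (jet D g x) - snd (jet D f x) \<bullet> snd (jet D h x))"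
    unfolding stokes_op_jet[OF D f H12_diff(1)[OF D g h]]
    by (intro integral_cong_AE borel_measurable_integrable[OF i] H12_diff(1) D g h Bochner_Integration.integrable_diff[THEN borel_measurable_integrable] i)
      (use H12_diff(2)[OF D g h] in \<open>auto elim!: eventually_mono simp: inner_diff_right\<close>)
  then show ?thesis using i[OF g] i[OF h] by (simp add: stokes_op_jet D f g h)
qed

lemma curl_jet:
  "weak_curl D f x = (let M = snd (jet D f x) in vector [M $ 2 $ 3 - M $ 3 $ 2, M $ 3 $ 1 - M $ 1 $ 3, M $ 1 $ 2 - M $ 2 $ 1])"
  by (simp add: weak_curl_def jet_def Let_def)

text \<open>
  The three components of the curl involve the six off-diagonal derivatives once each, and \<open>(p
  - q)\<^sup>2 \<le> 2 p\<^sup>2 + 2 q\<^sup>2\<close>.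
\<close>

lemma norm_curl_le: "norm (weak_curl D f x) \<le> 2 * norm (jet D f x)"
proof (rule power2_le_imp_le)
  define d where "d i j = weak_partial D i (\<lambda>y. f y $ j) x" for i j
  have sq: "(p - q)\<^sup>2 \<le> 2 * p\<^sup>2 + 2 * q\<^sup>2" for p q :: real
    using zero_le_power2[of "p + q"] by (simp add: power2_eq_square algebra_simps)
  have nine: "(a - b)\<^sup>2 + (c - c')\<^sup>2 + (e - e')\<^sup>2
      \<le> 2 * (p\<^sup>2 + e\<^sup>2 + c'\<^sup>2 + (e'\<^sup>2 + q\<^sup>2 + a\<^sup>2) + (c\<^sup>2 + b\<^sup>2 + r\<^sup>2))" for a b c c' e e' p q r :: real
    using sq[of a b] sq[of c c'] sq[of e e'] zero_le_power2[of p] zero_le_power2[of q] zero_le_power2[of r]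
    by argo
  have "(norm (weak_curl D f x))\<^sup>2 = (d 2 3 - d 3 2)\<^sup>2 + (d 3 1 - d 1 3)\<^sup>2 + (d 1 2 - d 2 1)\<^sup>2"
    unfolding power2_norm_eq_inner inner_vec_def sum_3
    by (simp add: weak_curl_def d_def power2_eq_square)
  also have "\<dots> \<le> 2 * (\<Sum>i\<in>UNIV. \<Sum>j\<in>UNIV. (d i j)\<^sup>2)"
    unfolding sum_3 by (rule nine)
  also have "\<dots> \<le> (2 * norm (jet D f x))\<^sup>2"
    unfolding power_mult_distrib norm_jet d_def using sum_nonneg[of UNIV "\<lambda>i. \<Sum>j\<in>UNIV. (weak_partial D i (\<lambda>y. f y $ j) x)\<^sup>2"]
      zero_le_power2[of "norm (f x)"] by (simp add: sum_nonneg)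
  finally show "(norm (weak_curl D f x))\<^sup>2 \<le> (2 * norm (jet D f x))\<^sup>2" .
qed simp

lemma weak_curl_sq_integrable:
  assumes D: "open D" and f: "f \<in> H12 D"
  shows "sq_integrable (lebesgue_on D) (weak_curl D f)" "l2 (lebesgue_on D) (weak_curl D f) \<le> 2 * H12_norm D f"
proof -
  have e: "weak_curl D f = (\<lambda>x. (weak_partial D 2 (\<lambda>y. f y $ 3) x - weak_partial D 3 (\<lambda>y. f y $ 2) x) *\<^sub>R axis 1 1
      + (weak_partial D 3 (\<lambda>y. f y $ 1) x - weak_partial D 1 (\<lambda>y. f y $ 3) x) *\<^sub>R axis 2 1
      + (weak_partial D 1 (\<lambda>y. f y $ 2) x - weak_partial D 2 (\<lambda>y. f y $ 1) x) *\<^sub>R axis 3 1)"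
    by (simp add: fun_eq_iff weak_curl_def vec_eq_iff forall_3 axis_def)
  show s: "sq_integrable (lebesgue_on D) (weak_curl D f)"
    unfolding e by (intro sq_integrable_add sq_integrable_scaleR_const sq_integrable_diff H12_D(3)[OF D f])
  have "l2 (lebesgue_on D) (weak_curl D f) \<le> l2 (lebesgue_on D) (\<lambda>x. 2 *\<^sub>R jet D f x)"
    by (rule l2_mono[OF sq_integrable_scaleR[OF jet_sq_integrable(1)[OF D f]] s]) (simp add: norm_curl_le)
  then show "l2 (lebesgue_on D) (weak_curl D f) \<le> 2 * H12_norm D f"
    by (simp add: l2_scaleR H12_norm_jet[OF D f])
qed

lemma weak_curl_diff:
  assumes D: "open D" and f: "f \<in> H12 D" and g: "g \<in> H12 D"
  shows "AE x in lebesgue_on D. weak_curl D (\<lambda>x. f x - g x) x = weak_curl D f x - weak_curl D g x"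
  using H12_diff(2)[OF assms]
  by eventually_elim (simp add: curl_jet Let_def vec_eq_iff forall_3)

lemma test_function_scalar_sq_integrable:
  fixes \<phi> :: "real^3 \<Rightarrow> real"
  assumes "open D" "\<phi> \<in> test_functions D"
  shows "sq_integrable (lebesgue_on D) \<phi>"
  using integrable_mult_test[OF assms(1) test_function_locally_integrable[OF assms(2)] assms(2)]
    borel_measurable_imp_lebesgue_on[OF test_function_borel_measurable[OF assms(2)]]
  by (simp add: sq_integrable_def power2_eq_square)

lemma vector_as_sum: "(v :: real^3) = (\<Sum>j\<in>UNIV. (v $ j) *\<^sub>R axis j 1)"
  by (simp add: vec_eq_iff forall_3 sum_3 axis_def)

lemma test_function_H12:
  assumes D: "open D" and \<phi>: "\<phi> \<in> test_functions D"
  shows "\<phi> \<in> H12 D"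
    and "AE x in lebesgue_on D. weak_partial D i (\<lambda>y. \<phi> y $ j) x = partial_deriv i (\<lambda>y. \<phi> y $ j) x"
proof -
  have w: "is_weak_partial D i (\<lambda>y. \<phi> y $ j) (partial_deriv i (\<lambda>y. \<phi> y $ j))" for i j
    by (rule test_function_is_weak_partial[OF D test_function_component[OF \<phi>]])
  have "sq_integrable (lebesgue_on D) (\<lambda>x. \<Sum>j\<in>UNIV. (\<phi> x $ j) *\<^sub>R (axis j 1 :: real^3))"
    by (intro sq_integrable_sum sq_integrable_scaleR_const test_function_scalar_sq_integrable D test_function_component \<phi>)
  then have s: "sq_integrable (lebesgue_on D) \<phi>" by (simp add: vector_as_sum[symmetric])
  show "\<phi> \<in> H12 D"
    by (rule H12_I[OF s w]) (intro test_function_scalar_sq_integrable D test_function_partial_deriv test_function_component \<phi>)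
  show "AE x in lebesgue_on D. weak_partial D i (\<lambda>y. \<phi> y $ j) x = partial_deriv i (\<lambda>y. \<phi> y $ j) x"
    by (rule weak_partial_AE[OF D w])
qed

lemma test_function_lincomb:
  fixes \<phi> \<psi> :: "'a::euclidean_space \<Rightarrow> 'b::real_normed_vector"
  assumes "\<phi> \<in> test_functions D" "\<psi> \<in> test_functions D"
  shows "(\<lambda>x. a *\<^sub>R \<phi> x + b *\<^sub>R \<psi> x) \<in> test_functions D"
proof -
  obtain K where K: "\<And>k. Ck k \<phi>" "compact K" "K \<subseteq> D" "\<And>x. x \<notin> K \<Longrightarrow> \<phi> x = 0"
    using test_functionE[OF assms(1)] by blast
  obtain K' where K': "\<And>k. Ck k \<psi>" "compact K'" "K' \<subseteq> D" "\<And>x. x \<notin> K' \<Longrightarrow> \<psi> x = 0"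
    using test_functionE[OF assms(2)] by blast
  have "Ck k (\<lambda>x. a *\<^sub>R \<phi> x + b *\<^sub>R \<psi> x)" for k
    by (intro Ck_add Ck_linear_compose[OF bounded_linear_scaleR_right] K K')
  then show ?thesis
    by (rule test_functionI[of _ "K \<union> K'"]) (use K K' in auto)
qed

lemma H12_0_H12: "f \<in> H12_0 D \<Longrightarrow> f \<in> H12 D" by (simp add: H12_0_def)

lemma H12_0_lincomb:
  assumes D: "open D" and f: "f \<in> H12_0 D" and g: "g \<in> H12_0 D"
  shows "(\<lambda>x. a *\<^sub>R f x + b *\<^sub>R g x) \<in> H12_0 D"
proof -
  obtain \<phi> where \<phi>: "\<And>n. \<phi> n \<in> test_functions D" "(\<lambda>n. H12_norm D (\<lambda>x. \<phi> n x - f x)) \<longlonglongrightarrow> 0"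
    using f by (auto simp: H12_0_def)
  obtain \<psi> where \<psi>: "\<And>n. \<psi> n \<in> test_functions D" "(\<lambda>n. H12_norm D (\<lambda>x. \<psi> n x - g x)) \<longlonglongrightarrow> 0"
    using g by (auto simp: H12_0_def)
  note fH = H12_0_H12[OF f] H12_0_H12[OF g]
  have "(\<lambda>n. H12_norm D (\<lambda>x. (a *\<^sub>R \<phi> n x + b *\<^sub>R \<psi> n x) - (a *\<^sub>R f x + b *\<^sub>R g x))) \<longlonglongrightarrow> 0"
  proof (rule tendsto_sandwich[OF _ _ tendsto_const])
    show "(\<lambda>n. \<bar>a\<bar> * H12_norm D (\<lambda>x. \<phi> n x - f x) + \<bar>b\<bar> * H12_norm D (\<lambda>x. \<psi> n x - g x)) \<longlonglongrightarrow> 0"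
      using tendsto_add[OF tendsto_mult_left[OF \<phi>(2), of "\<bar>a\<bar>"] tendsto_mult_left[OF \<psi>(2), of "\<bar>b\<bar>"]] by simp
    have "H12_norm D (\<lambda>x. (a *\<^sub>R \<phi> n x + b *\<^sub>R \<psi> n x) - (a *\<^sub>R f x + b *\<^sub>R g x))
       \<le> \<bar>a\<bar> * H12_norm D (\<lambda>x. \<phi> n x - f x) + \<bar>b\<bar> * H12_norm D (\<lambda>x. \<psi> n x - g x)" for n
      using H12_norm_lincomb[OF D H12_diff(1)[OF D test_function_H12(1)[OF D \<phi>(1)] fH(1)]
          H12_diff(1)[OF D test_function_H12(1)[OF D \<psi>(1)] fH(2)], of a n b n]
      by (simp add: algebra_simps)
    then show "\<forall>\<^sub>F n in sequentially. H12_norm D (\<lambda>x. (a *\<^sub>R \<phi> n x + b *\<^sub>R \<psi> n x) - (a *\<^sub>R f x + b *\<^sub>R g x))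
       \<le> \<bar>a\<bar> * H12_norm D (\<lambda>x. \<phi> n x - f x) + \<bar>b\<bar> * H12_norm D (\<lambda>x. \<psi> n x - g x)" by simp
  qed simp
  then show ?thesis
    unfolding H12_0_def mem_Collect_eq
    by (intro conjI exI[of _ "\<lambda>n x. a *\<^sub>R \<phi> n x + b *\<^sub>R \<psi> n x"] H12_lincomb(1)[OF D fH] allI
        test_function_lincomb[OF \<phi>(1) \<psi>(1)])
qed

lemma H12_0_diff:
  assumes D: "open D" and f: "f \<in> H12_0 D" and g: "g \<in> H12_0 D"
  shows "(\<lambda>x. f x - g x) \<in> H12_0 D"
  using H12_0_lincomb[OF assms, of 1 "-1"] by simp

section \<open>The Sobolev inequality\<close>

definition ennsqrt :: "ennreal \<Rightarrow> ennreal" where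
  "ennsqrt x = (if x = \<infinity> then \<infinity> else ennreal (sqrt (enn2real x)))"

lemma ennsqrt_power2 [simp]: "(ennsqrt x)\<^sup>2 = x"
  by (cases x) (auto simp: ennsqrt_def ennreal_power ennreal_top_eq_mult_iff power2_eq_square ennreal_mult[symmetric])

lemma measurable_ennsqrt [measurable]: "ennsqrt \<in> borel_measurable borel"
  unfolding ennsqrt_def by measurable

lemma ennreal_power2_le_imp_le: "(x::ennreal)\<^sup>2 \<le> y\<^sup>2 \<Longrightarrow> x \<le> y"
proof (cases y)
  case (real b)
  assume le: "x\<^sup>2 \<le> y\<^sup>2"
  have "x \<noteq> \<infinity>" using le real by (auto simp: top_unique power2_eq_square ennreal_mult[symmetric])
  then obtain a where a: "x = ennreal a" "a \<ge> 0" by (cases x) auto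
  have "a\<^sup>2 \<le> b\<^sup>2" using le a real by (simp add: ennreal_power)
  then have "a \<le> b" using real(1) by (rule power2_le_imp_le)
  then show "x \<le> y" using a real by (simp add: ennreal_leI)
qed simp

text \<open>
  A form of the Cauchy-Schwarz inequality that can be iterated: its conclusion has the shape of its
  hypothesis.
\<close>

lemma nn_integral_geometric_mean:
  assumes [measurable]: "A \<in> borel_measurable M" "B \<in> borel_measurable M"
    and le: "\<And>x. (J x)\<^sup>2 \<le> A x * B x"
  shows "(\<integral>\<^sup>+x. J x \<partial>M)\<^sup>2 \<le> (\<integral>\<^sup>+x. A x \<partial>M) * (\<integral>\<^sup>+x. B x \<partial>M)"
proof -
  have "J x \<le> ennsqrt (A x) * ennsqrt (B x)" for x
    by (rule ennreal_power2_le_imp_le) (simp add: power_mult_distrib le)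
  then have "(\<integral>\<^sup>+x. J x \<partial>M)\<^sup>2 \<le> (\<integral>\<^sup>+x. ennsqrt (A x) * ennsqrt (B x) \<partial>M)\<^sup>2"
    by (intro power_mono nn_integral_mono) auto
  also have "\<dots> \<le> (\<integral>\<^sup>+x. (ennsqrt (A x))\<^sup>2 \<partial>M) * (\<integral>\<^sup>+x. (ennsqrt (B x))\<^sup>2 \<partial>M)"
    by (rule Cauchy_Schwarz_nn_integral) measurable
  finally show ?thesis by simp
qed

text \<open>
  Integrate in \<open>x\<close>, then in \<open>y\<close>, then in \<open>z\<close>.  In each step
  one of the three factors does not depend on the variable of integration, and the Cauchy-Schwarz
  inequality separates the other two.
\<close>

lemma Loomis_Whitney:
  fixes U :: "real \<Rightarrow> real \<Rightarrow> real \<Rightarrow> ennreal"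
  assumes m1[measurable]: "(\<lambda>(y, z). f1 y z) \<in> borel_measurable (lborel \<Otimes>\<^sub>M lborel)"
    and m2[measurable]: "(\<lambda>(x, z). f2 x z) \<in> borel_measurable (lborel \<Otimes>\<^sub>M lborel)"
    and m3[measurable]: "(\<lambda>(x, y). f3 x y) \<in> borel_measurable (lborel \<Otimes>\<^sub>M lborel)"
    and le: "\<And>x y z. (U x y z)\<^sup>2 \<le> f1 y z * f2 x z * f3 x y"
  shows "(\<integral>\<^sup>+z. \<integral>\<^sup>+y. \<integral>\<^sup>+x. U x y z \<partial>lborel \<partial>lborel \<partial>lborel)\<^sup>2
    \<le> (\<integral>\<^sup>+z. \<integral>\<^sup>+y. f1 y z \<partial>lborel \<partial>lborel) * (\<integral>\<^sup>+z. \<integral>\<^sup>+x. f2 x z \<partial>lborel \<partial>lborel)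
      * (\<integral>\<^sup>+y. \<integral>\<^sup>+x. f3 x y \<partial>lborel \<partial>lborel)"
proof -
  define F2 where "F2 z = (\<integral>\<^sup>+x. f2 x z \<partial>lborel)" for z
  define F3 where "F3 y = (\<integral>\<^sup>+x. f3 x y \<partial>lborel)" for y
  define F1 where "F1 z = (\<integral>\<^sup>+y. f1 y z \<partial>lborel)" for z
  define n3 where "n3 = (\<integral>\<^sup>+y. F3 y \<partial>lborel)"
  have [measurable]: "F1 \<in> borel_measurable lborel" "F2 \<in> borel_measurable lborel" "F3 \<in> borel_measurable lborel"
    unfolding F1_def F2_def F3_def by measurable
  have 1: "(\<integral>\<^sup>+x. U x y z \<partial>lborel)\<^sup>2 \<le> f1 y z * F2 z * F3 y" for y z
  proof -
    have "(\<integral>\<^sup>+x. U x y z \<partial>lborel)\<^sup>2 \<le> (\<integral>\<^sup>+x. f1 y z * f2 x z \<partial>lborel) * (\<integral>\<^sup>+x. f3 x y \<partial>lborel)"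
      by (rule nn_integral_geometric_mean) (use le in \<open>auto\<close>)
    also have "(\<integral>\<^sup>+x. f1 y z * f2 x z \<partial>lborel) = f1 y z * F2 z"
      unfolding F2_def by (rule nn_integral_cmult) measurable
    finally show ?thesis by (simp add: F3_def)
  qed
  have 2: "(\<integral>\<^sup>+y. \<integral>\<^sup>+x. U x y z \<partial>lborel \<partial>lborel)\<^sup>2 \<le> F1 z * (F2 z * n3)" for z
  proof -
    have "(\<integral>\<^sup>+y. \<integral>\<^sup>+x. U x y z \<partial>lborel \<partial>lborel)\<^sup>2 \<le> (\<integral>\<^sup>+y. f1 y z * F2 z \<partial>lborel) * (\<integral>\<^sup>+y. F3 y \<partial>lborel)"
      by (rule nn_integral_geometric_mean) (use 1 in \<open>auto\<close>)
    also have "(\<integral>\<^sup>+y. f1 y z * F2 z \<partial>lborel) = F1 z * F2 z"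
      unfolding F1_def by (rule nn_integral_multc) measurable
    finally show ?thesis by (simp add: n3_def mult.assoc)
  qed
  have "(\<integral>\<^sup>+z. \<integral>\<^sup>+y. \<integral>\<^sup>+x. U x y z \<partial>lborel \<partial>lborel \<partial>lborel)\<^sup>2
      \<le> (\<integral>\<^sup>+z. F1 z \<partial>lborel) * (\<integral>\<^sup>+z. F2 z * n3 \<partial>lborel)"
    by (rule nn_integral_geometric_mean) (use 2 in \<open>auto\<close>)
  also have "(\<integral>\<^sup>+z. F2 z * n3 \<partial>lborel) = (\<integral>\<^sup>+z. F2 z \<partial>lborel) * n3"
    by (rule nn_integral_multc) measurable
  finally show ?thesis by (simp add: F1_def F2_def F3_def n3_def mult.assoc)
qed

definition point3 :: "real \<Rightarrow> real \<Rightarrow> real \<Rightarrow> real^3" where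
  "point3 x y z = x *\<^sub>R axis 1 1 + y *\<^sub>R axis 2 1 + z *\<^sub>R axis 3 1"

lemma point3_nth [simp]: "point3 x y z $ 1 = x" "point3 x y z $ 2 = y" "point3 x y z $ 3 = z"
  by (auto simp: point3_def axis_def)

lemma measurable_point3 [measurable]:
  "f \<in> borel_measurable M \<Longrightarrow> g \<in> borel_measurable M \<Longrightarrow> h \<in> borel_measurable M
    \<Longrightarrow> (\<lambda>w. point3 (f w) (g w) (h w)) \<in> borel_measurable M"
  unfolding point3_def by (intro borel_measurable_add borel_measurable_scaleR borel_measurable_const)

text \<open>
  Three iterated one dimensional integrals are needed for the Loomis-Whitney inequality, so the
  measure on \<open>real^3\<close> is identified with a product measure; it suffices to compare the
  measures of boxes.
\<close>

lemma lborel_point3: "lborel = distr (lborel :: (real \<times> real \<times> real) measure) borel (\<lambda>(z, y, x). point3 x y z)"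
proof (rule lborel_eqI)
  have m: "(\<lambda>(z, y, x). point3 x y z) \<in> borel_measurable (lborel :: (real \<times> real \<times> real) measure)"
    by (simp add: borel_prod[symmetric] split_beta')
  fix l u :: "real^3" assume le: "\<And>b. b \<in> Basis \<Longrightarrow> l \<bullet> b \<le> u \<bullet> b"
  have le': "l $ i \<le> u $ i" for i
    using le[of "axis i 1"] by (simp add: axis_in_Basis_iff inner_axis)
  have vi: "(\<lambda>(z, y, x). point3 x y z) -` box l u = box (l $ 3, l $ 2, l $ 1) (u $ 3, u $ 2, u $ 1)"
    by (auto simp: mem_box_cart forall_3 box_prod mem_box)
  have "emeasure (distr (lborel :: (real \<times> real \<times> real) measure) borel (\<lambda>(z, y, x). point3 x y z)) (box l u)
      = emeasure (lborel :: (real \<times> real \<times> real) measure) (box (l $ 3, l $ 2, l $ 1) (u $ 3, u $ 2, u $ 1))"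
    using m by (subst emeasure_distr) (auto simp: vi)
  also have "\<dots> = (\<Prod>b\<in>Basis. (u - l) \<bullet> b)"
  proof -
    have B: "(Basis :: (real^3) set) = (\<lambda>i. axis i 1) ` UNIV" by (auto simp: Basis_vec_def)
    have "(\<Prod>b\<in>Basis. (u - l) \<bullet> b) = (\<Prod>i\<in>UNIV. (u - l) \<bullet> axis i 1)"
      unfolding B by (rule prod.reindex_cong[of "\<lambda>i. axis i 1"]) (auto simp: inj_on_def axis_eq_axis)
    also have "\<dots> = (u $ 1 - l $ 1) * ((u $ 2 - l $ 2) * (u $ 3 - l $ 3))"
      unfolding UNIV_3 by (simp add: inner_axis)
    finally show ?thesis
      using le'[of 1] le'[of 2] le'[of 3]
      by (subst emeasure_lborel_box_eq) (auto simp: Basis_prod_def)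
  qed
  finally show "emeasure (distr (lborel :: (real \<times> real \<times> real) measure) borel (\<lambda>(z, y, x). point3 x y z)) (box l u) = (\<Prod>b\<in>Basis. (u - l) \<bullet> b)" .
qed simp

lemma nn_integral_point3:
  assumes [measurable]: "f \<in> borel_measurable borel"
  shows "(\<integral>\<^sup>+w. f w \<partial>lborel) = (\<integral>\<^sup>+z. \<integral>\<^sup>+y. \<integral>\<^sup>+x. f (point3 x y z) \<partial>lborel \<partial>lborel \<partial>lborel)"
proof -
  let ?g = "\<lambda>(z, y, x). f (point3 x y z)"
  have gm: "?g \<in> borel_measurable (borel :: (real \<times> real \<times> real) measure)"
    by (simp add: borel_prod[symmetric] split_beta')
  have "(\<integral>\<^sup>+w. f w \<partial>lborel) = (\<integral>\<^sup>+p. ?g p \<partial>lborel)"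
    by (subst lborel_point3, subst nn_integral_distr)
      (auto simp: borel_prod[symmetric] split_beta' case_prod_unfold)
  also have "\<dots> = (\<integral>\<^sup>+p. ?g p \<partial>(lborel \<Otimes>\<^sub>M lborel))" by (simp add: lborel_prod)
  also have "\<dots> = (\<integral>\<^sup>+z. \<integral>\<^sup>+q. ?g (z, q) \<partial>lborel \<partial>lborel)"
    by (rule lborel.nn_integral_fst[symmetric]) (use gm in \<open>simp add: lborel_prod\<close>)
  also have "\<dots> = (\<integral>\<^sup>+z. \<integral>\<^sup>+y. \<integral>\<^sup>+x. f (point3 x y z) \<partial>lborel \<partial>lborel \<partial>lborel)"
  proof (rule nn_integral_cong)
    fix z :: real
    have "(\<integral>\<^sup>+q. ?g (z, q) \<partial>lborel) = (\<integral>\<^sup>+q. ?g (z, q) \<partial>(lborel \<Otimes>\<^sub>M lborel))" by (simp add: lborel_prod)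
    also have "\<dots> = (\<integral>\<^sup>+y. \<integral>\<^sup>+x. ?g (z, (y, x)) \<partial>lborel \<partial>lborel)"
      by (rule lborel.nn_integral_fst[symmetric]) (simp add: split_beta')
    finally show "(\<integral>\<^sup>+q. ?g (z, q) \<partial>lborel) = (\<integral>\<^sup>+y. \<integral>\<^sup>+x. f (point3 x y z) \<partial>lborel \<partial>lborel)" by simp
  qed
  finally show ?thesis .
qed

text \<open>
  The fundamental theorem of calculus for \<open>g\<^sup>4\<close>, started outside of the support.
\<close>

lemma fourth_power_le_integral:
  fixes g g' :: "real \<Rightarrow> real"
  assumes d: "\<And>t. (g has_real_derivative g' t) (at t)" and c: "continuous_on UNIV g'"
    and z: "\<And>t. \<bar>t\<bar> > R \<Longrightarrow> g t = 0"
  shows "ennreal (g x ^ 4) \<le> (\<integral>\<^sup>+t. ennreal (4 * \<bar>g t\<bar> ^ 3 * \<bar>g' t\<bar>) \<partial>lborel)"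
proof -
  define a where "a = - (\<bar>R\<bar> + \<bar>x\<bar> + 1)"
  have a: "a \<le> x" "g a = 0" using z[of a] by (auto simp: a_def)
  have cg: "continuous_on UNIV g" using d by (auto intro!: continuous_at_imp_continuous_on DERIV_isCont)
  have D: "((\<lambda>t. g t ^ 4) has_real_derivative 4 * g t ^ 3 * g' t) (at t)" for t
    by (auto intro!: derivative_eq_intros d simp: algebra_simps)
  have cc: "continuous_on S (\<lambda>t. 4 * g t ^ 3 * g' t)" for S
    by (intro continuous_intros continuous_on_subset[OF cg] continuous_on_subset[OF c]) auto
  have i: "integrable lborel (\<lambda>t. indicator {a..x} t *\<^sub>R (4 * g t ^ 3 * g' t))"
    by (rule borel_integrable_compact[OF _ cc]) simp
  have vd: "((\<lambda>t. g t ^ 4) has_vector_derivative 4 * g t ^ 3 * g' t) (at t within {a..x})" for t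
    using D[of t] by (auto simp: has_real_derivative_iff_has_vector_derivative intro: has_vector_derivative_at_within)
  have "g x ^ 4 = (LINT t|lborel. indicator {a..x} t *\<^sub>R (4 * g t ^ 3 * g' t))"
    using integral_FTC_Icc[OF a(1) vd cc] a(2) by simp
  then have "ennreal (g x ^ 4) = ennreal (norm (LINT t|lborel. indicator {a..x} t *\<^sub>R (4 * g t ^ 3 * g' t)))"
    by (metis abs_of_nonneg real_norm_def zero_le_even_power even_numeral)
  also have "\<dots> \<le> (\<integral>\<^sup>+t. ennreal (norm (indicator {a..x} t *\<^sub>R (4 * g t ^ 3 * g' t))) \<partial>lborel)"
    by (rule integral_norm_bound_ennreal[OF i])
  also have "\<dots> \<le> (\<integral>\<^sup>+t. ennreal (4 * \<bar>g t\<bar> ^ 3 * \<bar>g' t\<bar>) \<partial>lborel)"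
    by (intro nn_integral_mono ennreal_leI) (auto simp: indicator_def abs_mult power_abs)
  finally show ?thesis .
qed

lemma test_function_continuous: "\<phi> \<in> test_functions D \<Longrightarrow> continuous_on UNIV \<phi>"
  using test_functionE[of \<phi> D] Ck.simps(1)[of \<phi>] by metis

lemma test_function_fourth_power_le:
  fixes u :: "real^3 \<Rightarrow> real"
  assumes u: "u \<in> test_functions D"
  shows "ennreal (u (p + s *\<^sub>R axis i 1) ^ 4)
    \<le> (\<integral>\<^sup>+t. ennreal (4 * \<bar>u (p + t *\<^sub>R axis i 1)\<bar> ^ 3 * \<bar>partial_deriv i u (p + t *\<^sub>R axis i 1)\<bar>) \<partial>lborel)"
proof -
  obtain K where K: "compact K" "\<And>x. x \<notin> K \<Longrightarrow> u x = 0" using test_functionE[OF u] by metis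
  obtain R where R: "\<And>x. x \<in> K \<Longrightarrow> norm x \<le> R"
    using compact_imp_bounded[OF K(1)] by (auto simp: bounded_iff)
  have z: "u (p + t *\<^sub>R axis i 1) = 0" if "\<bar>t\<bar> > R + norm p" for t
  proof -
    have "norm (t *\<^sub>R axis i 1 + p) \<ge> norm (t *\<^sub>R axis i (1::real)) - norm p" by (rule norm_diff_ineq)
    then have "norm (p + t *\<^sub>R axis i 1) > R" using that by (simp add: add.commute)
    then show ?thesis using R K(2) by (meson not_le)
  qed
  show ?thesis
    by (rule fourth_power_le_integral[OF test_function_line_derivative[OF u] _ z])
      (auto intro!: continuous_on_compose2[OF test_function_continuous[OF test_function_partial_deriv[OF u]]] continuous_intros)
qed

text \<open>
  The classical argument of Gagliardo and Nirenberg.  The fourth power of \<open>u\<close> is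
  bounded by its derivative integrated along each of the three coordinate lines; these bounds depend
  on two variables each, so the Loomis-Whitney inequality gives \<open>S\<^sup>2 \<le> G\<^sub>1
  G\<^sub>2 G\<^sub>3\<close> for \<open>S = \<integral> u\<^sup>6\<close>.  By the Cauchy-Schwarz
  inequality \<open>G\<^sub>i\<^sup>2 \<le> 16 S E\<^sub>i\<close> with \<open>E\<^sub>i\<close> the
  energy of the \<open>i\<close>-th derivative, and \<open>S\<close> cancels, being finite.
\<close>

lemma Sobolev_test_function:
  fixes u :: "real^3 \<Rightarrow> real"
  assumes u: "u \<in> test_functions D"
  shows "(\<integral>\<^sup>+x. ennreal (u x ^ 6) \<partial>lborel)
    \<le> 4096 * ((\<integral>\<^sup>+x. ennreal ((partial_deriv 1 u x)\<^sup>2) \<partial>lborel)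
      * (\<integral>\<^sup>+x. ennreal ((partial_deriv 2 u x)\<^sup>2) \<partial>lborel)
      * (\<integral>\<^sup>+x. ennreal ((partial_deriv 3 u x)\<^sup>2) \<partial>lborel))"
proof -
  have um[measurable]: "u \<in> borel_measurable borel" by (rule test_function_borel_measurable[OF u])
  have pm[measurable]: "partial_deriv i u \<in> borel_measurable borel" for i
    by (rule test_function_borel_measurable[OF test_function_partial_deriv[OF u]])
  define g where "g i w = ennreal (4 * \<bar>u w\<bar> ^ 3 * \<bar>partial_deriv i u w\<bar>)" for i w
  have gm[measurable]: "g i \<in> borel_measurable borel" for i unfolding g_def by measurable
  define S where "S = (\<integral>\<^sup>+x. ennreal (u x ^ 6) \<partial>lborel)"
  define G where "G i = (\<integral>\<^sup>+x. g i x \<partial>lborel)" for i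
  define E where "E i = (\<integral>\<^sup>+x. ennreal ((partial_deriv i u x)\<^sup>2) \<partial>lborel)" for i
  have G: "(G i)\<^sup>2 \<le> 16 * S * E i" for i
  proof -
    have "(G i)\<^sup>2 \<le> (\<integral>\<^sup>+x. 16 * ennreal (u x ^ 6) \<partial>lborel) * E i"
      unfolding G_def E_def
    proof (rule nn_integral_geometric_mean)
      fix x
      have "(g i x)\<^sup>2 = ennreal ((4 * \<bar>u x\<bar> ^ 3 * \<bar>partial_deriv i u x\<bar>)\<^sup>2)"
        unfolding g_def by (rule ennreal_power) simp
      also have "(4 * \<bar>u x\<bar> ^ 3 * \<bar>partial_deriv i u x\<bar>)\<^sup>2 = (16 * u x ^ 6) * (partial_deriv i u x)\<^sup>2"
        by (simp add: power_mult_distrib power_mult[symmetric] power_even_abs)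
      also have "ennreal \<dots> = 16 * ennreal (u x ^ 6) * ennreal ((partial_deriv i u x)\<^sup>2)"
        by (simp add: ennreal_mult)
      finally show "(g i x)\<^sup>2 \<le> 16 * ennreal (u x ^ 6) * ennreal ((partial_deriv i u x)\<^sup>2)" by simp
    qed measurable
    also have "(\<integral>\<^sup>+x. 16 * ennreal (u x ^ 6) \<partial>lborel) = 16 * S"
      unfolding S_def by (rule nn_integral_cmult) measurable
    finally show ?thesis .
  qed
  have p1: "ennreal (u (point3 x y z) ^ 4) \<le> (\<integral>\<^sup>+t. g 1 (point3 t y z) \<partial>lborel)" for x y z
    using test_function_fourth_power_le[OF u, of "point3 0 y z" x 1] by (simp add: g_def point3_def algebra_simps)
  have p2: "ennreal (u (point3 x y z) ^ 4) \<le> (\<integral>\<^sup>+t. g 2 (point3 x t z) \<partial>lborel)" for x y z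
    using test_function_fourth_power_le[OF u, of "point3 x 0 z" y 2] by (simp add: g_def point3_def algebra_simps)
  have p3: "ennreal (u (point3 x y z) ^ 4) \<le> (\<integral>\<^sup>+t. g 3 (point3 x y t) \<partial>lborel)" for x y z
    using test_function_fourth_power_le[OF u, of "point3 x y 0" z 3] by (simp add: g_def point3_def algebra_simps)
  have S: "S = (\<integral>\<^sup>+z. \<integral>\<^sup>+y. \<integral>\<^sup>+x. ennreal (u (point3 x y z) ^ 6) \<partial>lborel \<partial>lborel \<partial>lborel)"
    unfolding S_def by (rule nn_integral_point3) measurable
  have "S\<^sup>2 \<le> (\<integral>\<^sup>+z. \<integral>\<^sup>+y. \<integral>\<^sup>+x. g 1 (point3 x y z) \<partial>lborel \<partial>lborel \<partial>lborel)
     * (\<integral>\<^sup>+z. \<integral>\<^sup>+x. \<integral>\<^sup>+y. g 2 (point3 x y z) \<partial>lborel \<partial>lborel \<partial>lborel)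
     * (\<integral>\<^sup>+y. \<integral>\<^sup>+x. \<integral>\<^sup>+z. g 3 (point3 x y z) \<partial>lborel \<partial>lborel \<partial>lborel)"
    unfolding S
  proof (rule Loomis_Whitney)
    fix x y z :: real
    let ?u = "u (point3 x y z)"
    have "(ennreal (?u ^ 6))\<^sup>2 = ennreal (?u ^ 4) * ennreal (?u ^ 4) * ennreal (?u ^ 4)"
      by (simp add: ennreal_power ennreal_mult[symmetric] power_mult[symmetric] power_add[symmetric])
    also have "\<dots> \<le> (\<integral>\<^sup>+t. g 1 (point3 t y z) \<partial>lborel) * (\<integral>\<^sup>+t. g 2 (point3 x t z) \<partial>lborel) * (\<integral>\<^sup>+t. g 3 (point3 x y t) \<partial>lborel)"
      by (intro mult_mono p1 p2 p3) auto
    finally show "(ennreal (?u ^ 6))\<^sup>2 \<le> (\<integral>\<^sup>+x. g 1 (point3 x y z) \<partial>lborel) * (\<integral>\<^sup>+y. g 2 (point3 x y z) \<partial>lborel) * (\<integral>\<^sup>+z. g 3 (point3 x y z) \<partial>lborel)" .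
  qed (simp_all add: split_beta')
  also have "(\<integral>\<^sup>+z. \<integral>\<^sup>+y. \<integral>\<^sup>+x. g 1 (point3 x y z) \<partial>lborel \<partial>lborel \<partial>lborel) = G 1"
    unfolding G_def by (rule nn_integral_point3[symmetric]) measurable
  also have "(\<integral>\<^sup>+z. \<integral>\<^sup>+x. \<integral>\<^sup>+y. g 2 (point3 x y z) \<partial>lborel \<partial>lborel \<partial>lborel)
      = (\<integral>\<^sup>+z. \<integral>\<^sup>+y. \<integral>\<^sup>+x. g 2 (point3 x y z) \<partial>lborel \<partial>lborel \<partial>lborel)"
    by (intro nn_integral_cong lborel_pair.Fubini') (simp add: split_beta')
  also have "\<dots> = G 2"
    unfolding G_def by (rule nn_integral_point3[symmetric]) measurable
  also have "(\<integral>\<^sup>+y. \<integral>\<^sup>+x. \<integral>\<^sup>+z. g 3 (point3 x y z) \<partial>lborel \<partial>lborel \<partial>lborel)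
      = (\<integral>\<^sup>+y. \<integral>\<^sup>+z. \<integral>\<^sup>+x. g 3 (point3 x y z) \<partial>lborel \<partial>lborel \<partial>lborel)"
    by (intro nn_integral_cong lborel_pair.Fubini') (simp add: split_beta')
  also have "\<dots> = (\<integral>\<^sup>+z. \<integral>\<^sup>+y. \<integral>\<^sup>+x. g 3 (point3 x y z) \<partial>lborel \<partial>lborel \<partial>lborel)"
    by (rule lborel_pair.Fubini') (simp add: split_beta')
  also have "\<dots> = G 3"
    unfolding G_def by (rule nn_integral_point3[symmetric]) measurable
  finally have LW: "S\<^sup>2 \<le> G 1 * G 2 * G 3" .
  have "(S\<^sup>2)\<^sup>2 \<le> (G 1 * G 2 * G 3)\<^sup>2" by (rule power_mono[OF LW]) simp
  also have "\<dots> = (G 1)\<^sup>2 * (G 2)\<^sup>2 * (G 3)\<^sup>2" by (simp add: power_mult_distrib)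
  also have "\<dots> \<le> (16 * S * E 1) * (16 * S * E 2) * (16 * S * E 3)"
    by (intro mult_mono G) auto
  finally have main: "(S\<^sup>2)\<^sup>2 \<le> (16 * S * E 1) * (16 * S * E 2) * (16 * S * E 3)" .
  have Sfin: "S \<noteq> \<infinity>"
  proof -
    have "integrable lborel (\<lambda>x. u x ^ 6)"
    proof -
      obtain K where K: "compact K" "\<And>x. x \<notin> K \<Longrightarrow> u x = 0" using test_functionE[OF u] by metis
      have "integrable lborel (\<lambda>x. indicator K x *\<^sub>R u x ^ 6)"
        by (intro borel_integrable_compact K continuous_intros continuous_on_subset[OF test_function_continuous[OF u]]) auto
      moreover have "(\<lambda>x. indicator K x *\<^sub>R u x ^ 6) = (\<lambda>x. u x ^ 6)" using K(2) by (auto simp: indicator_def fun_eq_iff)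
      ultimately show ?thesis by simp
    qed
    then show ?thesis unfolding S_def by (simp add: real_integrable_def)
  qed
  have "S \<le> 4096 * (E 1 * E 2 * E 3)"
  proof (cases "E 1 * E 2 * E 3")
    case (real d)
    obtain s where s: "S = ennreal s" "s \<ge> 0" using Sfin by (cases S) auto
    have "(16 * S * E 1) * (16 * S * E 2) * (16 * S * E 3) = 4096 * (S * S * S) * (E 1 * E 2 * E 3)"
      by (simp add: algebra_simps)
    also have "\<dots> = ennreal (4096 * (s * s * s) * d)"
      using s real by (simp add: ennreal_mult)
    finally have "ennreal ((s\<^sup>2)\<^sup>2) \<le> ennreal (4096 * (s * s * s) * d)"
      using main s by (simp add: ennreal_power)
    then have "(s\<^sup>2)\<^sup>2 \<le> 4096 * (s * s * s) * d" using s real by (simp add: ennreal_le_iff)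
    then have "s * (s * s * s) \<le> (4096 * d) * (s * s * s)" by (simp add: power2_eq_square algebra_simps)
    then have "s \<le> 4096 * d" using s(2) real(1) by (cases "s = 0") auto
    then show ?thesis using s real by (simp add: ennreal_mult[symmetric] ennreal_leI del: ennreal_mult flip: ennreal_numeral)
  qed (simp add: ennreal_mult_top)
  then show ?thesis by (simp add: S_def E_def)
qed

section \<open>Estimates in the Sobolev space and the trilinear form\<close>

text \<open>
  Each factor is at most the same power of the largest of the three numbers.  The crude constant
  costs only a factor 3 in the Hoelder inequality below.
\<close>

lemma powr_product_le_sum:
  fixes x y z :: real
  assumes "x \<ge> 0" "y \<ge> 0" "z \<ge> 0" and "\<alpha> > 0" "\<beta> > 0" "\<gamma> > 0" "\<alpha> + \<beta> + \<gamma> = 1"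
  shows "x powr \<alpha> * y powr \<beta> * z powr \<gamma> \<le> x + y + z"
proof -
  define m where "m = max x (max y z)"
  have m: "x \<le> m" "y \<le> m" "z \<le> m" "m \<ge> 0" using assms by (auto simp: m_def)
  have "x powr \<alpha> * y powr \<beta> * z powr \<gamma> \<le> m powr \<alpha> * m powr \<beta> * m powr \<gamma>"
    using assms m by (intro mult_mono powr_mono2) auto
  also have "\<dots> = m" using m(4) assms by (simp add: powr_add[symmetric])
  also have "m \<le> x + y + z" using assms by (auto simp: m_def)
  finally show ?thesis .
qed

text \<open>
  Divide each function by its integral, apply the pointwise bound and integrate.
\<close>

lemma three_term_Hoelder:
  fixes f g h :: "'a \<Rightarrow> real"
  assumes i: "integrable M f" "integrable M g" "integrable M h"
    and nn: "\<And>x. f x \<ge> 0" "\<And>x. g x \<ge> 0" "\<And>x. h x \<ge> 0"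
    and e: "\<alpha> > 0" "\<beta> > 0" "\<gamma> > 0" "\<alpha> + \<beta> + \<gamma> = 1"
  shows "integrable M (\<lambda>x. f x powr \<alpha> * g x powr \<beta> * h x powr \<gamma>)"
    and "(LINT x|M. f x powr \<alpha> * g x powr \<beta> * h x powr \<gamma>)
      \<le> 3 * ((LINT x|M. f x) powr \<alpha> * (LINT x|M. g x) powr \<beta> * (LINT x|M. h x) powr \<gamma>)"
proof -
  let ?k = "\<lambda>x. f x powr \<alpha> * g x powr \<beta> * h x powr \<gamma>"
  have m: "?k \<in> borel_measurable M" using i by (intro borel_measurable_times powr_real_measurable) auto
  show ik: "integrable M ?k"
  proof (rule Bochner_Integration.integrable_bound)
    show "integrable M (\<lambda>x. f x + g x + h x)" using i by auto
    show "AE x in M. norm (?k x) \<le> norm (f x + g x + h x)"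
      using powr_product_le_sum[OF nn e] nn by (intro AE_I2) (simp add: add_nonneg_nonneg)
  qed (rule m)
  let ?F = "LINT x|M. f x" and ?G = "LINT x|M. g x" and ?H = "LINT x|M. h x"
  have FGH: "?F \<ge> 0" "?G \<ge> 0" "?H \<ge> 0" using nn by (auto intro: integral_nonneg_AE)
  show "(LINT x|M. ?k x) \<le> 3 * (?F powr \<alpha> * ?G powr \<beta> * ?H powr \<gamma>)"
  proof (cases "?F = 0 \<or> ?G = 0 \<or> ?H = 0")
    case True
    have z: "AE x in M. k x = 0" if "integrable M k" "\<And>x. k x \<ge> 0" "(LINT x|M. k x) = 0" for k :: "'a \<Rightarrow> real"
      using integral_nonneg_eq_0_iff_AE[OF that(1)] that by simp
    have "AE x in M. ?k x = 0"
      using True z[OF i(1) nn(1)] z[OF i(2) nn(2)] z[OF i(3) nn(3)] e by (auto elim!: eventually_mono)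
    then have "(LINT x|M. ?k x) = 0" by (rule integral_eq_zero_AE)
    then show ?thesis by simp
  next
    case False
    then have pos: "?F > 0" "?G > 0" "?H > 0" using FGH by auto
    define c where "c = ?F powr \<alpha> * ?G powr \<beta> * ?H powr \<gamma>"
    have c: "c > 0" unfolding c_def using pos by simp
    have le: "?k x / c \<le> f x / ?F + g x / ?G + h x / ?H" for x
    proof -
      have "?k x / c = (f x / ?F) powr \<alpha> * (g x / ?G) powr \<beta> * (h x / ?H) powr \<gamma>"
        using nn pos by (simp add: c_def powr_divide)
      also have "\<dots> \<le> f x / ?F + g x / ?G + h x / ?H"
        using nn pos e by (intro powr_product_le_sum) auto
      finally show ?thesis .
    qed
    have "(LINT x|M. ?k x / c) \<le> (LINT x|M. f x / ?F + g x / ?G + h x / ?H)"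
      using ik i le by (intro integral_mono) auto
    also have "\<dots> = 3" using i pos by simp
    finally have "(LINT x|M. ?k x) / c \<le> 3" by simp
    then show ?thesis using c by (simp add: c_def field_simps)
  qed
qed

lemma nn_integral_lebesgue_on_le:
  fixes f :: "'a::euclidean_space \<Rightarrow> ennreal"
  assumes "D \<in> sets lebesgue" "f \<in> borel_measurable borel"
  shows "(\<integral>\<^sup>+x. f x \<partial>lebesgue_on D) \<le> (\<integral>\<^sup>+x. f x \<partial>lborel)"
    and "(\<And>x. x \<notin> D \<Longrightarrow> f x = 0) \<Longrightarrow> (\<integral>\<^sup>+x. f x \<partial>lebesgue_on D) = (\<integral>\<^sup>+x. f x \<partial>lborel)"
proof -
  have r: "(\<integral>\<^sup>+x. f x \<partial>lebesgue_on D) = (\<integral>\<^sup>+x. f x * indicator D x \<partial>lebesgue)"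
    using assms(1) by (subst nn_integral_restrict_space) auto
  have c: "(\<integral>\<^sup>+x. f x \<partial>lebesgue) = (\<integral>\<^sup>+x. f x \<partial>lborel)"
    using assms(2) by (intro nn_integral_completion)
  have "(\<integral>\<^sup>+x. f x * indicator D x \<partial>lebesgue) \<le> (\<integral>\<^sup>+x. f x \<partial>lebesgue)"
    by (intro nn_integral_mono) (auto simp: indicator_def)
  then show "(\<integral>\<^sup>+x. f x \<partial>lebesgue_on D) \<le> (\<integral>\<^sup>+x. f x \<partial>lborel)" using r c by simp
  assume z: "\<And>x. x \<notin> D \<Longrightarrow> f x = 0"
  have "(\<integral>\<^sup>+x. f x * indicator D x \<partial>lebesgue) = (\<integral>\<^sup>+x. f x \<partial>lebesgue)"
    by (intro nn_integral_cong) (use z in \<open>auto simp: indicator_def\<close>)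
  then show "(\<integral>\<^sup>+x. f x \<partial>lebesgue_on D) = (\<integral>\<^sup>+x. f x \<partial>lborel)" using r c by simp
qed

lemma norm_weak_partial_le: "\<bar>weak_partial D i (\<lambda>y. f y $ j) x\<bar> \<le> norm (jet D f x)"
proof (rule power2_le_imp_le)
  have "\<bar>weak_partial D i (\<lambda>y. f y $ j) x\<bar>\<^sup>2 \<le> (\<Sum>j\<in>UNIV. (weak_partial D i (\<lambda>y. f y $ j) x)\<^sup>2)"
    using member_le_sum[of j UNIV "\<lambda>j. (weak_partial D i (\<lambda>y. f y $ j) x)\<^sup>2"] by simp
  also have "\<dots> \<le> (\<Sum>i\<in>UNIV. \<Sum>j\<in>UNIV. (weak_partial D i (\<lambda>y. f y $ j) x)\<^sup>2)"
    by (rule member_le_sum) (auto intro: sum_nonneg)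
  also have "\<dots> \<le> (norm (jet D f x))\<^sup>2" by (simp add: norm_jet)
  finally show "\<bar>weak_partial D i (\<lambda>y. f y $ j) x\<bar>\<^sup>2 \<le> (norm (jet D f x))\<^sup>2" .
qed simp

text \<open>
  The constant is \<open>9 \<cdot> 3 \<cdot> 4096\<close>: by \<open>(a + b + c)\<^sup>3 \<le> 9
  (a\<^sup>3 + b\<^sup>3 + c\<^sup>3)\<close> the sixth power of the norm is bounded by those of the
  three components.
\<close>

lemma Sobolev_test_field:
  assumes D: "open D" and \<phi>: "\<phi> \<in> test_functions D"
  shows "(\<integral>\<^sup>+x. ennreal (norm (\<phi> x) ^ 6) \<partial>lebesgue_on D) \<le> ennreal (110592 * H12_norm D \<phi> ^ 6)"
proof -
  have Dm: "D \<in> sets lebesgue" using D by (simp add: borel_open)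
  let ?N = "H12_norm D \<phi>"
  note H = test_function_H12(1)[OF D \<phi>]
  note c = test_function_component[OF \<phi>]
  have um[measurable]: "(\<lambda>x. \<phi> x $ j) \<in> borel_measurable borel" for j
    by (rule test_function_borel_measurable[OF c])
  have E: "(\<integral>\<^sup>+x. ennreal ((partial_deriv i (\<lambda>x. \<phi> x $ j) x)\<^sup>2) \<partial>lborel) \<le> ennreal (?N\<^sup>2)" for i j
  proof -
    let ?d = "partial_deriv i (\<lambda>x. \<phi> x $ j)"
    note t = test_function_partial_deriv[OF c]
    have s: "sq_integrable (lebesgue_on D) ?d" by (rule test_function_scalar_sq_integrable[OF D t])
    have [measurable]: "?d \<in> borel_measurable borel" by (rule test_function_borel_measurable[OF t])
    have "(\<integral>\<^sup>+x. ennreal ((?d x)\<^sup>2) \<partial>lborel) = (\<integral>\<^sup>+x. ennreal ((?d x)\<^sup>2) \<partial>lebesgue_on D)"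
      by (rule nn_integral_lebesgue_on_le(2)[OF Dm, symmetric]) (use test_function_zero_outside[OF t] in auto)
    also have "\<dots> = ennreal ((l2 (lebesgue_on D) ?d)\<^sup>2)"
      using s by (simp add: l2_power2 sq_integrable_def nn_integral_eq_integral)
    also have "l2 (lebesgue_on D) ?d \<le> ?N"
      unfolding H12_norm_jet[OF D H]
    proof (rule l2_mono[OF jet_sq_integrable(1)[OF D H] s])
      show "AE x in lebesgue_on D. norm (?d x) \<le> norm (jet D \<phi> x)"
        using test_function_H12(2)[OF D \<phi>, of i j]
        by eventually_elim (use norm_weak_partial_le[of D i \<phi> j] in \<open>simp, metis\<close>)
    qed
    then have "ennreal ((l2 (lebesgue_on D) ?d)\<^sup>2) \<le> ennreal (?N\<^sup>2)"
      by (intro ennreal_leI power_mono) auto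
    finally show ?thesis .
  qed
  have alg: "4096 * (ennreal a * ennreal a * ennreal a) = ennreal (4096 * (a * a * a))" if "a \<ge> 0" for a
    using that by (simp add: ennreal_mult)
  have comp: "(\<integral>\<^sup>+x. ennreal ((\<phi> x $ j) ^ 6) \<partial>lborel) \<le> ennreal (4096 * ?N ^ 6)" for j
  proof -
    have "(\<integral>\<^sup>+x. ennreal ((\<phi> x $ j) ^ 6) \<partial>lborel) \<le> 4096 * (ennreal (?N\<^sup>2) * ennreal (?N\<^sup>2) * ennreal (?N\<^sup>2))"
      by (rule order_trans[OF Sobolev_test_function[OF c]]) (intro mult_mono E; simp)
    also have "\<dots> = ennreal (4096 * (?N\<^sup>2 * ?N\<^sup>2 * ?N\<^sup>2))" by (rule alg) simp
    also have "?N\<^sup>2 * ?N\<^sup>2 * ?N\<^sup>2 = ?N ^ 6" by (simp add: power_add[symmetric])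
    finally show ?thesis .
  qed
  have cube: "(a + b + c) ^ 3 \<le> 9 * (a ^ 3 + b ^ 3 + c ^ 3)" if "a \<ge> 0" "b \<ge> 0" "c \<ge> 0" for a b c :: real
  proof -
    have s: "(p + q) * (p - q)\<^sup>2 \<ge> 0" if "p \<ge> 0" "q \<ge> 0" for p q :: real using that by simp
    have t: "p ^ 3 + q ^ 3 + r ^ 3 - 3 * p * q * r \<ge> 0" if "p \<ge> 0" "q \<ge> 0" "r \<ge> 0" for p q r :: real
    proof -
      have "p ^ 3 + q ^ 3 + r ^ 3 - 3 * p * q * r = (p + q + r) * ((p - q)\<^sup>2 + (q - r)\<^sup>2 + (r - p)\<^sup>2) / 2"
        by (simp add: power2_eq_square power3_eq_cube algebra_simps)
      also have "\<dots> \<ge> 0" using that by (intro divide_nonneg_nonneg mult_nonneg_nonneg add_nonneg_nonneg) auto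
      finally show ?thesis .
    qed
    show ?thesis
      using s[OF that(1,2)] s[OF that(2,3)] s[OF that(1,3)] t[OF that]
      by (simp add: power2_eq_square power3_eq_cube algebra_simps)
  qed
  have pt: "norm (\<phi> x) ^ 6 \<le> 9 * ((\<phi> x $ 1) ^ 6 + (\<phi> x $ 2) ^ 6 + (\<phi> x $ 3) ^ 6)" for x
  proof -
    have "norm (\<phi> x) ^ 6 = ((norm (\<phi> x))\<^sup>2) ^ 3" by (simp add: power_mult[symmetric])
    also have "(norm (\<phi> x))\<^sup>2 = (\<phi> x $ 1)\<^sup>2 + (\<phi> x $ 2)\<^sup>2 + (\<phi> x $ 3)\<^sup>2"
      unfolding power2_norm_eq_inner inner_vec_def sum_3 by (simp add: power2_eq_square)
    also have "\<dots> ^ 3 \<le> 9 * (((\<phi> x $ 1)\<^sup>2) ^ 3 + ((\<phi> x $ 2)\<^sup>2) ^ 3 + ((\<phi> x $ 3)\<^sup>2) ^ 3)"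
      by (rule cube) auto
    finally show ?thesis by (simp add: power_mult[symmetric])
  qed
  have "(\<integral>\<^sup>+x. ennreal (norm (\<phi> x) ^ 6) \<partial>lebesgue_on D) \<le> (\<integral>\<^sup>+x. ennreal (norm (\<phi> x) ^ 6) \<partial>lborel)"
    using test_function_borel_measurable[OF \<phi>] by (intro nn_integral_lebesgue_on_le(1) Dm) auto
  also have "\<dots> \<le> (\<integral>\<^sup>+x. 9 * (ennreal ((\<phi> x $ 1) ^ 6) + ennreal ((\<phi> x $ 2) ^ 6) + ennreal ((\<phi> x $ 3) ^ 6)) \<partial>lborel)"
    using pt by (intro nn_integral_mono) (simp flip: ennreal_plus ennreal_mult ennreal_numeral)
  also have "\<dots> = 9 * ((\<integral>\<^sup>+x. ennreal ((\<phi> x $ 1) ^ 6) \<partial>lborel) + (\<integral>\<^sup>+x. ennreal ((\<phi> x $ 2) ^ 6) \<partial>lborel)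
       + (\<integral>\<^sup>+x. ennreal ((\<phi> x $ 3) ^ 6) \<partial>lborel))"
    by (simp add: nn_integral_cmult nn_integral_add)
  also have "\<dots> \<le> 9 * (ennreal (4096 * ?N ^ 6) + ennreal (4096 * ?N ^ 6) + ennreal (4096 * ?N ^ 6))"
    by (intro mult_left_mono add_mono comp) auto
  also have "\<dots> = ennreal (110592 * ?N ^ 6)"
    by (simp flip: ennreal_plus ennreal_mult ennreal_numeral)
  finally show ?thesis .
qed

text \<open>
  Convergence in \<open>L\<^sup>2\<close> gives almost everywhere convergence of a subsequence of
  the approximating test fields, and Fatou's lemma carries the inequality over to the limit.
\<close>

lemma H12_0_L6:
  assumes D: "open D" and f: "f \<in> H12_0 D"
  shows "integrable (lebesgue_on D) (\<lambda>x. norm (f x) ^ 6)"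
    and "(LINT x|lebesgue_on D. norm (f x) ^ 6) \<le> 110592 * H12_norm D f ^ 6"
proof -
  let ?M = "lebesgue_on D"
  obtain \<phi> where \<phi>: "\<And>n. \<phi> n \<in> test_functions D" and lim: "(\<lambda>n. H12_norm D (\<lambda>x. \<phi> n x - f x)) \<longlonglongrightarrow> 0"
    using f by (auto simp: H12_0_def)
  note fH = H12_0_H12[OF f]
  note \<phi>H = test_function_H12(1)[OF D \<phi>]
  have fm: "f \<in> borel_measurable ?M" using H12_D(1)[OF D fH] by (simp add: sq_integrable_def)
  have \<phi>m: "\<phi> n \<in> borel_measurable ?M" for n using H12_D(1)[OF D \<phi>H] by (simp add: sq_integrable_def)
  have i: "integrable ?M (\<lambda>x. (norm (\<phi> n x - f x))\<^sup>2)" for n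
    using sq_integrable_diff[OF H12_D(1)[OF D \<phi>H[of n]] H12_D(1)[OF D fH]] by (simp add: sq_integrable_def)
  have "(\<lambda>n. LINT x|?M. norm ((norm (\<phi> n x - f x))\<^sup>2)) \<longlonglongrightarrow> 0"
  proof (rule tendsto_sandwich[OF _ _ tendsto_const])
    show "(\<lambda>n. (H12_norm D (\<lambda>x. \<phi> n x - f x))\<^sup>2) \<longlonglongrightarrow> 0" using tendsto_power[OF lim, of 2] by simp
    have "(LINT x|?M. norm ((norm (\<phi> n x - f x))\<^sup>2)) \<le> (H12_norm D (\<lambda>x. \<phi> n x - f x))\<^sup>2" for n
      using power_mono[OF Lp_norm_2_le_H12_norm[of D "\<lambda>x. \<phi> n x - f x"], of 2] by (simp add: Lp_norm_2 l2_power2)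
    then show "\<forall>\<^sub>F n in sequentially. (LINT x|?M. norm ((norm (\<phi> n x - f x))\<^sup>2)) \<le> (H12_norm D (\<lambda>x. \<phi> n x - f x))\<^sup>2"
      by simp
  qed (simp add: always_eventually)
  from tendsto_L1_AE_subseq[OF i this] obtain r :: "nat \<Rightarrow> nat"
    where r: "strict_mono r" "AE x in ?M. (\<lambda>n. (norm (\<phi> (r n) x - f x))\<^sup>2) \<longlonglongrightarrow> 0" by blast
  have Nlim: "(\<lambda>n. H12_norm D (\<phi> n)) \<longlonglongrightarrow> H12_norm D f"
  proof (rule LIM_zero_cancel, rule Lim_null_comparison[OF _ lim], rule always_eventually, rule allI)
    fix n
    have a: "H12_norm D (\<phi> n) \<le> H12_norm D (\<lambda>x. \<phi> n x - f x) + H12_norm D f"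
      using H12_norm_lincomb[OF D H12_diff(1)[OF D \<phi>H[of n] fH] fH, of 1 1] by simp
    have "H12_norm D f \<le> H12_norm D (\<lambda>x. \<phi> n x - f x) + H12_norm D (\<phi> n)"
      using H12_norm_lincomb[OF D H12_diff(1)[OF D \<phi>H[of n] fH] \<phi>H[of n], of "-1" 1] by simp
    then show "norm (H12_norm D (\<phi> n) - H12_norm D f) \<le> H12_norm D (\<lambda>x. \<phi> n x - f x)" using a by simp
  qed
  have "(\<integral>\<^sup>+x. ennreal (norm (f x) ^ 6) \<partial>?M) \<le> (\<integral>\<^sup>+x. liminf (\<lambda>n. ennreal (norm (\<phi> (r n) x) ^ 6)) \<partial>?M)"
  proof (rule nn_integral_mono_AE)
    show "AE x in ?M. ennreal (norm (f x) ^ 6) \<le> liminf (\<lambda>n. ennreal (norm (\<phi> (r n) x) ^ 6))"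
      using r(2)
    proof eventually_elim
      case (elim x)
      then have "(\<lambda>n. sqrt ((norm (\<phi> (r n) x - f x))\<^sup>2)) \<longlonglongrightarrow> sqrt 0" by (rule tendsto_real_sqrt)
      then have "(\<lambda>n. \<phi> (r n) x - f x) \<longlonglongrightarrow> 0" by (simp add: tendsto_norm_zero_iff)
      then have "(\<lambda>n. \<phi> (r n) x) \<longlonglongrightarrow> f x" by (rule LIM_zero_cancel)
      then have "(\<lambda>n. ennreal (norm (\<phi> (r n) x) ^ 6)) \<longlonglongrightarrow> ennreal (norm (f x) ^ 6)"
        by (intro tendsto_ennrealI tendsto_power tendsto_norm)
      then have "liminf (\<lambda>n. ennreal (norm (\<phi> (r n) x) ^ 6)) = ennreal (norm (f x) ^ 6)"
        by (intro lim_imp_Liminf) simp_all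
      then show ?case by simp
    qed
  qed
  also have "\<dots> \<le> liminf (\<lambda>n. \<integral>\<^sup>+x. ennreal (norm (\<phi> (r n) x) ^ 6) \<partial>?M)"
    using \<phi>m by (intro nn_integral_liminf) auto
  also have "\<dots> \<le> liminf (\<lambda>n. ennreal (110592 * H12_norm D (\<phi> (r n)) ^ 6))"
    by (intro Liminf_mono always_eventually allI Sobolev_test_field[OF D \<phi>])
  also have "\<dots> = ennreal (110592 * H12_norm D f ^ 6)"
  proof (rule lim_imp_Liminf)
    have "(\<lambda>n. H12_norm D (\<phi> (r n))) \<longlonglongrightarrow> H12_norm D f"
      using LIMSEQ_subseq_LIMSEQ[OF Nlim r(1)] by (simp add: o_def)
    then show "(\<lambda>n. ennreal (110592 * H12_norm D (\<phi> (r n)) ^ 6)) \<longlonglongrightarrow> ennreal (110592 * H12_norm D f ^ 6)"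
      by (intro tendsto_ennrealI tendsto_mult tendsto_const tendsto_power)
  qed simp
  finally have le: "(\<integral>\<^sup>+x. ennreal (norm (f x) ^ 6) \<partial>?M) \<le> ennreal (110592 * H12_norm D f ^ 6)" .
  show i6: "integrable ?M (\<lambda>x. norm (f x) ^ 6)"
    using le fm by (intro integrableI_bounded) (auto simp: le_less_trans)
  have "ennreal (LINT x|?M. norm (f x) ^ 6) \<le> ennreal (110592 * H12_norm D f ^ 6)"
    using le nn_integral_eq_integral[OF i6] by simp
  then show "(LINT x|?M. norm (f x) ^ 6) \<le> 110592 * H12_norm D f ^ 6"
    by (simp add: ennreal_le_iff)
qed

lemma Lp_norm_nonneg [simp]: "Lp_norm D p f \<ge> 0" by (simp add: Lp_norm_def)

lemma Lp_on_diff: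
  assumes "w \<in> Lp_on D p" "w' \<in> Lp_on D p" "p > 0"
  shows "(\<lambda>x. w x - w' x) \<in> Lp_on D p"
  unfolding Lp_on_def
proof (intro CollectI conjI)
  show m: "(\<lambda>x. w x - w' x) \<in> borel_measurable (lebesgue_on D)" using assms by (auto simp: Lp_on_def)
  have "norm (w x - w' x) powr p \<le> 2 powr p * (norm (w x) powr p + norm (w' x) powr p)" for x
  proof -
    let ?m = "max (norm (w x)) (norm (w' x))"
    have "norm (w x - w' x) \<le> 2 * ?m" using norm_triangle_ineq4[of "w x" "w' x"] by linarith
    then have "norm (w x - w' x) powr p \<le> (2 * ?m) powr p" using assms(3) by (intro powr_mono2) auto
    also have "\<dots> = 2 powr p * ?m powr p" by (simp add: powr_mult)
    also have "?m powr p \<le> norm (w x) powr p + norm (w' x) powr p" by (auto simp: max_def)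
    finally show ?thesis by simp
  qed
  then have le: "norm (norm (w x - w' x) powr p) \<le> norm (2 powr p * (norm (w x) powr p + norm (w' x) powr p))" for x
    by (simp add: abs_of_nonneg add_nonneg_nonneg)
  show "integrable (lebesgue_on D) (\<lambda>x. norm (w x - w' x) powr p)"
  proof (rule Bochner_Integration.integrable_bound)
    show "integrable (lebesgue_on D) (\<lambda>x. 2 powr p * (norm (w x) powr p + norm (w' x) powr p))"
      using assms by (auto simp: Lp_on_def)
    show "(\<lambda>x. norm (w x - w' x) powr p) \<in> borel_measurable (lebesgue_on D)"
      using measurable_compose[OF m borel_measurable_norm] by (intro powr_real_measurable) auto
  qed (use le in blast)
qed

text \<open>
  Since \<open>2 = 2 \<cdot> \<delta>/(3+\<delta>) + 6 \<cdot> 1/(3+\<delta>)\<close>, the square of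
  \<open>|w| |f|\<close> splits into a power \<open>2/(3+\<delta>)\<close> of
  \<open>|w|\<^sup>3\<^sup>+\<^sup>\<delta>\<close>, a power \<open>\<delta>/(3+\<delta>)\<close> of
  \<open>|f|\<^sup>2\<close> and a power \<open>1/(3+\<delta>)\<close> of
  \<open>|f|\<^sup>6\<close>.  These exponents add up to one.
\<close>

lemma cross_product_estimate:
  assumes D: "open D" and \<delta>: "\<delta> > 0" and w: "w \<in> Lp_on D (3 + \<delta>)" and f: "f \<in> H12_0 D"
  shows "sq_integrable (lebesgue_on D) (\<lambda>x. cross3 (w x) (f x))"
    and "l2 (lebesgue_on D) (\<lambda>x. cross3 (w x) (f x)) \<le> sqrt (3 * 110592 powr (1 / (3 + \<delta>))) * Lp_norm D (3 + \<delta>) w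
       * Lp_norm D 2 f powr (\<delta> / (3 + \<delta>)) * H12_norm D f powr (3 / (3 + \<delta>))"
proof -
  let ?M = "lebesgue_on D"
  let ?p = "3 + \<delta>"
  note fH = H12_0_H12[OF f]
  have p: "?p > 0" using \<delta> by simp
  have wi: "integrable ?M (\<lambda>x. norm (w x) powr ?p)" and wm: "w \<in> borel_measurable ?M"
    using w by (auto simp: Lp_on_def)
  have fi: "integrable ?M (\<lambda>x. (norm (f x))\<^sup>2)" and fm: "f \<in> borel_measurable ?M"
    using H12_D(1)[OF D fH] by (auto simp: sq_integrable_def)
  note f6 = H12_0_L6[OF D f]
  have e: "2 / ?p > 0" "\<delta> / ?p > 0" "1 / ?p > 0" "2 / ?p + \<delta> / ?p + 1 / ?p = 1"
    using \<delta> by (auto simp: add_divide_distrib[symmetric])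
  have eq: "(norm (w x) powr ?p) powr (2 / ?p) * ((norm (f x))\<^sup>2) powr (\<delta> / ?p) * (norm (f x) ^ 6) powr (1 / ?p)
      = (norm (w x))\<^sup>2 * (norm (f x))\<^sup>2" for x
  proof -
    have 1: "(norm (w x) powr ?p) powr (2 / ?p) = (norm (w x))\<^sup>2"
    proof -
      have "(norm (w x) powr ?p) powr (2 / ?p) = norm (w x) powr (?p * (2 / ?p))" by (rule powr_powr)
      also have "?p * (2 / ?p) = 2" using p by (simp only: times_divide_eq_right nonzero_mult_div_cancel_left less_imp_neq[symmetric] not_False_eq_True)
      finally show ?thesis by simp
    qed
    have 2: "((norm (f x))\<^sup>2) powr (\<delta> / ?p) * (norm (f x) ^ 6) powr (1 / ?p) = (norm (f x))\<^sup>2"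
    proof (cases "f x = 0")
      case False
      then have n: "norm (f x) > 0" by simp
      have "((norm (f x))\<^sup>2) powr (\<delta> / ?p) * (norm (f x) ^ 6) powr (1 / ?p)
          = norm (f x) powr (2 * (\<delta> / ?p) + 6 * (1 / ?p))"
        using n by (simp add: powr_powr powr_add flip: powr_numeral)
      also have "2 * (\<delta> / ?p) + 6 * (1 / ?p) = 2 * ((\<delta> + 3) / ?p)" by (simp add: add_divide_distrib)
      also have "(\<delta> + 3) / ?p = 1" using p by simp
      finally show ?thesis by simp
    qed simp
    show ?thesis using 1 2 by (simp add: mult.assoc)
  qed
  note H = three_term_Hoelder[OF wi fi f6(1) _ _ _ e, unfolded eq, simplified]
  have cm: "(\<lambda>x. cross3 (w x) (f x)) \<in> borel_measurable ?M"
  proof -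
    have "(\<lambda>x. cross3 (w x) (f x)) = (\<lambda>x. (w x $ 2 * f x $ 3 - w x $ 3 * f x $ 2) *\<^sub>R axis 1 1
        + (w x $ 3 * f x $ 1 - w x $ 1 * f x $ 3) *\<^sub>R axis 2 1 + (w x $ 1 * f x $ 2 - w x $ 2 * f x $ 1) *\<^sub>R axis 3 1)"
      by (simp add: fun_eq_iff cross3_def vec_eq_iff forall_3 axis_def)
    moreover have "(\<lambda>x. g x $ j) \<in> borel_measurable ?M" if "g \<in> borel_measurable ?M" for g :: field3 and j
      using measurable_compose[OF that, of "\<lambda>v. v $ j" borel] by (simp add: borel_measurable_continuous_onI continuous_on_component)
    ultimately show ?thesis using wm fm
      by (auto intro!: borel_measurable_add borel_measurable_scaleR borel_measurable_diff borel_measurable_times)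
  qed
  have le: "(norm (cross3 (w x) (f x)))\<^sup>2 \<le> (norm (w x))\<^sup>2 * (norm (f x))\<^sup>2" for x
    using norm_cross[of "w x" "f x"] by (simp add: power_mult_distrib)
  show s: "sq_integrable ?M (\<lambda>x. cross3 (w x) (f x))"
    unfolding sq_integrable_def
  proof
    show "integrable ?M (\<lambda>x. (norm (cross3 (w x) (f x)))\<^sup>2)"
      by (rule Bochner_Integration.integrable_bound[OF H(1)]) (use cm le in auto)
  qed (rule cm)
  let ?W = "Lp_norm D ?p w" and ?A = "Lp_norm D 2 f" and ?N = "H12_norm D f"
  have W: "(LINT x|?M. norm (w x) powr ?p) powr (2 / ?p) = ?W\<^sup>2"
    using p by (simp add: Lp_norm_def powr_powr flip: powr_numeral)
  have A: "(LINT x|?M. (norm (f x))\<^sup>2) powr (\<delta> / ?p) = (?A powr (\<delta> / ?p))\<^sup>2"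
  proof -
    have "(LINT x|?M. (norm (f x))\<^sup>2) = ?A powr 2" by (simp add: Lp_norm_2 l2_power2)
    then show ?thesis by (simp add: powr_powr mult.commute flip: powr_numeral)
  qed
  have B: "(LINT x|?M. norm (f x) ^ 6) powr (1 / ?p) \<le> 110592 powr (1 / ?p) * (?N powr (3 / ?p))\<^sup>2"
  proof -
    have "(LINT x|?M. norm (f x) ^ 6) powr (1 / ?p) \<le> (110592 * ?N ^ 6) powr (1 / ?p)"
      using f6(2) p by (intro powr_mono2) auto
    also have "\<dots> = 110592 powr (1 / ?p) * (?N powr 6) powr (1 / ?p)"
    proof -
      have N6: "?N ^ 6 = ?N powr 6" by simp
      show ?thesis unfolding N6 by (rule powr_mult; simp)
    qed
    also have "(?N powr 6) powr (1 / ?p) = ?N powr (6 / ?p)"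
      by (simp only: powr_powr times_divide_eq_right mult_1_right)
    also have "\<dots> = (?N powr (3 / ?p))\<^sup>2"
      by (simp add: power2_eq_square powr_add[symmetric] add_divide_distrib[symmetric])
    finally show ?thesis .
  qed
  have "(l2 ?M (\<lambda>x. cross3 (w x) (f x)))\<^sup>2 \<le> (LINT x|?M. (norm (w x))\<^sup>2 * (norm (f x))\<^sup>2)"
    unfolding l2_power2 using s H(1) le by (intro integral_mono) (auto simp: sq_integrable_def)
  also have "\<dots> \<le> 3 * (?W\<^sup>2 * (?A powr (\<delta> / ?p))\<^sup>2 * (LINT x|?M. norm (f x) ^ 6) powr (1 / ?p))"
    using H(2) unfolding W A by simp
  also have "\<dots> \<le> 3 * (?W\<^sup>2 * (?A powr (\<delta> / ?p))\<^sup>2 * (110592 powr (1 / ?p) * (?N powr (3 / ?p))\<^sup>2))"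
    by (intro mult_left_mono B) auto
  also have "\<dots> = (sqrt (3 * 110592 powr (1 / ?p)) * ?W * ?A powr (\<delta> / ?p) * ?N powr (3 / ?p))\<^sup>2"
    by (simp add: power_mult_distrib)
  finally show "l2 ?M (\<lambda>x. cross3 (w x) (f x)) \<le> sqrt (3 * 110592 powr (1 / ?p)) * ?W * ?A powr (\<delta> / ?p) * ?N powr (3 / ?p)"
    by (rule power2_le_imp_le) (simp add: Lp_norm_def)
qed

text \<open>
  Both first order terms are values of this form: \<open>B_op D w f \<phi>\<close> is \<open>-
  trilinear D w \<phi> f\<close> and \<open>curl_cross_op D w g \<phi>\<close> is \<open>trilinear D
  w g \<phi>\<close>.
\<close>

definition trilinear :: "(real^3) set \<Rightarrow> field3 \<Rightarrow> field3 \<Rightarrow> field3 \<Rightarrow> real" where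
  "trilinear D w g f = L2_inner D (\<lambda>x. cross3 (w x) (g x)) (weak_curl D f)"

lemma trilinear_bound:
  assumes D: "open D" and \<delta>: "\<delta> > 0" and w: "w \<in> Lp_on D (3 + \<delta>)" and g: "g \<in> H12_0 D" and f: "f \<in> H12 D"
  shows "\<bar>trilinear D w g f\<bar> \<le> 2 * sqrt (3 * 110592 powr (1 / (3 + \<delta>))) * Lp_norm D (3 + \<delta>) w
       * Lp_norm D 2 g powr (\<delta> / (3 + \<delta>)) * H12_norm D g powr (3 / (3 + \<delta>)) * H12_norm D f"
proof -
  let ?K = "sqrt (3 * 110592 powr (1 / (3 + \<delta>))) * Lp_norm D (3 + \<delta>) w
       * Lp_norm D 2 g powr (\<delta> / (3 + \<delta>)) * H12_norm D g powr (3 / (3 + \<delta>))"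
  have "\<bar>trilinear D w g f\<bar> \<le> l2 (lebesgue_on D) (\<lambda>x. cross3 (w x) (g x)) * l2 (lebesgue_on D) (weak_curl D f)"
    unfolding trilinear_def L2_inner_def
    by (rule l2_inner_bound[OF cross_product_estimate(1)[OF D \<delta> w g] weak_curl_sq_integrable(1)[OF D f]])
  also have "\<dots> \<le> ?K * (2 * H12_norm D f)"
    by (intro mult_mono cross_product_estimate(2)[OF D \<delta> w g] weak_curl_sq_integrable(2)[OF D f]) (auto simp: Lp_norm_def)
  finally show ?thesis by (simp add: algebra_simps)
qed

text \<open>
  The interpolated bound, weakened to a product of norms; this suffices for integrability and
  measurability in time.
\<close>

lemma trilinear_bound_H12:
  assumes D: "open D" and \<delta>: "\<delta> > 0" and w: "w \<in> Lp_on D (3 + \<delta>)" and g: "g \<in> H12_0 D" and f: "f \<in> H12 D"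
  shows "\<bar>trilinear D w g f\<bar> \<le> 2 * sqrt (3 * 110592 powr (1 / (3 + \<delta>))) * Lp_norm D (3 + \<delta>) w * H12_norm D g * H12_norm D f"
proof -
  let ?p = "3 + \<delta>"
  have "Lp_norm D 2 g powr (\<delta> / ?p) * H12_norm D g powr (3 / ?p) \<le> H12_norm D g powr (\<delta> / ?p) * H12_norm D g powr (3 / ?p)"
    using \<delta> by (intro mult_right_mono powr_mono2 Lp_norm_2_le_H12_norm) auto
  also have "\<dots> = H12_norm D g powr ((\<delta> + 3) / ?p)" by (simp add: powr_add[symmetric] add_divide_distrib)
  also have "(\<delta> + 3) / ?p = 1" using \<delta> by simp
  finally have *: "Lp_norm D 2 g powr (\<delta> / ?p) * H12_norm D g powr (3 / ?p) \<le> H12_norm D g" by simp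
  let ?K = "2 * sqrt (3 * 110592 powr (1 / ?p)) * Lp_norm D ?p w"
  have "\<bar>trilinear D w g f\<bar> \<le> ?K * (Lp_norm D 2 g powr (\<delta> / ?p) * H12_norm D g powr (3 / ?p)) * H12_norm D f"
    using trilinear_bound[OF assms] by (simp add: mult.assoc)
  also have "\<dots> \<le> ?K * H12_norm D g * H12_norm D f"
    by (intro mult_right_mono mult_left_mono *) auto
  finally show ?thesis .
qed

lemma trilinear_diff:
  assumes D: "open D" and \<delta>: "\<delta> > 0" and w: "w \<in> Lp_on D (3 + \<delta>)" and g: "g \<in> H12_0 D" and f: "f \<in> H12 D"
  shows trilinear_diff1: "w' \<in> Lp_on D (3 + \<delta>) \<Longrightarrow> trilinear D (\<lambda>x. w x - w' x) g f = trilinear D w g f - trilinear D w' g f"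
    and trilinear_diff2: "g' \<in> H12_0 D \<Longrightarrow> trilinear D w (\<lambda>x. g x - g' x) f = trilinear D w g f - trilinear D w g' f"
    and trilinear_diff3: "f' \<in> H12 D \<Longrightarrow> trilinear D w g (\<lambda>x. f x - f' x) = trilinear D w g f - trilinear D w g f'"
proof -
  have i: "integrable (lebesgue_on D) (\<lambda>x. cross3 (w x) (g x) \<bullet> weak_curl D f x)"
    if "w \<in> Lp_on D (3 + \<delta>)" "g \<in> H12_0 D" "f \<in> H12 D" for w g f
    by (rule integrable_inner_sq[OF cross_product_estimate(1)[OF D \<delta> that(1,2)] weak_curl_sq_integrable(1)[OF D that(3)]])
  show "trilinear D (\<lambda>x. w x - w' x) g f = trilinear D w g f - trilinear D w' g f" if w': "w' \<in> Lp_on D (3 + \<delta>)"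
    unfolding trilinear_def L2_inner_def
    by (subst Bochner_Integration.integral_diff[symmetric, OF i[OF w g f] i[OF w' g f]])
      (simp add: Cross3.left_diff_distrib inner_diff_left)
  show "trilinear D w (\<lambda>x. g x - g' x) f = trilinear D w g f - trilinear D w g' f" if g': "g' \<in> H12_0 D"
    unfolding trilinear_def L2_inner_def
    by (subst Bochner_Integration.integral_diff[symmetric, OF i[OF w g f] i[OF w g' f]])
      (simp add: Cross3.right_diff_distrib inner_diff_left)
  show "trilinear D w g (\<lambda>x. f x - f' x) = trilinear D w g f - trilinear D w g f'" if f': "f' \<in> H12 D"
    unfolding trilinear_def L2_inner_def
  proof (subst Bochner_Integration.integral_diff[symmetric, OF i[OF w g f] i[OF w g f']], rule integral_cong_AE)
    show "AE x in lebesgue_on D. cross3 (w x) (g x) \<bullet> weak_curl D (\<lambda>x. f x - f' x) x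
        = cross3 (w x) (g x) \<bullet> weak_curl D f x - cross3 (w x) (g x) \<bullet> weak_curl D f' x"
      using weak_curl_diff[OF D f f'] by eventually_elim (simp add: inner_diff_right)
  qed (use i[OF w g H12_diff(1)[OF D f f']] i[OF w g f] i[OF w g f'] in auto)
qed

section \<open>Integrals over time intervals\<close>

lemma AE_interval_nonempty:
  fixes p q :: real
  assumes "p < q" "AE t in lebesgue_on {p<..<q}. P t"
  shows "\<exists>t\<in>{p<..<q}. P t"
proof (rule ccontr)
  assume "\<not> ?thesis"
  then have "AE t in lebesgue. t \<notin> {p<..<q}"
    using assms(2) by (auto simp: AE_restrict_space_iff elim!: eventually_mono)
  then have "emeasure lebesgue {p<..<q} = 0"
    by (subst (asm) AE_iff_null_sets[symmetric]) auto
  then show False using assms(1) by simp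
qed

text \<open>
  A set of full measure is dense.  This replaces every passage to the limit along times at which a
  path has values in \<open>V\<close>.
\<close>

lemma continuous_AE_bound:
  fixes k :: "real \<Rightarrow> real"
  assumes k: "continuous_on {p..q} k" and pq: "p < q" and ae: "AE t in lebesgue_on {p<..<q}. k t \<le> B" and t: "t \<in> {p..q}"
  shows "k t \<le> B"
proof (rule ccontr)
  assume "\<not> k t \<le> B"
  then have pos: "k t - B > 0" by simp
  obtain d where d: "d > 0" "\<And>s. s \<in> {p..q} \<Longrightarrow> dist s t < d \<Longrightarrow> dist (k s) (k t) < k t - B"
    using k[unfolded continuous_on_iff, rule_format, OF t pos] by blast
  define p' q' where "p' = max p (t - d)" and "q' = min q (t + d)"
  have pq': "p' < q'" using pq t d(1) by (auto simp: p'_def q'_def)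
  have sub: "{p'<..<q'} \<subseteq> {p<..<q}" by (auto simp: p'_def q'_def)
  have "AE s in lebesgue. s \<in> {p<..<q} \<longrightarrow> k s \<le> B" using ae by (simp add: AE_restrict_space_iff)
  then have "AE s in lebesgue_on {p'<..<q'}. k s \<le> B"
    using sub by (auto simp: AE_restrict_space_iff elim!: eventually_mono)
  then obtain s where s: "s \<in> {p'<..<q'}" "k s \<le> B" using AE_interval_nonempty[OF pq'] by blast
  then have "dist (k s) (k t) < k t - B" by (intro d(2)) (auto simp: p'_def q'_def dist_real_def)
  then show False using s(2) by (simp add: dist_real_def)
qed

lemma AE_lebesgue_on_subset:
  assumes "AE t in lebesgue_on S. P t" "S' \<subseteq> S" "S \<in> sets lebesgue" "S' \<in> sets lebesgue"
  shows "AE t in lebesgue_on S'. P t"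
  using assms by (auto simp: AE_restrict_space_iff elim!: eventually_mono)

lemma integrable_lebesgue_on_subset:
  fixes f :: "real \<Rightarrow> real"
  assumes "integrable (lebesgue_on S) f" "S' \<subseteq> S" "S \<in> sets lebesgue" "S' \<in> sets lebesgue"
  shows "integrable (lebesgue_on S') f"
proof -
  have "integrable lebesgue (\<lambda>x. (indicator S x * f x) * indicator S' x)"
  proof (rule integrable_mult_bounded_measurable[where B=1])
    show "integrable lebesgue (\<lambda>x. indicator S x * f x)" using assms by (simp add: integrable_restrict_space)
    show "indicat_real S' \<in> borel_measurable lebesgue" using assms by simp
  qed (simp add: indicator_def)
  moreover have "(\<lambda>x. (indicator S x * f x) * indicator S' x) = (\<lambda>x. indicator S' x * f x)"
    using assms(2) by (auto simp: indicator_def fun_eq_iff)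
  ultimately show ?thesis using assms by (simp add: integrable_restrict_space)
qed

lemma integral_interval_split:
  fixes f :: "real \<Rightarrow> real"
  assumes f: "integrable (lebesgue_on {a<..<b}) f" and "a \<le> s" "s \<le> t" "t \<le> b"
  shows "(LINT \<tau>|lebesgue_on {a<..<t}. f \<tau>) = (LINT \<tau>|lebesgue_on {a<..<s}. f \<tau>) + (LINT \<tau>|lebesgue_on {s<..<t}. f \<tau>)"
proof -
  have i: "integrable lebesgue (\<lambda>x. indicator S x *\<^sub>R f x)" if "S \<subseteq> {a<..<b}" "S \<in> sets lebesgue" for S
    using integrable_lebesgue_on_subset[OF f that(1) _ that(2)] that(2) by (simp add: integrable_restrict_space)
  have i1: "integrable lebesgue (\<lambda>x. indicator {a<..<s} x *\<^sub>R f x)" "integrable lebesgue (\<lambda>x. indicator {s<..<t} x *\<^sub>R f x)"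
    "integrable lebesgue (\<lambda>x. indicator {a<..<t} x *\<^sub>R f x)"
    using assms i[of "{a<..<s}"] i[of "{s<..<t}"] i[of "{a<..<t}"] by (simp_all add: subset_eq)
  have ae: "AE x in lebesgue. x \<noteq> s" by (rule AE_not_in[of "{s}", simplified]) (simp add: negligible_iff_null_sets[symmetric])
  have "(LINT x|lebesgue. indicator {a<..<t} x *\<^sub>R f x)
      = (LINT x|lebesgue. indicator {a<..<s} x *\<^sub>R f x + indicator {s<..<t} x *\<^sub>R f x)"
  proof (rule integral_cong_AE)
    show "AE x in lebesgue. indicator {a<..<t} x *\<^sub>R f x = indicator {a<..<s} x *\<^sub>R f x + indicator {s<..<t} x *\<^sub>R f x"
      using ae by eventually_elim (use assms(2-4) in \<open>auto simp: indicator_def\<close>)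
  qed (use i1 in auto)
  then show ?thesis using i1 by (simp add: integral_restrict_space)
qed

lemma integral_interval_diff:
  fixes f :: "real \<Rightarrow> real"
  assumes f: "integrable (lebesgue_on {a<..<b}) f" and "a \<le> s" "s \<le> t" "t \<le> b"
  shows "(LINT \<tau>|lebesgue_on {s<..<t}. f \<tau>) = (LINT \<tau>|lebesgue_on {a<..<t}. f \<tau>) - (LINT \<tau>|lebesgue_on {a<..<s}. f \<tau>)"
  using integral_interval_split[OF assms] by simp

lemma integral_const_interval: "p \<le> q \<Longrightarrow> (LINT t|lebesgue_on {p<..<q}. c) = (q - p) * (c::real)"
  by (simp add: measure_restrict_space)

lemma integrable_const_interval: "integrable (lebesgue_on {p<..<q::real}) (\<lambda>_. c::real)"
  by (rule finite_measure.integrable_const) (simp add: finite_measure_restrict_space finite_measure_lebesgue_on)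

text \<open>
  Otherwise \<open>g\<close> would exceed its mean almost everywhere.
\<close>

lemma mean_value_point:
  fixes g :: "real \<Rightarrow> real"
  assumes pq: "p < q" and g: "integrable (lebesgue_on {p<..<q}) g" and W: "AE t in lebesgue_on {p<..<q}. t \<in> W"
  shows "\<exists>t\<in>{p<..<q} \<inter> W. (q - p) * g t \<le> (LINT t|lebesgue_on {p<..<q}. g t)"
proof (rule ccontr)
  let ?M = "lebesgue_on {p<..<q}"
  define m where "m = (LINT t|?M. g t) / (q - p)"
  assume "\<not> ?thesis"
  then have n: "m < g t" if "t \<in> {p<..<q}" "t \<in> W" for t
    using that pq by (auto simp: m_def field_simps not_le)
  have ae: "AE t in ?M. m < g t" using W AE_space by eventually_elim (use n in auto)
  have i: "integrable ?M (\<lambda>t. g t - m)" using g integrable_const_interval by auto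
  have "(LINT t|?M. g t - m) = 0"
    using g pq integrable_const_interval[of p q m] integral_const_interval[of p q m] by (simp add: m_def)
  then have "AE t in ?M. g t - m = 0"
    by (subst (asm) integral_nonneg_eq_0_iff_AE[OF i]) (use ae in \<open>auto elim!: eventually_mono\<close>)
  with ae have "AE t in ?M. False" by eventually_elim simp
  then show False using AE_interval_nonempty[OF pq] by blast
qed

text \<open>
  The increment bound contains the values of \<open>g\<close> at the two end points, which cannot be
  controlled by an integral for arbitrary points.  In each of \<open>n\<close> subintervals of equal
  length \<open>\<eta>\<close> there is a point of \<open>W\<close> at which \<open>\<eta> g\<close>
  is at most the integral of \<open>g\<close> over the subinterval.  Consecutive points of this kind
  have a distance of at most \<open>2\<eta>\<close>, and each of them is the end point of two
  intervals, whence the constant \<open>4 = 2 \<cdot> 2\<close>; the contributions of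
  \<open>a\<close> and \<open>b\<close> vanish in the limit.
\<close>

lemma partition_estimate:
  fixes h g m :: "real \<Rightarrow> real"
  assumes ab: "a < b" and W: "AE t in lebesgue_on {a<..<b}. t \<in> W" "a \<in> W" "b \<in> W"
    and g: "integrable (lebesgue_on {a<..<b}) g" "\<And>t. g t \<ge> 0"
    and m: "integrable (lebesgue_on {a<..<b}) m"
    and d: "d > 0" and c: "c \<ge> 0"
    and le: "\<And>s t. s \<in> W \<Longrightarrow> t \<in> W \<Longrightarrow> a \<le> s \<Longrightarrow> s < t \<Longrightarrow> t \<le> b \<Longrightarrow> t - s < d
      \<Longrightarrow> \<bar>h t - h s\<bar> \<le> (LINT \<tau>|lebesgue_on {s<..<t}. m \<tau>) + c * (t - s) * (g s + g t)"
  shows "\<bar>h b - h a\<bar> \<le> (LINT \<tau>|lebesgue_on {a<..<b}. m \<tau>) + 4 * c * (LINT \<tau>|lebesgue_on {a<..<b}. g \<tau>)"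
proof -
  define I where "I k s = (LINT \<tau>|lebesgue_on {a<..<s}. k \<tau>)" for k :: "real \<Rightarrow> real" and s
  have I: "(LINT \<tau>|lebesgue_on {s<..<t}. k \<tau>) = I k t - I k s"
    if "integrable (lebesgue_on {a<..<b}) k" "a \<le> s" "s \<le> t" "t \<le> b" for k s t
    using integral_interval_diff[OF that] by (simp add: I_def)
  have main: "\<bar>h b - h a\<bar> \<le> I m b + 4 * c * I g b + 2 * c * ((b - a) / real n) * (g a + g b)"
    if n: "n > 0" "2 * ((b - a) / real n) < d" for n :: nat
  proof -
    (* the mesh; the points tau i below are mean value points of g in the i-th cell *)
    define \<eta> where "\<eta> = (b - a) / real n"
    have \<eta>: "\<eta> > 0" "a + real n * \<eta> = b" using n(1) ab by (auto simp: \<eta>_def)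
    have grid: "a \<le> a + real i * \<eta>" "a + real (Suc i) * \<eta> \<le> b" if "i < n" for i
    proof -
      have "real (Suc i) * \<eta> \<le> real n * \<eta>" using that \<eta>(1) by (intro mult_right_mono) auto
      then show "a + real (Suc i) * \<eta> \<le> b" using \<eta>(2) by simp
    qed (use \<eta> in auto)
    have "\<exists>t. t \<in> {a + real i * \<eta><..<a + real (Suc i) * \<eta>} \<and> t \<in> W \<and> \<eta> * g t \<le> I g (a + real (Suc i) * \<eta>) - I g (a + real i * \<eta>)"
      if i: "i < n" for i
    proof -
      let ?p = "a + real i * \<eta>" and ?q = "a + real (Suc i) * \<eta>"
      have pq: "?p < ?q" using \<eta> by (simp add: algebra_simps)
      have sub: "{?p<..<?q} \<subseteq> {a<..<b}" using grid[OF i] by auto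
      have "\<exists>t\<in>{?p<..<?q} \<inter> W. (?q - ?p) * g t \<le> (LINT t|lebesgue_on {?p<..<?q}. g t)"
        by (rule mean_value_point[OF pq integrable_lebesgue_on_subset[OF g(1) sub] AE_lebesgue_on_subset[OF W(1) sub]]) auto
      moreover have "?q - ?p = \<eta>" by (simp add: algebra_simps)
      moreover have "(LINT t|lebesgue_on {?p<..<?q}. g t) = I g ?q - I g ?p"
        using grid[OF i] pq by (intro I g(1)) auto
      ultimately show ?thesis by auto
    qed
    then obtain \<tau> where \<tau>: "\<And>i. i < n \<Longrightarrow> \<tau> i \<in> {a + real i * \<eta><..<a + real (Suc i) * \<eta>}" "\<And>i. i < n \<Longrightarrow> \<tau> i \<in> W"
      "\<And>i. i < n \<Longrightarrow> \<eta> * g (\<tau> i) \<le> I g (a + real (Suc i) * \<eta>) - I g (a + real i * \<eta>)"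
      by metis
    (* n + 2 points: the two ends and one point in each of the n cells *)
    define t where "t i = (if i = 0 then a else if i \<le> n then \<tau> (i - 1) else b)" for i
    have t0: "t 0 = a" "t (Suc n) = b" by (auto simp: t_def)
    have tW: "t i \<in> W" for i using W \<tau>(2)[of "i - 1"] by (auto simp: t_def)
    have pos: "a + (real i - 1) * \<eta> \<le> t i \<and> (i \<noteq> 0 \<longrightarrow> i \<le> n \<longrightarrow> a + (real i - 1) * \<eta> < t i) \<and> t i \<le> a + real i * \<eta> \<and> (i \<noteq> 0 \<longrightarrow> i \<le> n \<longrightarrow> t i < a + real i * \<eta>)"
      if i: "i \<le> Suc n" for i
    proof -
      consider "i = 0" | j where "i = Suc j" "j < n" | "i = Suc n" using i by (cases i) (auto simp: le_less)
      then show ?thesis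
      proof cases
        case 2
        then show ?thesis using \<tau>(1)[of j] by (auto simp: t_def algebra_simps)
      qed (use \<eta> ab in \<open>auto simp: t_def algebra_simps\<close>)
    qed
    have step: "t i < t (Suc i) \<and> t (Suc i) - t i \<le> 2 * \<eta>" if "i \<le> n" for i
      using pos[of i] pos[of "Suc i"] that \<eta> n(1) by (cases "i = 0"; cases "i = n") (auto simp: algebra_simps)
    have rng: "a \<le> t i \<and> t i \<le> b" if i: "i \<le> Suc n" for i
    proof -
      consider "i = 0" | j where "i = Suc j" "j < n" | "i = Suc n" using i by (cases i) (auto simp: le_less)
      then show ?thesis
      proof cases
        case 2
        then show ?thesis using \<tau>(1)[of j] grid[of j] by (auto simp: t_def)
      qed (use ab in \<open>auto simp: t_def\<close>)
    qed
    have one: "\<bar>h (t (Suc i)) - h (t i)\<bar> \<le> (I m (t (Suc i)) - I m (t i)) + c * (2 * \<eta>) * (g (t i) + g (t (Suc i)))"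
      if i: "i \<le> n" for i
    proof -
      have s: "t i < t (Suc i)" "t (Suc i) - t i \<le> 2 * \<eta>" using step[OF i] by auto
      have "\<bar>h (t (Suc i)) - h (t i)\<bar> \<le> (LINT \<tau>|lebesgue_on {t i<..<t (Suc i)}. m \<tau>) + c * (t (Suc i) - t i) * (g (t i) + g (t (Suc i)))"
        using s n(2) rng[of i] rng[of "Suc i"] i by (intro le tW) (auto simp: \<eta>_def)
      also have "(LINT \<tau>|lebesgue_on {t i<..<t (Suc i)}. m \<tau>) = I m (t (Suc i)) - I m (t i)"
        using s rng[of i] rng[of "Suc i"] i by (intro I m) auto
      also have "c * (t (Suc i) - t i) * (g (t i) + g (t (Suc i))) \<le> c * (2 * \<eta>) * (g (t i) + g (t (Suc i)))"
        using s c g(2) by (intro mult_right_mono mult_left_mono add_nonneg_nonneg) auto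
      finally show ?thesis by simp
    qed
    have "\<bar>h b - h a\<bar> = \<bar>\<Sum>i<Suc n. h (t (Suc i)) - h (t i)\<bar>"
      by (subst sum_lessThan_telescope) (simp add: t_def)
    also have "\<dots> \<le> (\<Sum>i<Suc n. \<bar>h (t (Suc i)) - h (t i)\<bar>)" by (rule sum_abs)
    also have "\<dots> \<le> (\<Sum>i<Suc n. (I m (t (Suc i)) - I m (t i)) + c * (2 * \<eta>) * (g (t i) + g (t (Suc i))))"
      by (intro sum_mono one) auto
    also have "\<dots> = (I m b - I m a) + c * (2 * \<eta>) * (\<Sum>i<Suc n. g (t i) + g (t (Suc i)))"
      unfolding sum.distrib[of "\<lambda>i. I m (t (Suc i)) - I m (t i)"] sum_distrib_left[symmetric]
        sum_lessThan_telescope[of "\<lambda>i. I m (t i)" "Suc n"] t0 by simp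
    also have "(\<Sum>i<Suc n. g (t i) + g (t (Suc i))) = g a + g b + 2 * (\<Sum>i<n. g (\<tau> i))"
    proof -
      have "(\<Sum>i<Suc n. g (t i)) = g a + (\<Sum>i<n. g (\<tau> i))"
        by (subst sum.lessThan_Suc_shift) (auto simp: t_def intro!: sum.cong)
      moreover have "(\<Sum>i<Suc n. g (t (Suc i))) = (\<Sum>i<n. g (\<tau> i)) + g b"
        by (auto simp: t_def intro!: sum.cong)
      ultimately show ?thesis by (simp only: sum.distrib)
    qed
    also have "c * (2 * \<eta>) * (g a + g b + 2 * (\<Sum>i<n. g (\<tau> i)))
        = 4 * c * (\<Sum>i<n. \<eta> * g (\<tau> i)) + 2 * c * \<eta> * (g a + g b)"
      by (simp add: sum_distrib_left[symmetric] algebra_simps)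
    also have "(\<Sum>i<n. \<eta> * g (\<tau> i)) \<le> (\<Sum>i<n. I g (a + real (Suc i) * \<eta>) - I g (a + real i * \<eta>))"
      by (intro sum_mono \<tau>(3)) auto
    also have "\<dots> = I g b - I g a"
      by (subst sum_lessThan_telescope) (simp add: \<eta>(2))
    finally have "\<bar>h b - h a\<bar> \<le> (I m b - I m a) + (4 * c * (I g b - I g a) + 2 * c * \<eta> * (g a + g b))"
      using c by (simp add: mult_left_mono)
    moreover have "I k a = 0" for k by (simp add: I_def)
    ultimately show ?thesis by (simp add: \<eta>_def)
  qed
  have l: "(\<lambda>n. I m b + 4 * c * I g b + 2 * c * ((b - a) / real n) * (g a + g b)) \<longlonglongrightarrow> I m b + 4 * c * I g b + 2 * c * 0 * (g a + g b)"
    by (intro tendsto_intros tendsto_divide_0[OF tendsto_const] filterlim_compose[OF filterlim_at_top_imp_at_infinity filterlim_real_sequentially])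
  have z: "(\<lambda>n. 2 * ((b - a) / real n)) \<longlonglongrightarrow> 0" by real_asymp
  have "\<forall>\<^sub>F n in sequentially. 2 * ((b - a) / real n) < d" using z d by (simp add: order_tendsto_iff)
  then have "\<forall>\<^sub>F n in sequentially. \<bar>h b - h a\<bar> \<le> I m b + 4 * c * I g b + 2 * c * ((b - a) / real n) * (g a + g b)"
    using eventually_gt_at_top[of 0] by eventually_elim (rule main)
  from tendsto_lowerbound[OF l this] show ?thesis by (simp add: I_def)
qed

lemma integral_interval_absolutely_continuous:
  fixes f :: "real \<Rightarrow> real"
  assumes f: "integrable (lebesgue_on {0<..<T}) f" and T: "T > 0" and e: "e > 0"
  obtains d where "d > 0" "\<And>s t. 0 \<le> s \<Longrightarrow> s \<le> t \<Longrightarrow> t \<le> T \<Longrightarrow> t - s < d \<Longrightarrow> (LINT \<tau>|lebesgue_on {s<..<t}. f \<tau>) < e"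
proof -
  have fo: "f integrable_on {0<..<T}" using f by (intro integrable_on_lebesgue_on) auto
  then have fc: "f integrable_on {0..T}" by (simp add: integrable_on_Icc_iff_Ioo)
  have eq: "(LINT \<tau>|lebesgue_on {s<..<t}. f \<tau>) = integral {0..t} f - integral {0..s} f" if "0 \<le> s" "s \<le> t" "t \<le> T" for s t
  proof -
    have "(LINT \<tau>|lebesgue_on {0<..<x}. f \<tau>) = integral {0..x} f" if "0 \<le> x" "x \<le> T" for x
    proof -
      have "integrable (lebesgue_on {0<..<x}) f" using that by (intro integrable_lebesgue_on_subset[OF f]) auto
      from lebesgue_integral_eq_integral[OF this]
      show ?thesis by (simp add: integral_open_interval_real)
    qed
    then show ?thesis using integral_interval_diff[OF f that] that by simp
  qed
  have "uniformly_continuous_on {0..T} (\<lambda>x. integral {0..x} f)"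
    by (intro compact_uniformly_continuous indefinite_integral_continuous_1 fc) auto
  then obtain d where d: "d > 0" "\<And>x y. x \<in> {0..T} \<Longrightarrow> y \<in> {0..T} \<Longrightarrow> dist y x < d \<Longrightarrow> dist (integral {0..y} f) (integral {0..x} f) < e"
    using e unfolding uniformly_continuous_on_def by metis
  show ?thesis
  proof (rule that[OF d(1)])
    fix s t :: real assume st: "0 \<le> s" "s \<le> t" "t \<le> T" "t - s < d"
    then have "dist (integral {0..t} f) (integral {0..s} f) < e" by (intro d(2)) (auto simp: dist_real_def)
    then show "(LINT \<tau>|lebesgue_on {s<..<t}. f \<tau>) < e" unfolding eq[OF st(1-3)] by (simp add: dist_real_def)
  qed
qed

section \<open>Constancy of the pairing of two evolutions\<close>

text \<open>
  Approximation in \<open>L\<^sup>2(0,T;V)\<close> by uniformly continuous paths.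
\<close>

definition approximable :: "(real^3) set \<Rightarrow> real \<Rightarrow> (real \<Rightarrow> field3) \<Rightarrow> bool" where
  "approximable D T u \<longleftrightarrow> (\<forall>\<delta>>0. \<exists>\<Psi>. (\<forall>t. \<Psi> t \<in> H12_0 D) \<and>
     (\<forall>e>0. \<exists>d>0. \<forall>s\<in>{0<..<T}. \<forall>t\<in>{0<..<T}. \<bar>s - t\<bar> < d \<longrightarrow> H12_norm D (\<lambda>x. \<Psi> s x - \<Psi> t x) < e) \<and>
     integrable (lebesgue_on {0<..<T}) (\<lambda>t. (H12_norm D (\<lambda>x. u t x - \<Psi> t x))\<^sup>2) \<and>
     (LINT t|lebesgue_on {0<..<T}. (H12_norm D (\<lambda>x. u t x - \<Psi> t x))\<^sup>2) < \<delta>)"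

text \<open>
  A bound for the modulus of continuity of a functional \<open>l\<close> on the ball of radius
  \<open>M\<close> in \<open>H\<close>.  For a fixed \<open>e\<close> it is much weaker than
  boundedness on \<open>V\<close>, yet sufficient when it holds for all \<open>e\<close> with the
  same \<open>a\<close>.
\<close>

definition rate_bound :: "(real^3) set \<Rightarrow> real \<Rightarrow> real \<Rightarrow> real \<Rightarrow> (field3 \<Rightarrow> real) \<Rightarrow> real \<Rightarrow> bool" where
  "rate_bound D M e C l a \<longleftrightarrow> (\<forall>\<phi>\<in>V_space D. \<forall>\<psi>\<in>V_space D.
     Lp_norm D 2 \<phi> \<le> M \<longrightarrow> Lp_norm D 2 \<psi> \<le> M \<longrightarrow>
     \<bar>l \<phi> - l \<psi>\<bar> \<le> e * a + C * (H12_norm D (\<lambda>x. \<phi> x - \<psi> x))\<^sup>2)"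

lemma rate_boundD:
  "rate_bound D M e C l a \<Longrightarrow> \<phi> \<in> V_space D \<Longrightarrow> \<psi> \<in> V_space D \<Longrightarrow> Lp_norm D 2 \<phi> \<le> M \<Longrightarrow> Lp_norm D 2 \<psi> \<le> M
    \<Longrightarrow> \<bar>l \<phi> - l \<psi>\<bar> \<le> e * a + C * (H12_norm D (\<lambda>x. \<phi> x - \<psi> x))\<^sup>2"
  unfolding rate_bound_def by blast

text \<open>
  The properties of a weak solution on which the product rule depends: \<open>u\<close> is the path,
  \<open>r\<close> its time derivative with values in functionals on \<open>V\<close>, given by the
  right hand side of the equation, and \<open>m\<close> the integrable majorant of \<open>r\<close>.
\<close>

definition evolution ::
    "(real^3) set \<Rightarrow> real \<Rightarrow> real \<Rightarrow> (real \<Rightarrow> field3) \<Rightarrow> (real \<Rightarrow> field3 \<Rightarrow> real) \<Rightarrow> (real \<Rightarrow> real) \<Rightarrow> bool" where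
  "evolution D T M u r m \<longleftrightarrow>
     (\<forall>t\<in>{0..T}. u t \<in> Lp_on D 2) \<and>
     (\<forall>g\<in>Lp_on D 2. continuous_on {0..T} (\<lambda>t. L2_inner D (u t) g)) \<and>
     (AE t in lebesgue_on {0<..<T}. u t \<in> V_space D \<and> Lp_norm D 2 (u t) \<le> M) \<and>
     (\<forall>\<phi>\<in>V_space D. integrable (lebesgue_on {0<..<T}) (\<lambda>\<tau>. r \<tau> \<phi>)) \<and>
     (\<forall>\<phi>\<in>V_space D. \<forall>s t. 0 < s \<and> s < t \<and> t < T \<longrightarrow>
        L2_inner D (u t) \<phi> - L2_inner D (u s) \<phi> = (LINT \<tau>|lebesgue_on {s<..<t}. r \<tau> \<phi>)) \<and>
     integrable (lebesgue_on {0<..<T}) m \<and> (\<forall>\<tau>. m \<tau> \<ge> 0) \<and>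
     (\<forall>e>0. \<exists>C\<ge>0. AE \<tau> in lebesgue_on {0<..<T}. rate_bound D M e C (r \<tau>) (m \<tau>)) \<and>
     integrable (lebesgue_on {0<..<T}) (\<lambda>\<tau>. (H12_norm D (u \<tau>))\<^sup>2) \<and>
     (\<forall>\<phi>\<in>V_space D. integrable (lebesgue_on {0<..<T}) (\<lambda>\<tau>. (H12_norm D (\<lambda>x. u \<tau> x - \<phi> x))\<^sup>2)) \<and>
     approximable D T u"

lemma evolutionD:
  assumes "evolution D T M u r m"
  shows evolution_L2: "\<And>t. t \<in> {0..T} \<Longrightarrow> u t \<in> Lp_on D 2"
    and evolution_weakly_continuous: "\<And>g. g \<in> Lp_on D 2 \<Longrightarrow> continuous_on {0..T} (\<lambda>t. L2_inner D (u t) g)"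
    and evolution_AE: "AE t in lebesgue_on {0<..<T}. u t \<in> V_space D \<and> Lp_norm D 2 (u t) \<le> M"
    and evolution_rate_integrable: "\<And>\<phi>. \<phi> \<in> V_space D \<Longrightarrow> integrable (lebesgue_on {0<..<T}) (\<lambda>\<tau>. r \<tau> \<phi>)"
    and evolution_increment: "\<And>\<phi> s t. \<phi> \<in> V_space D \<Longrightarrow> 0 < s \<Longrightarrow> s < t \<Longrightarrow> t < T \<Longrightarrow>
        L2_inner D (u t) \<phi> - L2_inner D (u s) \<phi> = (LINT \<tau>|lebesgue_on {s<..<t}. r \<tau> \<phi>)"
    and evolution_m: "integrable (lebesgue_on {0<..<T}) m" "\<And>\<tau>. m \<tau> \<ge> 0"
    and evolution_modulus: "\<And>e. e > 0 \<Longrightarrow> \<exists>C\<ge>0. AE \<tau> in lebesgue_on {0<..<T}. rate_bound D M e C (r \<tau>) (m \<tau>)"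
    and evolution_square_integrable: "integrable (lebesgue_on {0<..<T}) (\<lambda>\<tau>. (H12_norm D (u \<tau>))\<^sup>2)"
    and evolution_distance_integrable: "\<And>\<phi>. \<phi> \<in> V_space D \<Longrightarrow> integrable (lebesgue_on {0<..<T}) (\<lambda>\<tau>. (H12_norm D (\<lambda>x. u \<tau> x - \<phi> x))\<^sup>2)"
    and evolution_approximable: "approximable D T u"
  using assms unfolding evolution_def by blast+

lemma V_space_H12_0: "f \<in> V_space D \<Longrightarrow> f \<in> H12_0 D" by (simp add: V_space_def)
lemma V_space_H12: "f \<in> V_space D \<Longrightarrow> f \<in> H12 D" by (simp add: V_space_def H12_0_def)
lemma V_space_Lp: "f \<in> V_space D \<Longrightarrow> f \<in> Lp_on D 2" by (auto dest!: V_space_H12 simp: H12_def)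

lemma L2_inner_commute: "L2_inner D f g = L2_inner D g f"
  by (simp add: L2_inner_def inner_commute)

lemma L2_inner_integrable: "f \<in> Lp_on D 2 \<Longrightarrow> g \<in> Lp_on D 2 \<Longrightarrow> integrable (lebesgue_on D) (\<lambda>x. f x \<bullet> g x)"
  unfolding Lp_on_2_iff by (rule integrable_inner_sq)

lemma L2_inner_lincomb_left:
  assumes "f \<in> Lp_on D 2" "g \<in> Lp_on D 2" "h \<in> Lp_on D 2"
  shows "L2_inner D (\<lambda>x. a *\<^sub>R f x + b *\<^sub>R g x) h = a * L2_inner D f h + b * L2_inner D g h"
  using L2_inner_integrable[OF assms(1,3)] L2_inner_integrable[OF assms(2,3)]
  by (simp add: L2_inner_def inner_add_left)

lemma L2_inner_diff_left:
  assumes "f \<in> Lp_on D 2" "g \<in> Lp_on D 2" "h \<in> Lp_on D 2"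
  shows "L2_inner D (\<lambda>x. f x - g x) h = L2_inner D f h - L2_inner D g h"
  using L2_inner_lincomb_left[OF assms, of 1 "-1"] by simp

lemma L2_diff: "f \<in> Lp_on D 2 \<Longrightarrow> g \<in> Lp_on D 2 \<Longrightarrow> (\<lambda>x. f x - g x) \<in> Lp_on D 2"
  by (rule Lp_on_diff) auto

lemma L2_inner_diff_right:
  assumes "f \<in> Lp_on D 2" "g \<in> Lp_on D 2" "h \<in> Lp_on D 2"
  shows "L2_inner D h (\<lambda>x. f x - g x) = L2_inner D h f - L2_inner D h g"
  using L2_inner_diff_left[OF assms] by (simp add: L2_inner_commute)

lemma L2_inner_self: "L2_inner D f f = (Lp_norm D 2 f)\<^sup>2"
  by (simp add: L2_inner_def Lp_norm_2 l2_power2 power2_norm_eq_inner)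

lemma L2_inner_bound: "f \<in> Lp_on D 2 \<Longrightarrow> g \<in> Lp_on D 2 \<Longrightarrow> \<bar>L2_inner D f g\<bar> \<le> Lp_norm D 2 f * Lp_norm D 2 g"
  unfolding Lp_on_2_iff L2_inner_def Lp_norm_2 by (rule l2_inner_bound)

lemma L2_distance_square:
  assumes "f \<in> Lp_on D 2" "g \<in> Lp_on D 2"
  shows "(Lp_norm D 2 (\<lambda>x. f x - g x))\<^sup>2 = L2_inner D f f - 2 * L2_inner D f g + L2_inner D g g"
  unfolding L2_inner_self[symmetric]
  by (simp add: L2_inner_diff_left L2_inner_diff_right L2_diff assms L2_inner_commute[of D g f])

text \<open>
  Weak lower semicontinuity of the norm, in the form of testing \<open>u t - z\<close> with itself.
\<close>

lemma weak_bound_imp_norm_bound: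
  fixes p q t :: real
  assumes u: "\<And>t. t \<in> {p..q} \<Longrightarrow> u t \<in> Lp_on D 2" and c: "\<And>g. g \<in> Lp_on D 2 \<Longrightarrow> continuous_on {p..q} (\<lambda>t. L2_inner D (u t) g)"
    and pq: "p < q" and z: "z \<in> Lp_on D 2" and B: "B \<ge> 0"
    and ae: "AE t in lebesgue_on {p<..<q}. Lp_norm D 2 (\<lambda>x. u t x - z x) \<le> B" and t: "t \<in> {p..q}"
  shows "Lp_norm D 2 (\<lambda>x. u t x - z x) \<le> B"
proof -
  define y where "y = (\<lambda>x. u t x - z x)"
  have y: "y \<in> Lp_on D 2" unfolding y_def by (intro L2_diff u z t)
  have "L2_inner D (u t) y - L2_inner D z y \<le> B * Lp_norm D 2 y"
  proof (rule continuous_AE_bound[OF _ pq _ t])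
    show "continuous_on {p..q} (\<lambda>t. L2_inner D (u t) y - L2_inner D z y)" by (intro continuous_intros c y)
    have "AE s in lebesgue_on {p<..<q}. s \<in> {p<..<q}"
      using AE_space[of "lebesgue_on {p<..<q}"] by simp
    with ae show "AE s in lebesgue_on {p<..<q}. L2_inner D (u s) y - L2_inner D z y \<le> B * Lp_norm D 2 y"
    proof eventually_elim
      case (elim s)
      have us: "u s \<in> Lp_on D 2" using elim by (intro u) auto
      have "L2_inner D (u s) y - L2_inner D z y = L2_inner D (\<lambda>x. u s x - z x) y"
        by (rule L2_inner_diff_left[OF us z y, symmetric])
      also have "\<dots> \<le> Lp_norm D 2 (\<lambda>x. u s x - z x) * Lp_norm D 2 y"
        using L2_inner_bound[OF L2_diff[OF us z] y] by linarith
      also have "\<dots> \<le> B * Lp_norm D 2 y" using elim by (intro mult_right_mono) auto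
      finally show ?case .
    qed
  qed
  then have "(Lp_norm D 2 y)\<^sup>2 \<le> B * Lp_norm D 2 y"
    using L2_inner_diff_left[OF u[OF t] z y] by (simp add: L2_inner_self[symmetric] y_def)
  then have "Lp_norm D 2 y \<le> B"
    using B Lp_norm_nonneg[of D 2 y] by (cases "0 < Lp_norm D 2 y") (auto simp: power2_eq_square)
  then show ?thesis by (simp add: y_def)
qed

lemma H12_norm_diff_square:
  assumes "open D" "f \<in> H12 D" "g \<in> H12 D"
  shows "(H12_norm D (\<lambda>x. f x - g x))\<^sup>2 \<le> 2 * (H12_norm D f)\<^sup>2 + 2 * (H12_norm D g)\<^sup>2"
proof -
  have "(H12_norm D (\<lambda>x. f x - g x))\<^sup>2 \<le> (H12_norm D f + H12_norm D g)\<^sup>2"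
    by (intro power_mono H12_norm_diff assms) simp
  also have "\<dots> \<le> 2 * (H12_norm D f)\<^sup>2 + 2 * (H12_norm D g)\<^sup>2"
    using zero_le_power2[of "H12_norm D f - H12_norm D g"] by (simp add: power2_eq_square algebra_simps)
  finally show ?thesis .
qed

text \<open>
  The increment of \<open>\<parallel>u - u c\<parallel>\<^sub>H\<^sup>2\<close> between
  \<open>s\<close> and \<open>t\<close> is the integral of \<open>(r\<^sub>\<tau>(u t) -
  r\<^sub>\<tau>(u c)) + (r\<^sub>\<tau>(u s) - r\<^sub>\<tau>(u c))\<close>, so the rate bound with
  \<open>e = 1\<close> controls it by \<open>m\<close> and by the distances to \<open>u c\<close> in
  \<open>V\<close> at the end points.  This is the increment bound required by the partition
  estimate; the base point is one of the ends of the interval, where the distance vanishes.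
\<close>

lemma evolution_local_estimate:
  assumes D: "open D" and ev: "evolution D T M u r m"
  shows "\<exists>C W. C \<ge> 0 \<and> (AE t in lebesgue_on {0<..<T}. t \<in> W) \<and> W \<subseteq> {0<..<T} \<and> (\<forall>t\<in>W. u t \<in> V_space D)
    \<and> (\<forall>a\<in>W. \<forall>b\<in>W. a < b \<longrightarrow>
       (Lp_norm D 2 (\<lambda>x. u b x - u a x))\<^sup>2 \<le> 2 * (LINT \<tau>|lebesgue_on {a<..<b}. m \<tau>)
          + 4 * C * (LINT \<tau>|lebesgue_on {a<..<b}. (H12_norm D (\<lambda>x. u \<tau> x - u a x))\<^sup>2))
    \<and> (\<forall>a\<in>W. \<forall>b\<in>W. a < b \<longrightarrow>
       (Lp_norm D 2 (\<lambda>x. u a x - u b x))\<^sup>2 \<le> 2 * (LINT \<tau>|lebesgue_on {a<..<b}. m \<tau>)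
          + 4 * C * (LINT \<tau>|lebesgue_on {a<..<b}. (H12_norm D (\<lambda>x. u \<tau> x - u b x))\<^sup>2))"
proof -
  obtain C where C: "C \<ge> 0" and mod: "AE \<tau> in lebesgue_on {0<..<T}. rate_bound D M 1 C (r \<tau>) (m \<tau>)"
    using evolution_modulus[OF ev zero_less_one] by blast
  define W where "W = {t \<in> {0<..<T}. u t \<in> V_space D \<and> Lp_norm D 2 (u t) \<le> M}"
  have W: "AE t in lebesgue_on {0<..<T}. t \<in> W"
    using evolution_AE[OF ev] AE_space[of "lebesgue_on {0<..<T}"] by eventually_elim (simp add: W_def)
  have WV: "u t \<in> V_space D" "Lp_norm D 2 (u t) \<le> M" "0 < t" "t < T" if "t \<in> W" for t
    using that by (auto simp: W_def)
  have step: "\<bar>(Lp_norm D 2 (\<lambda>x. u t x - u c x))\<^sup>2 - (Lp_norm D 2 (\<lambda>x. u s x - u c x))\<^sup>2\<bar>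
      \<le> (LINT \<tau>|lebesgue_on {s<..<t}. 2 * m \<tau>) + C * (t - s) * ((H12_norm D (\<lambda>x. u s x - u c x))\<^sup>2 + (H12_norm D (\<lambda>x. u t x - u c x))\<^sup>2)"
    if s: "s \<in> W" and t: "t \<in> W" and c: "c \<in> W" and st: "s < t" for s t c
  proof -
    let ?g = "\<lambda>t. (H12_norm D (\<lambda>x. u t x - u c x))\<^sup>2"
    let ?L = "lebesgue_on {s<..<t}"
    have sub: "{s<..<t} \<subseteq> {0<..<T}" using WV[OF s] WV[OF t] by auto
    have ri: "integrable ?L (\<lambda>\<tau>. r \<tau> (u y))" if "y \<in> W" for y
      by (rule integrable_lebesgue_on_subset[OF evolution_rate_integrable[OF ev WV(1)[OF that]] sub]) auto
    have mi: "integrable ?L m" by (rule integrable_lebesgue_on_subset[OF evolution_m(1)[OF ev] sub]) auto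
    have inc: "L2_inner D (u t) (u y) - L2_inner D (u s) (u y) = (LINT \<tau>|?L. r \<tau> (u y))" if "y \<in> W" for y
      by (rule evolution_increment[OF ev WV(1)[OF that] WV(3)[OF s] st WV(4)[OF t]])
    have L: "u y \<in> Lp_on D 2" if "y \<in> W" for y by (rule V_space_Lp[OF WV(1)[OF that]])
    have bd: "\<bar>LINT \<tau>|?L. r \<tau> (u y) - r \<tau> (u c)\<bar> \<le> (LINT \<tau>|?L. m \<tau>) + (t - s) * (C * ?g y)" if y: "y \<in> W" for y
    proof -
      have "\<bar>LINT \<tau>|?L. r \<tau> (u y) - r \<tau> (u c)\<bar> \<le> (LINT \<tau>|?L. \<bar>r \<tau> (u y) - r \<tau> (u c)\<bar>)" by (rule integral_abs_bound)
      also have "\<dots> \<le> (LINT \<tau>|?L. m \<tau> + C * ?g y)"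
      proof (rule integral_mono_AE)
        show "AE \<tau> in ?L. \<bar>r \<tau> (u y) - r \<tau> (u c)\<bar> \<le> m \<tau> + C * ?g y"
          using AE_lebesgue_on_subset[OF mod sub, simplified]
          by eventually_elim (use rate_boundD[OF _ WV(1)[OF y] WV(1)[OF c] WV(2)[OF y] WV(2)[OF c]] in force)
      qed (use ri[OF y] ri[OF c] mi integrable_const_interval in auto)
      also have "\<dots> = (LINT \<tau>|?L. m \<tau>) + (t - s) * (C * ?g y)"
        using mi integrable_const_interval integral_const_interval[of s t "C * ?g y"] st by simp
      finally show ?thesis .
    qed
    have "(Lp_norm D 2 (\<lambda>x. u t x - u c x))\<^sup>2 - (Lp_norm D 2 (\<lambda>x. u s x - u c x))\<^sup>2
      = (L2_inner D (u t) (u t) - L2_inner D (u s) (u t)) + (L2_inner D (u t) (u s) - L2_inner D (u s) (u s))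
        - 2 * (L2_inner D (u t) (u c) - L2_inner D (u s) (u c))"
      unfolding L2_distance_square[OF L[OF t] L[OF c]] L2_distance_square[OF L[OF s] L[OF c]]
      using L2_inner_commute[of D "u s" "u t"] by simp
    also have "\<dots> = (LINT \<tau>|?L. r \<tau> (u t) - r \<tau> (u c)) + (LINT \<tau>|?L. r \<tau> (u s) - r \<tau> (u c))"
      unfolding inc[OF t] inc[OF s] inc[OF c] using ri[OF t] ri[OF s] ri[OF c] by simp
    finally show ?thesis using bd[OF t] bd[OF s] by (simp add: algebra_simps)
  qed
  have est: "\<bar>(Lp_norm D 2 (\<lambda>x. u b x - u c x))\<^sup>2 - (Lp_norm D 2 (\<lambda>x. u a x - u c x))\<^sup>2\<bar>
      \<le> (LINT \<tau>|lebesgue_on {a<..<b}. 2 * m \<tau>)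
          + 4 * C * (LINT \<tau>|lebesgue_on {a<..<b}. (H12_norm D (\<lambda>x. u \<tau> x - u c x))\<^sup>2)"
    if a: "a \<in> W" and b: "b \<in> W" and c: "c \<in> W" and ab: "a < b" for a b c
  proof -
    have sub: "{a<..<b} \<subseteq> {0<..<T}" using WV[OF a] WV[OF b] by auto
    show ?thesis
    proof (rule partition_estimate[OF ab _ a b, where d=1])
      show "AE t in lebesgue_on {a<..<b}. t \<in> W" by (rule AE_lebesgue_on_subset[OF W sub]) auto
      show "integrable (lebesgue_on {a<..<b}) (\<lambda>\<tau>. (H12_norm D (\<lambda>x. u \<tau> x - u c x))\<^sup>2)"
        by (rule integrable_lebesgue_on_subset[OF evolution_distance_integrable[OF ev WV(1)[OF c]] sub]) auto
      have "integrable (lebesgue_on {a<..<b}) m"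
        by (rule integrable_lebesgue_on_subset[OF evolution_m(1)[OF ev] sub]) auto
      then show "integrable (lebesgue_on {a<..<b}) (\<lambda>\<tau>. 2 * m \<tau>)" by simp
    qed (use C step c in auto)
  qed
  have zero: "Lp_norm D 2 (\<lambda>x. f x - f x) = 0" for f :: field3
    by (simp add: Lp_norm_2 l2_def)
  show ?thesis
  proof (intro exI[of _ C] exI[of _ W] conjI ballI impI)
    show "W \<subseteq> {0<..<T}" by (auto simp: W_def)
    show "u t \<in> V_space D" if "t \<in> W" for t using WV(1)[OF that] .
    show "(Lp_norm D 2 (\<lambda>x. u b x - u a x))\<^sup>2 \<le> 2 * (LINT \<tau>|lebesgue_on {a<..<b}. m \<tau>)
          + 4 * C * (LINT \<tau>|lebesgue_on {a<..<b}. (H12_norm D (\<lambda>x. u \<tau> x - u a x))\<^sup>2)"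
      if "a \<in> W" "b \<in> W" "a < b" for a b
      using est[OF that(1,2) that(1,3)] zero[of "u a"] by simp
    show "(Lp_norm D 2 (\<lambda>x. u a x - u b x))\<^sup>2 \<le> 2 * (LINT \<tau>|lebesgue_on {a<..<b}. m \<tau>)
          + 4 * C * (LINT \<tau>|lebesgue_on {a<..<b}. (H12_norm D (\<lambda>x. u \<tau> x - u b x))\<^sup>2)"
      if "a \<in> W" "b \<in> W" "a < b" for a b
      using est[OF that(1,2) that(2,3)] zero[of "u b"] by simp
  qed (use C W in auto)
qed

text \<open>
  Take a short interval and, as base point, a point \<open>c\<close> in it at which
  \<open>\<parallel>u\<parallel>\<^sub>V\<^sup>2\<close> is at most its mean value.  Then the
  integral of \<open>\<parallel>u - u c\<parallel>\<^sub>V\<^sup>2\<close> over the interval is at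
  most four times that of \<open>\<parallel>u\<parallel>\<^sub>V\<^sup>2\<close>, which is small by
  absolute continuity of the integral, and the previous estimate bounds the oscillation of
  \<open>u\<close>.
\<close>

lemma evolution_strongly_continuous:
  assumes D: "open D" and T: "T > 0" and ev: "evolution D T M u r m" and e: "e > 0"
  shows "\<exists>d>0. \<forall>t\<in>{0..T}. \<forall>t'\<in>{0..T}. \<bar>t' - t\<bar> < d \<longrightarrow> Lp_norm D 2 (\<lambda>x. u t' x - u t x) \<le> e"
proof -
  obtain C :: real and W :: "real set" where C: "C \<ge> 0" and W: "AE t in lebesgue_on {0<..<T}. t \<in> W" "W \<subseteq> {0<..<T}"
    and WV: "\<forall>t\<in>W. u t \<in> V_space D"
    and up: "\<forall>a\<in>W. \<forall>b\<in>W. a < b \<longrightarrow> (Lp_norm D 2 (\<lambda>x. u b x - u a x))\<^sup>2 \<le> 2 * (LINT \<tau>|lebesgue_on {a<..<b}. m \<tau>)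
          + 4 * C * (LINT \<tau>|lebesgue_on {a<..<b}. (H12_norm D (\<lambda>x. u \<tau> x - u a x))\<^sup>2)"
    and down: "\<forall>a\<in>W. \<forall>b\<in>W. a < b \<longrightarrow> (Lp_norm D 2 (\<lambda>x. u a x - u b x))\<^sup>2 \<le> 2 * (LINT \<tau>|lebesgue_on {a<..<b}. m \<tau>)
          + 4 * C * (LINT \<tau>|lebesgue_on {a<..<b}. (H12_norm D (\<lambda>x. u \<tau> x - u b x))\<^sup>2)"
    using evolution_local_estimate[OF D ev] by (elim exE conjE) (rule that)
  note WV = WV[rule_format] and up = up[rule_format] and down = down[rule_format]
  define f where "f \<tau> = 2 * m \<tau> + 16 * C * (H12_norm D (u \<tau>))\<^sup>2" for \<tau>
  have fi: "integrable (lebesgue_on {0<..<T}) f"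
    unfolding f_def using evolution_m(1)[OF ev] evolution_square_integrable[OF ev] by simp
  have "(e / 2)\<^sup>2 > 0" using e by simp
  then obtain d where d: "d > 0" and small: "\<And>s t. 0 \<le> s \<Longrightarrow> s \<le> t \<Longrightarrow> t \<le> T \<Longrightarrow> t - s < d \<Longrightarrow> (LINT \<tau>|lebesgue_on {s<..<t}. f \<tau>) < (e / 2)\<^sup>2"
    using integral_interval_absolutely_continuous[OF fi T] by metis
  have osc: "Lp_norm D 2 (\<lambda>x. u t' x - u t x) \<le> e"
    if pq: "0 \<le> p" "p < q" "q \<le> T" "q - p < d" and t: "t \<in> {p..q}" "t' \<in> {p..q}" for p q t t'
  proof -
    let ?L = "lebesgue_on {p<..<q}"
    have sub: "{p<..<q} \<subseteq> {0<..<T}" using pq by auto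
    have Wpq: "AE t in ?L. t \<in> W" by (rule AE_lebesgue_on_subset[OF W(1) sub]) auto
    have ui: "integrable ?L (\<lambda>\<tau>. (H12_norm D (u \<tau>))\<^sup>2)"
      by (rule integrable_lebesgue_on_subset[OF evolution_square_integrable[OF ev] sub]) auto
    have mi: "integrable ?L m" by (rule integrable_lebesgue_on_subset[OF evolution_m(1)[OF ev] sub]) auto
    (* the base point: its norm in V is at most the mean over the interval *)
    obtain c where c: "c \<in> {p<..<q}" "c \<in> W" "(q - p) * (H12_norm D (u c))\<^sup>2 \<le> (LINT t|?L. (H12_norm D (u t))\<^sup>2)"
      using mean_value_point[OF pq(2) ui Wpq] by blast
    note cV = WV[OF c(2)]
    let ?g = "\<lambda>\<tau>. (H12_norm D (\<lambda>x. u \<tau> x - u c x))\<^sup>2"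
    have gi: "integrable ?L ?g"
      by (rule integrable_lebesgue_on_subset[OF evolution_distance_integrable[OF ev cV] sub]) auto
    have "(LINT \<tau>|?L. ?g \<tau>) \<le> (LINT \<tau>|?L. 2 * (H12_norm D (u \<tau>))\<^sup>2 + 2 * (H12_norm D (u c))\<^sup>2)"
    proof (rule integral_mono_AE[OF gi])
      show "AE \<tau> in ?L. ?g \<tau> \<le> 2 * (H12_norm D (u \<tau>))\<^sup>2 + 2 * (H12_norm D (u c))\<^sup>2"
        using Wpq by eventually_elim (intro H12_norm_diff_square D V_space_H12 WV cV)
    qed (use ui integrable_const_interval in auto)
    also have "\<dots> = 2 * (LINT \<tau>|?L. (H12_norm D (u \<tau>))\<^sup>2) + (q - p) * (2 * (H12_norm D (u c))\<^sup>2)"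
      using ui integrable_const_interval integral_const_interval[of p q "2 * (H12_norm D (u c))\<^sup>2"] pq(2) by simp
    also have "\<dots> \<le> 4 * (LINT \<tau>|?L. (H12_norm D (u \<tau>))\<^sup>2)" using c(3) by simp
    finally have g4: "(LINT \<tau>|?L. ?g \<tau>) \<le> 4 * (LINT \<tau>|?L. (H12_norm D (u \<tau>))\<^sup>2)" .
    have f: "(LINT \<tau>|?L. f \<tau>) = 2 * (LINT \<tau>|?L. m \<tau>) + 16 * C * (LINT \<tau>|?L. (H12_norm D (u \<tau>))\<^sup>2)"
      unfolding f_def using mi ui by simp
    have mono: "(LINT \<tau>|lebesgue_on {a<..<b}. k \<tau>) \<le> (LINT \<tau>|?L. k \<tau>)"
      if "integrable ?L k" "\<And>\<tau>. k \<tau> \<ge> 0" "p \<le> a" "a \<le> b" "b \<le> q" for k :: "real \<Rightarrow> real" and a b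
    proof -
      have n: "(LINT \<tau>|lebesgue_on S. k \<tau>) \<ge> 0" for S using that(2) by simp
      have "(LINT \<tau>|?L. k \<tau>) = (LINT \<tau>|lebesgue_on {p<..<b}. k \<tau>) + (LINT \<tau>|lebesgue_on {b<..<q}. k \<tau>)"
        using that by (intro integral_interval_split) auto
      moreover have "(LINT \<tau>|lebesgue_on {p<..<b}. k \<tau>) = (LINT \<tau>|lebesgue_on {p<..<a}. k \<tau>) + (LINT \<tau>|lebesgue_on {a<..<b}. k \<tau>)"
        using that by (intro integral_interval_split[OF that(1)]) auto
      ultimately show ?thesis using n[of "{b<..<q}"] n[of "{p<..<a}"] by linarith
    qed
    have near: "Lp_norm D 2 (\<lambda>x. u s x - u c x) \<le> e / 2" if s: "s \<in> {p<..<q}" "s \<in> W" for s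
    proof -
      have key: "2 * (LINT \<tau>|lebesgue_on {a<..<b}. m \<tau>) + 4 * C * (LINT \<tau>|lebesgue_on {a<..<b}. ?g \<tau>) \<le> (e / 2)\<^sup>2"
        if "p \<le> a" "a \<le> b" "b \<le> q" for a b
      proof -
        have "2 * (LINT \<tau>|lebesgue_on {a<..<b}. m \<tau>) + 4 * C * (LINT \<tau>|lebesgue_on {a<..<b}. ?g \<tau>)
           \<le> 2 * (LINT \<tau>|?L. m \<tau>) + 4 * C * (LINT \<tau>|?L. ?g \<tau>)"
          using C that by (intro add_mono mult_left_mono mono mi gi) (auto simp: evolution_m(2)[OF ev])
        also have "\<dots> \<le> 2 * (LINT \<tau>|?L. m \<tau>) + 4 * C * (4 * (LINT \<tau>|?L. (H12_norm D (u \<tau>))\<^sup>2))"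
          using C by (intro add_left_mono mult_left_mono g4) auto
        also have "\<dots> = (LINT \<tau>|?L. f \<tau>)" unfolding f by simp
        also have "\<dots> \<le> (e / 2)\<^sup>2" using small[OF pq(1) _ pq(3,4)] pq(2) by simp
        finally show ?thesis .
      qed
      have "(Lp_norm D 2 (\<lambda>x. u s x - u c x))\<^sup>2 \<le> (e / 2)\<^sup>2"
      proof (cases "s = c")
        case True
        then show ?thesis by (simp add: Lp_norm_2 l2_def)
      next
        case False
        then consider "s < c" | "c < s" by linarith
        then show ?thesis
        proof cases
          case 1
          show ?thesis using down[OF s(2) c(2) 1] key[of s c] 1 s c by simp
        next
          case 2
          show ?thesis using up[OF c(2) s(2) 2] key[of c s] 2 s c by simp
        qed
      qed
      then show ?thesis by (rule power2_le_imp_le) (use e in simp)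
    qed
    have cL: "u c \<in> Lp_on D 2" by (rule V_space_Lp[OF cV])
    have lim: "Lp_norm D 2 (\<lambda>x. u s x - u c x) \<le> e / 2" if "s \<in> {p..q}" for s
    proof (rule weak_bound_imp_norm_bound[OF _ _ pq(2) cL _ _ that])
      show "u t \<in> Lp_on D 2" if "t \<in> {p..q}" for t using that pq by (intro evolution_L2[OF ev]) auto
      show "continuous_on {p..q} (\<lambda>t. L2_inner D (u t) g)" if "g \<in> Lp_on D 2" for g
        using continuous_on_subset[OF evolution_weakly_continuous[OF ev that], of "{p..q}"] pq by auto
      show "AE t in ?L. Lp_norm D 2 (\<lambda>x. u t x - u c x) \<le> e / 2"
        using Wpq AE_space[of ?L] by eventually_elim (use near in auto)
    qed (use e in simp)
    have tL: "u t \<in> Lp_on D 2" "u t' \<in> Lp_on D 2" using t pq by (auto intro!: evolution_L2[OF ev])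
    have "Lp_norm D 2 (\<lambda>x. u t' x - u t x) = Lp_norm D 2 (\<lambda>x. (u t' x - u c x) - (u t x - u c x))" by simp
    also have "\<dots> \<le> Lp_norm D 2 (\<lambda>x. u t' x - u c x) + Lp_norm D 2 (\<lambda>x. u t x - u c x)"
      unfolding Lp_norm_2 using L2_diff[OF tL(1) cL] L2_diff[OF tL(2) cL]
      by (intro l2_diff_triangle) (simp_all add: Lp_on_2_iff)
    also have "\<dots> \<le> e" using lim[OF t(1)] lim[OF t(2)] by simp
    finally show ?thesis .
  qed
  show ?thesis
  proof (intro exI[of _ "d / 2"] conjI ballI impI)
    show "d / 2 > 0" using d by simp
    fix t t' assume t: "t \<in> {0..T}" "t' \<in> {0..T}" "\<bar>t' - t\<bar> < d / 2"
    (* the interval must have both points in its closure, positive length, and length below d *)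
    define p where "p = max 0 (min t t' - d / 8)"
    define q where "q = min T (max t t' + d / 8)"
    show "Lp_norm D 2 (\<lambda>x. u t' x - u t x) \<le> e"
      by (rule osc[of p q]) (use t d T in \<open>auto simp: p_def q_def min_def max_def abs_if split: if_splits\<close>)
  qed
qed

lemma H12_norm_three_step:
  assumes "open D" "f \<in> H12 D" "g \<in> H12 D" "h \<in> H12 D" "k \<in> H12 D"
  shows "(H12_norm D (\<lambda>x. f x - k x))\<^sup>2 \<le> 3 * ((H12_norm D (\<lambda>x. f x - g x))\<^sup>2
     + (H12_norm D (\<lambda>x. g x - h x))\<^sup>2 + (H12_norm D (\<lambda>x. k x - h x))\<^sup>2)"
proof -
  have sq: "(a + b + c)\<^sup>2 \<le> 3 * (a\<^sup>2 + b\<^sup>2 + c\<^sup>2)" for a b c :: real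
    using zero_le_power2[of "a - b"] zero_le_power2[of "b - c"] zero_le_power2[of "a - c"]
    by (simp add: power2_eq_square algebra_simps)
  have "H12_norm D (\<lambda>x. f x - k x) \<le> H12_norm D (\<lambda>x. f x - g x) + H12_norm D (\<lambda>x. g x - h x) + H12_norm D (\<lambda>x. k x - h x)"
    using H12_norm_triangle_diff[OF assms(1,2,3,5)] H12_norm_triangle_diff[OF assms(1,3,4,5)]
      H12_norm_minus_commute[OF assms(1,4,5)] by linarith
  then have "(H12_norm D (\<lambda>x. f x - k x))\<^sup>2 \<le> (H12_norm D (\<lambda>x. f x - g x) + H12_norm D (\<lambda>x. g x - h x) + H12_norm D (\<lambda>x. k x - h x))\<^sup>2"
    by (intro power_mono) auto
  then show ?thesis using sq order_trans by blast
qed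

text \<open>
  Each increment of the pairing is compared with the integral of \<open>r\<^sub>\<tau>(w \<tau>) +
  q\<^sub>\<tau>(u \<tau>)\<close>, which is zero.  With uniformly continuous approximations
  \<open>\<Psi>\<close> of \<open>w\<close> and \<open>\<Phi>\<close> of \<open>u\<close>, the error
  between times of small distance is controlled by the distances of the paths to their
  approximations at \<open>\<tau>\<close> and at the end points.  The partition estimate turns this
  into integrals.
\<close>

lemma evolution_pairing_AE_constant:
  assumes D: "open D" and T: "T > 0" and eu: "evolution D T M u r m" and ew: "evolution D T M w q m'"
    and cancel: "AE \<tau> in lebesgue_on {0<..<T}. r \<tau> (w \<tau>) + q \<tau> (u \<tau>) = 0"
  shows "\<exists>W. (AE t in lebesgue_on {0<..<T}. t \<in> W) \<and> (\<forall>a\<in>W. \<forall>b\<in>W. L2_inner D (u a) (w a) = L2_inner D (u b) (w b))"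
proof -
  define h where "h t = L2_inner D (u t) (w t)" for t
  define W where "W = {t \<in> {0<..<T}. u t \<in> V_space D \<and> Lp_norm D 2 (u t) \<le> M \<and> w t \<in> V_space D \<and> Lp_norm D 2 (w t) \<le> M}"
  have W: "AE t in lebesgue_on {0<..<T}. t \<in> W"
    using evolution_AE[OF eu] evolution_AE[OF ew] AE_space[of "lebesgue_on {0<..<T}"]
    by eventually_elim (simp add: W_def)
  have WD: "u t \<in> V_space D" "Lp_norm D 2 (u t) \<le> M" "w t \<in> V_space D" "Lp_norm D 2 (w t) \<le> M" "0 < t" "t < T"
    if "t \<in> W" for t using that by (auto simp: W_def)
  let ?I = "lebesgue_on {0<..<T}"
  define m2 where "m2 \<tau> = m \<tau> + m' \<tau>" for \<tau>
  have m2: "integrable ?I m2" "m2 \<tau> \<ge> 0" for \<tau>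
    unfolding m2_def[abs_def] using evolution_m[OF eu] evolution_m[OF ew] by auto
  have approx: "\<bar>h b - h a\<bar> \<le> 3 * \<kappa>" if a: "a \<in> W" and b: "b \<in> W" and ab: "a < b" and \<kappa>: "\<kappa> > 0" for a b \<kappa>
  proof -
    let ?J = "lebesgue_on {a<..<b}"
    have sub: "{a<..<b} \<subseteq> {0<..<T}" using WD[OF a] WD[OF b] by auto
    define Im where "Im = (LINT \<tau>|?J. m2 \<tau>)"
    have Im: "Im \<ge> 0" unfolding Im_def using m2(2) by simp
    (* The parameters are chosen in the order e, C, delta, epsilon: C depends on e, and delta
       and epsilon, the mean and the uniform distance to the approximations, have to be small
       compared with 1/C. *)
    define e where "e = \<kappa> / (Im + 1)"
    have e: "e > 0" "e * Im \<le> \<kappa>" using Im \<kappa> by (auto simp: e_def field_simps)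
    obtain C1 where C1: "C1 \<ge> 0" and mod1: "AE \<tau> in ?I. rate_bound D M e C1 (r \<tau>) (m \<tau>)"
      using evolution_modulus[OF eu e(1)] by blast
    obtain C2 where C2: "C2 \<ge> 0" and mod2: "AE \<tau> in ?I. rate_bound D M e C2 (q \<tau>) (m' \<tau>)"
      using evolution_modulus[OF ew e(1)] by blast
    define C where "C = max C1 C2"
    have C: "C \<ge> 0" "C1 \<le> C" "C2 \<le> C" using C1 by (auto simp: C_def)
    define \<delta> where "\<delta> = \<kappa> / (36 * (C + 1))"
    have \<delta>: "\<delta> > 0" "36 * C * \<delta> \<le> \<kappa>" using C \<kappa> by (auto simp: \<delta>_def field_simps)
    obtain \<Psi> where \<Psi>: "\<And>t. \<Psi> t \<in> H12_0 D"
      and \<Psi>c: "\<forall>e>0. \<exists>d>0. \<forall>s\<in>{0<..<T}. \<forall>t\<in>{0<..<T}. \<bar>s - t\<bar> < d \<longrightarrow> H12_norm D (\<lambda>x. \<Psi> s x - \<Psi> t x) < e"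
      and \<Psi>i: "integrable ?I (\<lambda>t. (H12_norm D (\<lambda>x. w t x - \<Psi> t x))\<^sup>2)"
      and \<Psi>\<delta>: "(LINT t|?I. (H12_norm D (\<lambda>x. w t x - \<Psi> t x))\<^sup>2) < \<delta>"
      using evolution_approximable[OF ew] \<delta>(1) unfolding approximable_def by blast
    obtain \<Phi> where \<Phi>: "\<And>t. \<Phi> t \<in> H12_0 D"
      and \<Phi>c: "\<forall>e>0. \<exists>d>0. \<forall>s\<in>{0<..<T}. \<forall>t\<in>{0<..<T}. \<bar>s - t\<bar> < d \<longrightarrow> H12_norm D (\<lambda>x. \<Phi> s x - \<Phi> t x) < e"
      and \<Phi>i: "integrable ?I (\<lambda>t. (H12_norm D (\<lambda>x. u t x - \<Phi> t x))\<^sup>2)"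
      and \<Phi>\<delta>: "(LINT t|?I. (H12_norm D (\<lambda>x. u t x - \<Phi> t x))\<^sup>2) < \<delta>"
      using evolution_approximable[OF eu] \<delta>(1) unfolding approximable_def by blast
    define \<epsilon> where "\<epsilon> = sqrt (\<kappa> / (6 * (C + 1) * T))"
    have \<epsilon>: "\<epsilon> > 0" using C \<kappa> T by (auto simp: \<epsilon>_def)
    have \<epsilon>2: "6 * C * \<epsilon>\<^sup>2 * (b - a) \<le> \<kappa>"
    proof -
      have "\<epsilon>\<^sup>2 = \<kappa> / (6 * (C + 1) * T)" using C \<kappa> T by (simp add: \<epsilon>_def)
      then have "6 * (C + 1) * T * \<epsilon>\<^sup>2 = \<kappa>" using C T by simp
      moreover have "6 * C * \<epsilon>\<^sup>2 * (b - a) \<le> 6 * (C + 1) * \<epsilon>\<^sup>2 * T"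
        using C WD[OF a] WD[OF b] ab by (intro mult_mono) auto
      ultimately show ?thesis by (simp add: algebra_simps)
    qed
    obtain d1 where d1: "d1 > 0" "\<forall>s\<in>{0<..<T}. \<forall>t\<in>{0<..<T}. \<bar>s - t\<bar> < d1 \<longrightarrow> H12_norm D (\<lambda>x. \<Psi> s x - \<Psi> t x) < \<epsilon>"
      using \<Psi>c \<epsilon> by blast
    obtain d2 where d2: "d2 > 0" "\<forall>s\<in>{0<..<T}. \<forall>t\<in>{0<..<T}. \<bar>s - t\<bar> < d2 \<longrightarrow> H12_norm D (\<lambda>x. \<Phi> s x - \<Phi> t x) < \<epsilon>"
      using \<Phi>c \<epsilon> by blast
    define g where "g t = (H12_norm D (\<lambda>x. w t x - \<Psi> t x))\<^sup>2 + (H12_norm D (\<lambda>x. u t x - \<Phi> t x))\<^sup>2" for t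
    have g0: "g t \<ge> 0" for t by (simp add: g_def)
    have gI: "integrable ?I g" unfolding g_def using \<Psi>i \<Phi>i by simp
    have gle: "(H12_norm D (\<lambda>x. w t x - \<Psi> t x))\<^sup>2 \<le> g t" "(H12_norm D (\<lambda>x. u t x - \<Phi> t x))\<^sup>2 \<le> g t" for t
      by (auto simp: g_def)
    have gi: "integrable ?J g" by (rule integrable_lebesgue_on_subset[OF gI sub]) auto
    have mi: "integrable ?J m2" by (rule integrable_lebesgue_on_subset[OF m2(1) sub]) auto
    define mm where "mm \<tau> = e * m2 \<tau> + 6 * C * g \<tau> + 6 * C * \<epsilon>\<^sup>2" for \<tau>
    have mmi: "integrable (lebesgue_on {s<..<t}) mm" if "{s<..<t} \<subseteq> {0<..<T}" for s t
      unfolding mm_def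
      using integrable_lebesgue_on_subset[OF gI that] integrable_lebesgue_on_subset[OF m2(1) that] integrable_const_interval[of s t]
      by auto
    have gJ: "(LINT \<tau>|?J. g \<tau>) \<le> 2 * \<delta>"
    proof -
      have "(LINT \<tau>|?J. g \<tau>) \<le> (LINT \<tau>|?I. g \<tau>)"
      proof -
        have n: "(LINT \<tau>|lebesgue_on S. g \<tau>) \<ge> 0" for S using g0 by simp
        have "(LINT \<tau>|?I. g \<tau>) = (LINT \<tau>|lebesgue_on {0<..<b}. g \<tau>) + (LINT \<tau>|lebesgue_on {b<..<T}. g \<tau>)"
          using WD[OF b] by (intro integral_interval_split[OF gI]) auto
        moreover have "(LINT \<tau>|lebesgue_on {0<..<b}. g \<tau>) = (LINT \<tau>|lebesgue_on {0<..<a}. g \<tau>) + (LINT \<tau>|?J. g \<tau>)"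
          using WD[OF a] WD[OF b] ab by (intro integral_interval_split[OF gI]) auto
        ultimately show ?thesis using n[of "{0<..<a}"] n[of "{b<..<T}"] by linarith
      qed
      also have "\<dots> \<le> 2 * \<delta>" unfolding g_def using \<Psi>i \<Phi>i \<Psi>\<delta> \<Phi>\<delta> by simp
      finally show ?thesis .
    qed
    have step: "\<bar>h t - h s\<bar> \<le> (LINT \<tau>|lebesgue_on {s<..<t}. mm \<tau>) + (3 * C) * (t - s) * (g s + g t)"
      if s: "s \<in> W" and t: "t \<in> W" and st: "s < t" and small: "t - s < min d1 d2" for s t
    proof -
      let ?L = "lebesgue_on {s<..<t}"
      have sub': "{s<..<t} \<subseteq> {0<..<T}" using WD[OF s] WD[OF t] by auto
      have ri: "integrable ?L (\<lambda>\<tau>. r \<tau> (w t))"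
        by (rule integrable_lebesgue_on_subset[OF evolution_rate_integrable[OF eu WD(3)[OF t]] sub']) auto
      have qi: "integrable ?L (\<lambda>\<tau>. q \<tau> (u s))"
        by (rule integrable_lebesgue_on_subset[OF evolution_rate_integrable[OF ew WD(1)[OF s]] sub']) auto
      have "h t - h s = (L2_inner D (u t) (w t) - L2_inner D (u s) (w t)) + (L2_inner D (w t) (u s) - L2_inner D (w s) (u s))"
        unfolding h_def using L2_inner_commute[of D "u s"] by simp
      also have "\<dots> = (LINT \<tau>|?L. r \<tau> (w t)) + (LINT \<tau>|?L. q \<tau> (u s))"
        using evolution_increment[OF eu WD(3)[OF t] WD(5)[OF s] st WD(6)[OF t]]
          evolution_increment[OF ew WD(1)[OF s] WD(5)[OF s] st WD(6)[OF t]] by simp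
      also have "\<dots> = (LINT \<tau>|?L. r \<tau> (w t) + q \<tau> (u s))" using ri qi by simp
      finally have "\<bar>h t - h s\<bar> \<le> (LINT \<tau>|?L. \<bar>r \<tau> (w t) + q \<tau> (u s)\<bar>)" using integral_abs_bound by simp
      also have "\<dots> \<le> (LINT \<tau>|?L. mm \<tau> + 3 * C * (g s + g t))"
      proof (rule integral_mono_AE)
        show "integrable ?L (\<lambda>\<tau>. \<bar>r \<tau> (w t) + q \<tau> (u s)\<bar>)" using ri qi by simp
        show "integrable ?L (\<lambda>\<tau>. mm \<tau> + 3 * C * (g s + g t))"
          using mmi[OF sub'] integrable_const_interval[of s t] by auto
        show "AE \<tau> in ?L. \<bar>r \<tau> (w t) + q \<tau> (u s)\<bar> \<le> mm \<tau> + 3 * C * (g s + g t)"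
          using AE_lebesgue_on_subset[OF W sub', simplified] AE_lebesgue_on_subset[OF cancel sub', simplified]
            AE_lebesgue_on_subset[OF mod1 sub', simplified] AE_lebesgue_on_subset[OF mod2 sub', simplified]
            AE_space[of ?L]
        proof eventually_elim
          case (elim \<tau>)
          note \<tau> = WD[OF elim(1)]
          have rng: "\<tau> \<in> {0<..<T}" "s \<in> {0<..<T}" "t \<in> {0<..<T}" "\<bar>t - \<tau>\<bar> < d1" "\<bar>s - \<tau>\<bar> < d2"
            using \<tau> WD[OF s] WD[OF t] elim(5) small by auto
          have A: "\<bar>r \<tau> (w t) - r \<tau> (w \<tau>)\<bar> \<le> e * m \<tau> + C1 * (H12_norm D (\<lambda>x. w t x - w \<tau> x))\<^sup>2"
            by (rule rate_boundD[OF elim(3) WD(3)[OF t] \<tau>(3) WD(4)[OF t] \<tau>(4)])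
          have B: "\<bar>q \<tau> (u s) - q \<tau> (u \<tau>)\<bar> \<le> e * m' \<tau> + C2 * (H12_norm D (\<lambda>x. u s x - u \<tau> x))\<^sup>2"
            by (rule rate_boundD[OF elim(4) WD(1)[OF s] \<tau>(1) WD(2)[OF s] \<tau>(2)])
          have A': "(H12_norm D (\<lambda>x. w t x - w \<tau> x))\<^sup>2 \<le> 3 * (g t + \<epsilon>\<^sup>2 + g \<tau>)"
          proof -
            have "(H12_norm D (\<lambda>x. w t x - w \<tau> x))\<^sup>2 \<le> 3 * ((H12_norm D (\<lambda>x. w t x - \<Psi> t x))\<^sup>2
               + (H12_norm D (\<lambda>x. \<Psi> t x - \<Psi> \<tau> x))\<^sup>2 + (H12_norm D (\<lambda>x. w \<tau> x - \<Psi> \<tau> x))\<^sup>2)"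
              by (rule H12_norm_three_step[OF D V_space_H12[OF WD(3)[OF t]] H12_0_H12[OF \<Psi>] H12_0_H12[OF \<Psi>] V_space_H12[OF \<tau>(3)]])
            moreover have "H12_norm D (\<lambda>x. \<Psi> t x - \<Psi> \<tau> x) < \<epsilon>" using d1(2) rng by blast
            then have "(H12_norm D (\<lambda>x. \<Psi> t x - \<Psi> \<tau> x))\<^sup>2 \<le> \<epsilon>\<^sup>2" by (intro power_mono) auto
            ultimately show ?thesis using gle(1)[of t] gle(1)[of \<tau>] by simp
          qed
          have B': "(H12_norm D (\<lambda>x. u s x - u \<tau> x))\<^sup>2 \<le> 3 * (g s + \<epsilon>\<^sup>2 + g \<tau>)"
          proof -
            have "(H12_norm D (\<lambda>x. u s x - u \<tau> x))\<^sup>2 \<le> 3 * ((H12_norm D (\<lambda>x. u s x - \<Phi> s x))\<^sup>2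
               + (H12_norm D (\<lambda>x. \<Phi> s x - \<Phi> \<tau> x))\<^sup>2 + (H12_norm D (\<lambda>x. u \<tau> x - \<Phi> \<tau> x))\<^sup>2)"
              by (rule H12_norm_three_step[OF D V_space_H12[OF WD(1)[OF s]] H12_0_H12[OF \<Phi>] H12_0_H12[OF \<Phi>] V_space_H12[OF \<tau>(1)]])
            moreover have "H12_norm D (\<lambda>x. \<Phi> s x - \<Phi> \<tau> x) < \<epsilon>" using d2(2) rng by blast
            then have "(H12_norm D (\<lambda>x. \<Phi> s x - \<Phi> \<tau> x))\<^sup>2 \<le> \<epsilon>\<^sup>2" by (intro power_mono) auto
            ultimately show ?thesis using gle(2)[of s] gle(2)[of \<tau>] by simp
          qed
          have A2: "C1 * (H12_norm D (\<lambda>x. w t x - w \<tau> x))\<^sup>2 \<le> C * (3 * (g t + \<epsilon>\<^sup>2 + g \<tau>))"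
            using C C1 A' by (intro mult_mono) auto
          have B2: "C2 * (H12_norm D (\<lambda>x. u s x - u \<tau> x))\<^sup>2 \<le> C * (3 * (g s + \<epsilon>\<^sup>2 + g \<tau>))"
            using C C2 B' by (intro mult_mono) auto
          have "\<bar>r \<tau> (w t) + q \<tau> (u s)\<bar> \<le> (e * m \<tau> + C * (3 * (g t + \<epsilon>\<^sup>2 + g \<tau>))) + (e * m' \<tau> + C * (3 * (g s + \<epsilon>\<^sup>2 + g \<tau>)))"
            using A B A2 B2 elim(2) by linarith
          also have "\<dots> = mm \<tau> + 3 * C * (g s + g t)" by (simp add: mm_def m2_def algebra_simps)
          finally show ?case .
        qed
      qed
      also have "\<dots> = (LINT \<tau>|?L. mm \<tau>) + (t - s) * (3 * C * (g s + g t))"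
        using mmi[OF sub'] integrable_const_interval[of s t] integral_const_interval[of s t "3 * C * (g s + g t)"] st by simp
      finally show ?thesis by (simp add: algebra_simps)
    qed
    have "\<bar>h b - h a\<bar> \<le> (LINT \<tau>|?J. mm \<tau>) + 4 * (3 * C) * (LINT \<tau>|?J. g \<tau>)"
    proof (rule partition_estimate[OF ab _ a b gi g0 mmi[OF sub]])
      show "AE t in ?J. t \<in> W" by (rule AE_lebesgue_on_subset[OF W sub]) auto
      show "min d1 d2 > 0" using d1 d2 by simp
    qed (use C step in auto)
    also have "(LINT \<tau>|?J. mm \<tau>) = e * Im + 6 * C * (LINT \<tau>|?J. g \<tau>) + (b - a) * (6 * C * \<epsilon>\<^sup>2)"
      unfolding mm_def Im_def using mi gi integrable_const_interval[of a b] integral_const_interval[of a b "6 * C * \<epsilon>\<^sup>2"] ab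
      by simp
    also have "e * Im + 6 * C * (LINT \<tau>|?J. g \<tau>) + (b - a) * (6 * C * \<epsilon>\<^sup>2) + 4 * (3 * C) * (LINT \<tau>|?J. g \<tau>)
        = e * Im + 18 * C * (LINT \<tau>|?J. g \<tau>) + 6 * C * \<epsilon>\<^sup>2 * (b - a)" by (simp add: algebra_simps)
    also have "\<dots> \<le> \<kappa> + 18 * C * (2 * \<delta>) + \<kappa>"
      using C gJ e(2) \<epsilon>2 by (intro add_mono mult_left_mono) auto
    also have "\<dots> \<le> 3 * \<kappa>" using \<delta>(2) by simp
    finally show ?thesis .
  qed
  have eq: "h a = h b" if "a \<in> W" "b \<in> W" "a < b" for a b
  proof (rule ccontr)
    assume "h a \<noteq> h b"
    then have "\<bar>h b - h a\<bar> > 0" by simp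
    then show False using approx[OF that, of "\<bar>h b - h a\<bar> / 6"] by simp
  qed
  show ?thesis
  proof (intro exI[of _ W] conjI ballI W)
    show "L2_inner D (u a) (w a) = L2_inner D (u b) (w b)" if "a \<in> W" "b \<in> W" for a b
      using eq[OF that] eq[OF that(2,1)] by (cases a b rule: linorder_cases) (auto simp: h_def)
  qed
qed

lemma evolution_norm_bound:
  assumes T: "T > 0" and ev: "evolution D T M u r m" and t: "t \<in> {0..T}"
  shows "Lp_norm D 2 (u t) \<le> \<bar>M\<bar>"
proof -
  have z: "(\<lambda>_. 0) \<in> Lp_on D 2" by (simp add: Lp_on_2_iff sq_integrable_def)
  have ae: "AE t in lebesgue_on {0<..<T}. Lp_norm D 2 (\<lambda>x. u t x - (\<lambda>_. 0) x) \<le> \<bar>M\<bar>"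
    using evolution_AE[OF ev] by eventually_elim (simp, linarith)
  have "Lp_norm D 2 (\<lambda>x. u t x - (\<lambda>_. 0) x) \<le> \<bar>M\<bar>"
    by (rule weak_bound_imp_norm_bound[OF evolution_L2[OF ev] evolution_weakly_continuous[OF ev] T z _ ae t]) auto
  then show ?thesis by simp
qed

text \<open>
  The pairing of a strongly continuous path with a bounded weakly continuous one is continuous.
\<close>

lemma evolution_pairing_constant:
  assumes D: "open D" and T: "T > 0" and eu: "evolution D T M u r m" and ew: "evolution D T M w q m'"
    and cancel: "AE \<tau> in lebesgue_on {0<..<T}. r \<tau> (w \<tau>) + q \<tau> (u \<tau>) = 0"
    and t: "t \<in> {0..T}"
  shows "L2_inner D (u t) (w t) = L2_inner D (u 0) (w 0)"
proof -
  define h where "h t = L2_inner D (u t) (w t)" for t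
  note uL = evolution_L2[OF eu] and wL = evolution_L2[OF ew]
  have c: "continuous_on {0..T} h"
    unfolding continuous_on_iff
  proof (intro ballI allI impI)
    fix t e :: real assume t: "t \<in> {0..T}" and e: "e > 0"
    (* the summand 1 excludes a division by zero *)
    define e' where "e' = e / (2 * (\<bar>M\<bar> + 1))"
    have e': "e' > 0" "e' * \<bar>M\<bar> < e / 2" using e by (auto simp: e'_def field_simps)
    obtain d1 where d1: "d1 > 0" "\<And>s. s \<in> {0..T} \<Longrightarrow> \<bar>s - t\<bar> < d1 \<Longrightarrow> Lp_norm D 2 (\<lambda>x. u s x - u t x) \<le> e'"
      using evolution_strongly_continuous[OF D T eu e'(1)] t by blast
    have e2: "e / 2 > 0" using e by simp
    obtain d2 where d2: "d2 > 0" "\<And>s. s \<in> {0..T} \<Longrightarrow> dist s t < d2 \<Longrightarrow> dist (L2_inner D (w s) (u t)) (L2_inner D (w t) (u t)) < e / 2"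
      using evolution_weakly_continuous[OF ew uL[OF t], unfolded continuous_on_iff, rule_format, OF t e2] by blast
    have "dist (h s) (h t) < e" if s: "s \<in> {0..T}" "dist s t < min d1 d2" for s
    proof -
      have "h s - h t = L2_inner D (\<lambda>x. u s x - u t x) (w s) + (L2_inner D (w s) (u t) - L2_inner D (w t) (u t))"
        unfolding h_def L2_inner_diff_left[OF uL[OF s(1)] uL[OF t] wL[OF s(1)]]
        using L2_inner_commute[of D "u t"] by simp
      moreover have "\<bar>L2_inner D (\<lambda>x. u s x - u t x) (w s)\<bar> \<le> e' * \<bar>M\<bar>"
      proof -
        have "\<bar>L2_inner D (\<lambda>x. u s x - u t x) (w s)\<bar> \<le> Lp_norm D 2 (\<lambda>x. u s x - u t x) * Lp_norm D 2 (w s)"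
          by (intro L2_inner_bound L2_diff uL wL s t)
        also have "\<dots> \<le> e' * \<bar>M\<bar>"
          using d1(2)[OF s(1)] s(2) e'(1) evolution_norm_bound[OF T ew s(1)]
          by (intro mult_mono) (auto simp: dist_real_def)
        finally show ?thesis .
      qed
      moreover have "\<bar>L2_inner D (w s) (u t) - L2_inner D (w t) (u t)\<bar> < e / 2"
        using d2(2)[OF s(1)] s(2) by (simp add: dist_real_def)
      ultimately show ?thesis using e'(2) unfolding dist_real_def by linarith
    qed
    then show "\<exists>d>0. \<forall>s\<in>{0..T}. dist s t < d \<longrightarrow> dist (h s) (h t) < e"
      using d1(1) d2(1) by (intro exI[of _ "min d1 d2"]) auto
  qed
  obtain W :: "real set" where W: "AE t in lebesgue_on {0<..<T}. t \<in> W"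
    and eq: "\<forall>a\<in>W. \<forall>b\<in>W. L2_inner D (u a) (w a) = L2_inner D (u b) (w b)"
    using evolution_pairing_AE_constant[OF D T eu ew cancel] by blast
  obtain a where a: "a \<in> W" using AE_interval_nonempty[OF T W] by blast
  have eqa: "h s = h a" if "s \<in> W" for s using eq a that unfolding h_def by blast
  have const: "h s = h a" if s: "s \<in> {0..T}" for s
  proof (rule antisym)
    have ae: "AE s in lebesgue_on {0<..<T}. h s = h a"
      using W by eventually_elim (rule eqa)
    show "h s \<le> h a"
      by (rule continuous_AE_bound[OF c T _ s]) (use ae in eventually_elim, simp)
    have "- h s \<le> - h a"
      by (rule continuous_AE_bound[OF continuous_on_minus[OF c] T _ s]) (use ae in eventually_elim, simp)
    then show "h a \<le> h s" by simp
  qed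
  show ?thesis using const[OF t] const[of 0] T by (simp add: h_def)
qed

section \<open>Approximation and measurability in time\<close>

lemma lebesgue_on_measurable_AE_limit:
  fixes g :: "real \<Rightarrow> real"
  assumes S: "S \<in> sets lebesgue" and f: "\<And>n. f n \<in> borel_measurable (lebesgue_on S)"
    and l: "AE x in lebesgue_on S. (\<lambda>n. f n x) \<longlonglongrightarrow> g x"
  shows "g \<in> borel_measurable (lebesgue_on S)"
proof (rule measurable_lebesgue_on_AE_cong[OF S])
  show "(\<lambda>x. lim (\<lambda>n. f n x)) \<in> borel_measurable (lebesgue_on S)"
    by (rule borel_measurable_lim_metric) (rule f)
  show "AE x in lebesgue_on S. lim (\<lambda>n. f n x) = g x"
    using l by eventually_elim (rule limI)
qed

lemma zero_H12_0:
  assumes D: "open D"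
  shows "(\<lambda>_. 0) \<in> H12_0 D" "H12_norm D (\<lambda>_. 0) = 0"
proof -
  have z: "(\<lambda>_. 0) \<in> test_functions D" by (rule test_functionI[of _ "{}"]) auto
  note zH = test_function_H12(1)[OF D z]
  have "H12_norm D (\<lambda>_. 0) \<le> 0" using H12_norm_lincomb[OF D zH zH, of 0 0] by simp
  then show n: "H12_norm D (\<lambda>_. 0) = 0" by (rule order_antisym) simp
  show "(\<lambda>_. 0) \<in> H12_0 D"
    unfolding H12_0_def using zH z n by (intro CollectI conjI exI[of _ "\<lambda>_ _. 0"]) auto
qed

lemma H12_norm_diff_lipschitz:
  assumes "open D" "f \<in> H12 D" "g \<in> H12 D" "h \<in> H12 D"
  shows "\<bar>H12_norm D (\<lambda>x. f x - h x) - H12_norm D (\<lambda>x. g x - h x)\<bar> \<le> H12_norm D (\<lambda>x. f x - g x)"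
  using H12_norm_triangle_diff[OF assms(1,2,3,4)] H12_norm_triangle_diff[OF assms(1,3,2,4)]
    H12_norm_minus_commute[OF assms(1-3)] by linarith

text \<open>
  A measurable function is an almost everywhere limit of continuous ones; these are truncated to
  \<open>[0, 1]\<close> and converge in \<open>L\<^sup>2\<close> by dominated convergence.
\<close>

lemma indicator_continuous_approximation:
  fixes A :: "real set"
  assumes A: "A \<in> sets lebesgue" and e: "e > 0"
  shows "\<exists>c. continuous_on UNIV c \<and> (\<forall>t. 0 \<le> c t \<and> c t \<le> (1::real)) \<and>
    (LINT t|lebesgue_on {0<..<T}. (indicator A t - c t)\<^sup>2) < e"
proof -
  let ?I = "lebesgue_on {0<..<T::real}"
  have "(indicator A :: real \<Rightarrow> real) \<in> borel_measurable lebesgue" using A by simp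
  then have "(indicator A :: real \<Rightarrow> real) measurable_on UNIV" by (rule lebesgue_measurable_imp_measurable_on) simp
  then obtain N and g :: "nat \<Rightarrow> real \<Rightarrow> real" where N: "negligible N" and g: "\<And>n. continuous_on UNIV (g n)"
    and lim: "\<And>x. x \<notin> N \<Longrightarrow> (\<lambda>n. g n x) \<longlonglongrightarrow> indicator A x"
    unfolding measurable_on_def by auto
  define c where "c n t = max 0 (min 1 (g n t))" for n t
  have cc: "continuous_on UNIV (c n)" for n unfolding c_def by (intro continuous_intros g)
  have c01: "0 \<le> c n t \<and> c n t \<le> 1" for n t by (auto simp: c_def)
  have cm: "c n \<in> borel_measurable ?I" for n
    by (intro borel_measurable_imp_lebesgue_on borel_measurable_continuous_onI cc)
  have Am: "indicat_real A \<in> borel_measurable ?I" using A by (intro measurable_restrict_space1) simp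
  have "(\<lambda>n. LINT t|?I. (indicator A t - c n t)\<^sup>2) \<longlonglongrightarrow> (LINT t|?I. 0)"
  proof (rule integral_dominated_convergence[where w="\<lambda>_. 1"])
    show "integrable ?I (\<lambda>_. 1::real)" by (rule integrable_const_interval)
    show "(\<lambda>t. (indicator A t - c n t)\<^sup>2) \<in> borel_measurable ?I" for n using Am cm by auto
    show "AE t in ?I. (\<lambda>n. (indicator A t - c n t)\<^sup>2) \<longlonglongrightarrow> 0"
    proof -
      have "AE t in lebesgue. t \<notin> N" using N by (intro AE_not_in) (simp add: negligible_iff_null_sets)
      then have "AE t in ?I. t \<notin> N" by (auto simp: AE_restrict_space_iff elim!: eventually_mono)
      then show ?thesis
      proof eventually_elim
        case (elim t)
        have "(\<lambda>n. c n t) \<longlonglongrightarrow> max 0 (min 1 (indicator A t))"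
          unfolding c_def by (intro tendsto_intros lim elim)
        then have "(\<lambda>n. c n t) \<longlonglongrightarrow> indicator A t" by (simp add: indicator_def split: if_splits)
        then have "(\<lambda>n. (indicator A t - c n t)\<^sup>2) \<longlonglongrightarrow> (indicator A t - indicator A t)\<^sup>2" by (intro tendsto_intros)
        then show ?case by simp
      qed
    qed
    show "AE t in ?I. norm ((indicator A t - c n t)\<^sup>2) \<le> 1" for n
    proof (rule AE_I2)
      fix t
      have "\<bar>indicator A t - c n t\<bar> \<le> 1" using c01[of n t] by (auto simp: indicator_def)
      then show "norm ((indicator A t - c n t)\<^sup>2) \<le> 1" by (simp add: abs_square_le_1)
    qed
  qed auto
  then have "(\<lambda>n. LINT t|?I. (indicator A t - c n t)\<^sup>2) \<longlonglongrightarrow> 0" by simp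
  then have "\<forall>\<^sub>F n in sequentially. (LINT t|?I. (indicator A t - c n t)\<^sup>2) < e"
    using e by (simp add: order_tendsto_iff)
  then obtain n where "(LINT t|?I. (indicator A t - c n t)\<^sup>2) < e" by (auto simp: eventually_sequentially)
  then show ?thesis using cc c01 by blast
qed

lemma Bochner_Lp_2_norm_measurable:
  assumes "u \<in> Bochner_Lp 2 I X N" "\<And>f. N f \<ge> 0"
  shows "(\<lambda>t. N (u t)) \<in> borel_measurable (lebesgue_on I)" "integrable (lebesgue_on I) (\<lambda>t. (N (u t))\<^sup>2)"
proof -
  show i: "integrable (lebesgue_on I) (\<lambda>t. (N (u t))\<^sup>2)" using assms by (simp add: Bochner_Lp_def)
  then have "(\<lambda>t. sqrt ((N (u t))\<^sup>2)) \<in> borel_measurable (lebesgue_on I)" by measurable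
  then show "(\<lambda>t. N (u t)) \<in> borel_measurable (lebesgue_on I)" using assms(2) by simp
qed

text \<open>
  With \<open>u\<close> replaced by a simple function the distance is a finite sum of measurable
  pieces, one for each of its values.
\<close>

lemma strongly_measurable_distance:
  fixes T :: real
  assumes D: "open D" and u: "strongly_measurable_on {0<..<T} (V_space D) (H12_norm D) u"
    and \<Psi>: "\<And>t. \<Psi> t \<in> H12_0 D" and m: "\<And>\<phi>. \<phi> \<in> V_space D \<Longrightarrow> (\<lambda>t. H12_norm D (\<lambda>x. \<phi> x - \<Psi> t x)) \<in> borel_measurable (lebesgue_on {0<..<T})"
  shows "(\<lambda>t. H12_norm D (\<lambda>x. u t x - \<Psi> t x)) \<in> borel_measurable (lebesgue_on {0<..<T})"
proof -
  let ?I = "lebesgue_on {0<..<T}"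
  obtain s where s: "\<And>n. simple_function ?I (s n)" "\<And>n. s n ` {0<..<T} \<subseteq> V_space D"
    and lim: "AE t in ?I. (\<lambda>n. H12_norm D (\<lambda>x. s n t x - u t x)) \<longlonglongrightarrow> 0"
    and uV: "AE t in ?I. u t \<in> V_space D"
    using u by (auto simp: strongly_measurable_on_def)
  show ?thesis
  proof (rule lebesgue_on_measurable_AE_limit[where f="\<lambda>n t. H12_norm D (\<lambda>x. s n t x - \<Psi> t x)"])
    show "(\<lambda>t. H12_norm D (\<lambda>x. s n t x - \<Psi> t x)) \<in> borel_measurable ?I" for n
    proof -
      let ?R = "s n ` {0<..<T}"
      have fin: "finite ?R" using simple_functionD(1)[OF s(1)[of n]] by simp
      have "(\<lambda>t. \<Sum>\<phi>\<in>?R. indicator (s n -` {\<phi>} \<inter> space ?I) t * H12_norm D (\<lambda>x. \<phi> x - \<Psi> t x)) \<in> borel_measurable ?I"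
      proof (intro borel_measurable_sum borel_measurable_times borel_measurable_indicator)
        fix \<phi> assume "\<phi> \<in> ?R"
        then show "(\<lambda>t. H12_norm D (\<lambda>x. \<phi> x - \<Psi> t x)) \<in> borel_measurable ?I" using s(2)[of n] by (intro m) auto
        show "s n -` {\<phi>} \<inter> space ?I \<in> sets ?I" by (rule simple_functionD(2)[OF s(1)])
      qed
      moreover have "(\<Sum>\<phi>\<in>?R. indicator (s n -` {\<phi>} \<inter> space ?I) t * H12_norm D (\<lambda>x. \<phi> x - \<Psi> t x))
          = H12_norm D (\<lambda>x. s n t x - \<Psi> t x)" if t: "t \<in> space ?I" for t
      proof -
        have "(\<Sum>\<phi>\<in>?R. indicator (s n -` {\<phi>} \<inter> space ?I) t * H12_norm D (\<lambda>x. \<phi> x - \<Psi> t x))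
           = (\<Sum>\<phi>\<in>?R. if \<phi> = s n t then H12_norm D (\<lambda>x. s n t x - \<Psi> t x) else 0)"
          using t by (intro sum.cong) (auto simp: indicator_def)
        then show ?thesis using fin t by simp
      qed
      ultimately show ?thesis by (rule measurable_cong[THEN iffD1, rotated])
    qed
    show "AE t in ?I. (\<lambda>n. H12_norm D (\<lambda>x. s n t x - \<Psi> t x)) \<longlonglongrightarrow> H12_norm D (\<lambda>x. u t x - \<Psi> t x)"
      using lim uV AE_space[of ?I]
    proof eventually_elim
      case (elim t)
      have "s n t \<in> H12 D" for n using elim(3) s(2)[of n] by (intro V_space_H12) auto
      then have le: "norm (H12_norm D (\<lambda>x. s n t x - \<Psi> t x) - H12_norm D (\<lambda>x. u t x - \<Psi> t x)) \<le> H12_norm D (\<lambda>x. s n t x - u t x)" for n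
        unfolding real_norm_def by (intro H12_norm_diff_lipschitz D V_space_H12[OF elim(2)] H12_0_H12[OF \<Psi>])
      show ?case
        by (rule LIM_zero_cancel, rule Lim_null_comparison[OF always_eventually elim(1)]) (rule allI, rule le)
    qed
  qed simp
qed

text \<open>
  The simple functions of strong measurability converge only pointwise.  Setting them to zero where
  their norm exceeds \<open>1 + 2 \<parallel>u\<parallel>\<^sub>V\<close> keeps the convergence and
  provides a square integrable majorant.
\<close>

lemma Bochner_simple_approximation:
  fixes T :: real
  assumes D: "open D" and u: "u \<in> Bochner_Lp 2 {0<..<T} (V_space D) (H12_norm D)" and \<delta>: "\<delta> > 0"
  shows "\<exists>\<sigma>. simple_function (lebesgue_on {0<..<T}) \<sigma> \<and> \<sigma> ` {0<..<T} \<subseteq> H12_0 D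
     \<and> integrable (lebesgue_on {0<..<T}) (\<lambda>t. (H12_norm D (\<lambda>x. u t x - \<sigma> t x))\<^sup>2)
     \<and> (LINT t|lebesgue_on {0<..<T}. (H12_norm D (\<lambda>x. u t x - \<sigma> t x))\<^sup>2) < \<delta>"
proof -
  let ?I = "lebesgue_on {0<..<T}"
  let ?N = "H12_norm D"
  have sm: "strongly_measurable_on {0<..<T} (V_space D) ?N u" using u by (simp add: Bochner_Lp_def)
  obtain s where s: "\<And>n. simple_function ?I (s n)" "\<And>n. s n ` {0<..<T} \<subseteq> V_space D"
    and lim: "AE t in ?I. (\<lambda>n. ?N (\<lambda>x. s n t x - u t x)) \<longlonglongrightarrow> 0"
    and uV: "AE t in ?I. u t \<in> V_space D"
    using sm by (auto simp: strongly_measurable_on_def)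
  note um = Bochner_Lp_2_norm_measurable[OF u H12_norm_nonneg]
  (* the set on which the n-th simple function is kept *)
  define A where "A n = {t \<in> space ?I. ?N (s n t) \<le> 1 + 2 * ?N (u t)}" for n
  have A: "A n \<in> sets ?I" for n
  proof -
    have [measurable]: "(\<lambda>t. ?N (s n t)) \<in> borel_measurable ?I"
      using simple_function_compose1[OF s(1)[of n], of ?N] by (rule borel_measurable_simple_function)
    note [measurable] = um(1)
    show ?thesis unfolding A_def by measurable
  qed
  define \<sigma> where "\<sigma> n t = (if t \<in> A n then s n t else (\<lambda>_. 0))" for n t
  have \<sigma>s: "simple_function ?I (\<sigma> n)" for n
    unfolding \<sigma>_def using A[of n] s(1) by (intro simple_function_If_set) (auto dest: sets.sets_into_space simp: Int_absorb2)
  have \<sigma>H: "\<sigma> n t \<in> H12_0 D" if "t \<in> {0<..<T}" for n t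
  proof -
    have "s n t \<in> V_space D" using that s(2)[of n] by blast
    then show ?thesis using zero_H12_0(1)[OF D] by (simp add: \<sigma>_def V_space_H12_0)
  qed
  (* outside of the interval the values of the simple functions are arbitrary, so they are set
     to zero *)
  define \<sigma>' where "\<sigma>' n t = (if t \<in> {0<..<T} then \<sigma> n t else (\<lambda>_. 0))" for n t
  have \<sigma>'H: "\<sigma>' n t \<in> H12_0 D" for n t using \<sigma>H zero_H12_0(1)[OF D] by (auto simp: \<sigma>'_def)
  have \<sigma>'s: "simple_function ?I (\<sigma>' n)" for n
    using \<sigma>s[of n] by (rule simple_function_cong[THEN iffD1, rotated]) (simp add: \<sigma>'_def)
  have dm: "(\<lambda>t. ?N (\<lambda>x. u t x - \<sigma>' n t x)) \<in> borel_measurable ?I" for n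
    by (rule strongly_measurable_distance[OF D sm \<sigma>'H])
      (rule borel_measurable_simple_function[OF simple_function_compose1[OF \<sigma>'s]])
  have bound: "AE t in ?I. (?N (\<lambda>x. u t x - \<sigma>' n t x))\<^sup>2 \<le> 2 + 18 * (?N (u t))\<^sup>2" for n
    using uV AE_space[of ?I]
  proof eventually_elim
    case (elim t)
    have "?N (\<sigma>' n t) \<le> 1 + 2 * ?N (u t)"
    proof (cases "t \<in> A n")
      case True
      then show ?thesis using elim by (simp add: \<sigma>'_def \<sigma>_def A_def)
    next
      case False
      show ?thesis using False zero_H12_0(2)[OF D] by (simp add: \<sigma>'_def \<sigma>_def)
    qed
    then have "?N (\<lambda>x. u t x - \<sigma>' n t x) \<le> 1 + 3 * ?N (u t)"
      using H12_norm_diff[OF D V_space_H12[OF elim(1)] H12_0_H12[OF \<sigma>'H[of n t]]] by linarith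
    then have "(?N (\<lambda>x. u t x - \<sigma>' n t x))\<^sup>2 \<le> (1 + 3 * ?N (u t))\<^sup>2" by (intro power_mono) auto
    also have "\<dots> \<le> 2 + 18 * (?N (u t))\<^sup>2"
      using zero_le_power2[of "1 - 3 * ?N (u t)"] by (simp add: power2_eq_square algebra_simps)
    finally show ?case .
  qed
  have wi: "integrable ?I (\<lambda>t. 2 + 18 * (?N (u t))\<^sup>2)" using um(2) integrable_const_interval by auto
  have conv: "AE t in ?I. (\<lambda>n. (?N (\<lambda>x. u t x - \<sigma>' n t x))\<^sup>2) \<longlonglongrightarrow> 0"
    using uV lim AE_space[of ?I]
  proof eventually_elim
    case (elim t)
    have sH: "s n t \<in> H12 D" for n using elim(3) s(2)[of n] by (intro V_space_H12) auto
    note uH = V_space_H12[OF elim(1)]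
    have "\<forall>\<^sub>F n in sequentially. ?N (\<lambda>x. s n t x - u t x) < 1" using elim(2) by (simp add: order_tendsto_iff)
    then have "\<forall>\<^sub>F n in sequentially. ?N (\<lambda>x. u t x - \<sigma>' n t x) = ?N (\<lambda>x. s n t x - u t x)"
    proof eventually_elim
      case (elim n)
      have "?N (s n t) \<le> ?N (\<lambda>x. s n t x - u t x) + ?N (u t)"
        using H12_norm_lincomb[OF D H12_diff(1)[OF D sH[of n] uH] uH, of 1 1] by simp
      then have "?N (s n t) \<le> 1 + 2 * ?N (u t)" using elim H12_norm_nonneg[of D "u t"] by linarith
      then have "t \<in> A n" using \<open>t \<in> space ?I\<close> by (simp add: A_def)
      then have "\<sigma>' n t = s n t" using \<open>t \<in> space ?I\<close> by (simp add: \<sigma>'_def \<sigma>_def)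
      then show ?case using H12_norm_minus_commute[OF D uH sH] by simp
    qed
    then have "(\<lambda>n. ?N (\<lambda>x. u t x - \<sigma>' n t x)) \<longlonglongrightarrow> 0"
      using elim(2) by (simp add: tendsto_cong)
    then show ?case using tendsto_power[of _ 0 _ 2] by fastforce
  qed
  have "(\<lambda>n. LINT t|?I. (?N (\<lambda>x. u t x - \<sigma>' n t x))\<^sup>2) \<longlonglongrightarrow> (LINT t|?I. 0)"
    by (rule integral_dominated_convergence[OF _ _ wi conv]) (use dm bound in auto)
  then have "(\<lambda>n. LINT t|?I. (?N (\<lambda>x. u t x - \<sigma>' n t x))\<^sup>2) \<longlonglongrightarrow> 0" by simp
  then have "\<forall>\<^sub>F n in sequentially. (LINT t|?I. (?N (\<lambda>x. u t x - \<sigma>' n t x))\<^sup>2) < \<delta>"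
    using \<delta> by (simp add: order_tendsto_iff)
  then obtain n where n: "(LINT t|?I. (?N (\<lambda>x. u t x - \<sigma>' n t x))\<^sup>2) < \<delta>" by (auto simp: eventually_sequentially)
  have "integrable ?I (\<lambda>t. (?N (\<lambda>x. u t x - \<sigma>' n t x))\<^sup>2)"
    by (rule Bochner_Integration.integrable_bound[OF wi]) (use dm bound[of n] in \<open>auto elim!: eventually_mono\<close>)
  then show ?thesis using n \<sigma>'s \<sigma>'H by blast
qed

lemma H12_0_sum:
  assumes D: "open D" and \<phi>: "\<And>k. k \<in> K \<Longrightarrow> \<phi> k \<in> H12_0 D"
  shows "(\<lambda>x. \<Sum>k\<in>K. c k *\<^sub>R \<phi> k x) \<in> H12_0 D"
    and "H12_norm D (\<lambda>x. \<Sum>k\<in>K. c k *\<^sub>R \<phi> k x) \<le> (\<Sum>k\<in>K. \<bar>c k\<bar> * H12_norm D (\<phi> k))"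
proof -
  have "(\<lambda>x. \<Sum>k\<in>K. c k *\<^sub>R \<phi> k x) \<in> H12_0 D \<and>
     H12_norm D (\<lambda>x. \<Sum>k\<in>K. c k *\<^sub>R \<phi> k x) \<le> (\<Sum>k\<in>K. \<bar>c k\<bar> * H12_norm D (\<phi> k))"
    using \<phi>
  proof (induction K rule: infinite_finite_induct)
    case (insert k K)
    then have IH: "(\<lambda>x. \<Sum>k\<in>K. c k *\<^sub>R \<phi> k x) \<in> H12_0 D"
      "H12_norm D (\<lambda>x. \<Sum>k\<in>K. c k *\<^sub>R \<phi> k x) \<le> (\<Sum>k\<in>K. \<bar>c k\<bar> * H12_norm D (\<phi> k))" by auto
    have k: "\<phi> k \<in> H12_0 D" using insert by auto
    show ?case
      using H12_0_lincomb[OF D k IH(1), of "c k" 1] H12_norm_lincomb[OF D H12_0_H12[OF k] H12_0_H12[OF IH(1)], of "c k" 1] IH(2) insert(1,2)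
      by simp
  qed (use zero_H12_0[OF D] in auto)
  then show "(\<lambda>x. \<Sum>k\<in>K. c k *\<^sub>R \<phi> k x) \<in> H12_0 D"
    and "H12_norm D (\<lambda>x. \<Sum>k\<in>K. c k *\<^sub>R \<phi> k x) \<le> (\<Sum>k\<in>K. \<bar>c k\<bar> * H12_norm D (\<phi> k))" by auto
qed

text \<open>
  In a simple function \<open>\<sigma> = \<Sum>\<^sub>\<phi> 1\<^sub>A\<^sub>(\<^sub>\<phi>\<^sub>)
  \<phi>\<close> close to \<open>u\<close> the indicators are replaced by continuous functions.
\<close>

lemma Bochner_approximable:
  fixes T :: real
  assumes D: "open D" and u: "u \<in> Bochner_Lp 2 {0<..<T} (V_space D) (H12_norm D)"
  shows "approximable D T u"
  unfolding approximable_def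
proof (intro allI impI)
  fix \<delta> :: real assume \<delta>: "\<delta> > 0"
  let ?I = "lebesgue_on {0<..<T}"
  let ?N = "H12_norm D"
  have sm: "strongly_measurable_on {0<..<T} (V_space D) ?N u" using u by (simp add: Bochner_Lp_def)
  have uV: "AE t in ?I. u t \<in> V_space D" using sm by (simp add: strongly_measurable_on_def)
  obtain \<sigma> where \<sigma>: "simple_function ?I \<sigma>" "\<sigma> ` {0<..<T} \<subseteq> H12_0 D"
    "integrable ?I (\<lambda>t. (?N (\<lambda>x. u t x - \<sigma> t x))\<^sup>2)" "(LINT t|?I. (?N (\<lambda>x. u t x - \<sigma> t x))\<^sup>2) < \<delta> / 4"
    using Bochner_simple_approximation[OF D u, of "\<delta> / 4"] \<delta> by auto
  define R where "R = \<sigma> ` {0<..<T}"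
  have fin: "finite R" using simple_functionD(1)[OF \<sigma>(1)] by (simp add: R_def)
  have RH: "\<phi> \<in> H12_0 D" if "\<phi> \<in> R" for \<phi> using that \<sigma>(2) by (auto simp: R_def)
  define A where "A \<phi> = \<sigma> -` {\<phi>} \<inter> {0<..<T}" for \<phi>
  have A: "A \<phi> \<in> sets lebesgue" for \<phi>
    using simple_functionD(2)[OF \<sigma>(1), of "{\<phi>}"] by (simp add: A_def sets_restrict_space_iff)
  define n where "n = real (card R) + 1"
  have n: "n > 0" by (simp add: n_def)
  define Q where "Q = (\<Sum>\<phi>\<in>R. (?N \<phi>)\<^sup>2) + 1"
  have Q: "Q > 0" by (simp add: Q_def sum_nonneg add_nonneg_pos)
  define \<eta> where "\<eta> = \<delta> / (4 * n * Q)"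
  have \<eta>: "\<eta> > 0" using \<delta> n Q by (simp add: \<eta>_def)
  have "\<forall>\<phi>. \<exists>c. continuous_on UNIV c \<and> (\<forall>t. 0 \<le> c t \<and> c t \<le> (1::real)) \<and> (LINT t|?I. (indicator (A \<phi>) t - c t)\<^sup>2) < \<eta>"
    using indicator_continuous_approximation[OF A \<eta>] by blast
  then have "\<exists>c. \<forall>\<phi>. continuous_on UNIV (c \<phi>) \<and> (\<forall>t. 0 \<le> c \<phi> t \<and> c \<phi> t \<le> (1::real)) \<and> (LINT t|?I. (indicator (A \<phi>) t - c \<phi> t)\<^sup>2) < \<eta>"
    by (rule choice)
  then obtain c where c: "\<And>\<phi>. continuous_on UNIV (c \<phi>)" "\<And>\<phi> t. 0 \<le> c \<phi> t \<and> c \<phi> t \<le> (1::real)"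
    "\<And>\<phi>. (LINT t|?I. (indicator (A \<phi>) t - c \<phi> t)\<^sup>2) < \<eta>" by blast
  define \<Psi> where "\<Psi> t = (\<lambda>x. \<Sum>\<phi>\<in>R. c \<phi> t *\<^sub>R \<phi> x)" for t
  have \<Psi>H: "\<Psi> t \<in> H12_0 D" for t unfolding \<Psi>_def by (intro H12_0_sum D RH)
  have \<Psi>d: "?N (\<lambda>x. \<Psi> s x - \<Psi> t x) \<le> (\<Sum>\<phi>\<in>R. \<bar>c \<phi> s - c \<phi> t\<bar> * ?N \<phi>)" for s t
    using H12_0_sum(2)[OF D RH, where K=R and c="\<lambda>\<phi>. c \<phi> s - c \<phi> t"] by (simp add: \<Psi>_def sum_subtractf scaleR_left_diff_distrib)
  have unif: "\<forall>e>0. \<exists>d>0. \<forall>s\<in>{0<..<T}. \<forall>t\<in>{0<..<T}. \<bar>s - t\<bar> < d \<longrightarrow> ?N (\<lambda>x. \<Psi> s x - \<Psi> t x) < e"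
  proof (intro allI impI)
    fix e :: real assume e: "e > 0"
    define B where "B = (\<Sum>\<phi>\<in>R. ?N \<phi>) + 1"
    have B: "B > 0" by (simp add: B_def sum_nonneg add_nonneg_pos)
    have eB: "e / B > 0" using e B by simp
    have "\<exists>d>0. \<forall>t\<in>{0..T}. \<forall>s\<in>{0..T}. dist s t < d \<longrightarrow> dist (c \<phi> s) (c \<phi> t) < e / B" for \<phi>
    proof -
      have "uniformly_continuous_on {0..T} (c \<phi>)"
        by (intro compact_uniformly_continuous continuous_on_subset[OF c(1)]) auto
      from this[unfolded uniformly_continuous_on_def, rule_format, OF eB] show ?thesis by blast
    qed
    then have "\<exists>d. \<forall>\<phi>. d \<phi> > 0 \<and> (\<forall>t\<in>{0..T}. \<forall>s\<in>{0..T}. dist s t < d \<phi> \<longrightarrow> dist (c \<phi> s) (c \<phi> t) < e / B)"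
      by (intro choice) blast
    then obtain d where d: "\<And>\<phi>. d \<phi> > 0" "\<And>\<phi> s t. s \<in> {0..T} \<Longrightarrow> t \<in> {0..T} \<Longrightarrow> dist s t < d \<phi> \<Longrightarrow> dist (c \<phi> s) (c \<phi> t) < e / B"
      by blast
    define d0 where "d0 = Min (insert 1 (d ` R))"
    have d0: "d0 > 0" "\<And>\<phi>. \<phi> \<in> R \<Longrightarrow> d0 \<le> d \<phi>" using fin d(1) by (auto simp: d0_def)
    have "?N (\<lambda>x. \<Psi> s x - \<Psi> t x) < e" if st: "s \<in> {0<..<T}" "t \<in> {0<..<T}" "\<bar>s - t\<bar> < d0" for s t
    proof -
      have "\<bar>c \<phi> s - c \<phi> t\<bar> \<le> e / B" if "\<phi> \<in> R" for \<phi>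
        using d(2)[of s t \<phi>] st d0(2)[OF that] by (auto simp: dist_real_def)
      then have "(\<Sum>\<phi>\<in>R. \<bar>c \<phi> s - c \<phi> t\<bar> * ?N \<phi>) \<le> (\<Sum>\<phi>\<in>R. e / B * ?N \<phi>)"
        by (intro sum_mono mult_right_mono) auto
      also have "\<dots> = e / B * (B - 1)" by (simp add: B_def sum_distrib_left)
      also have "\<dots> < e" using e B by (simp add: field_simps)
      finally show ?thesis using \<Psi>d[of s t] by simp
    qed
    then show "\<exists>d>0. \<forall>s\<in>{0<..<T}. \<forall>t\<in>{0<..<T}. \<bar>s - t\<bar> < d \<longrightarrow> ?N (\<lambda>x. \<Psi> s x - \<Psi> t x) < e"
      using d0(1) by blast
  qed
  have \<Psi>m: "(\<lambda>t. ?N (\<lambda>x. u t x - \<Psi> t x)) \<in> borel_measurable ?I"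
  proof (rule strongly_measurable_distance[OF D sm \<Psi>H])
    fix \<phi> assume \<phi>: "\<phi> \<in> V_space D"
    have "continuous_on {0<..<T} (\<lambda>t. ?N (\<lambda>x. \<phi> x - \<Psi> t x))"
      unfolding continuous_on_iff
    proof (intro ballI allI impI)
      fix t e :: real assume t: "t \<in> {0<..<T}" and e: "e > 0"
      obtain d where d: "d > 0" "\<forall>s\<in>{0<..<T}. \<forall>t\<in>{0<..<T}. \<bar>s - t\<bar> < d \<longrightarrow> ?N (\<lambda>x. \<Psi> s x - \<Psi> t x) < e"
        using unif e by blast
      have "dist (?N (\<lambda>x. \<phi> x - \<Psi> s x)) (?N (\<lambda>x. \<phi> x - \<Psi> t x)) < e" if s: "s \<in> {0<..<T}" "dist s t < d" for s
      proof -
        have "\<bar>?N (\<lambda>x. \<Psi> s x - \<phi> x) - ?N (\<lambda>x. \<Psi> t x - \<phi> x)\<bar> \<le> ?N (\<lambda>x. \<Psi> s x - \<Psi> t x)"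
          by (intro H12_norm_diff_lipschitz D H12_0_H12[OF \<Psi>H] V_space_H12 \<phi>)
        also have "\<dots> < e" using d(2) s t by (auto simp: dist_real_def)
        finally show ?thesis
          using H12_norm_minus_commute[OF D V_space_H12[OF \<phi>] H12_0_H12[OF \<Psi>H]] by (simp add: dist_real_def)
      qed
      then show "\<exists>d>0. \<forall>s\<in>{0<..<T}. dist s t < d \<longrightarrow> dist (?N (\<lambda>x. \<phi> x - \<Psi> s x)) (?N (\<lambda>x. \<phi> x - \<Psi> t x)) < e"
        using d(1) by blast
    qed
    then show "(\<lambda>t. ?N (\<lambda>x. \<phi> x - \<Psi> t x)) \<in> borel_measurable ?I"
      by (intro continuous_imp_measurable_on_sets_lebesgue) auto
  qed
  define k where "k \<phi> t = (indicator (A \<phi>) t - c \<phi> t)\<^sup>2" for \<phi> t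
  have ki: "integrable ?I (k \<phi>)" for \<phi>
  proof (rule Bochner_Integration.integrable_bound[OF integrable_const_interval[of 0 T 1]])
    have "indicat_real (A \<phi>) \<in> borel_measurable ?I" using A by (intro measurable_restrict_space1) simp
    moreover have "c \<phi> \<in> borel_measurable ?I"
      by (intro borel_measurable_imp_lebesgue_on borel_measurable_continuous_onI c)
    ultimately show "k \<phi> \<in> borel_measurable ?I" unfolding k_def by auto
    show "AE t in ?I. norm (k \<phi> t) \<le> norm (1::real)"
    proof (rule AE_I2)
      fix t
      have "\<bar>indicator (A \<phi>) t - c \<phi> t\<bar> \<le> 1" using c(2)[of \<phi> t] by (auto simp: indicator_def)
      then show "norm (k \<phi> t) \<le> norm (1::real)" by (simp add: k_def abs_square_le_1)
    qed
  qed
  have le: "AE t in ?I. (?N (\<lambda>x. u t x - \<Psi> t x))\<^sup>2 \<le> 2 * (?N (\<lambda>x. u t x - \<sigma> t x))\<^sup>2 + 2 * (n * (\<Sum>\<phi>\<in>R. (?N \<phi>)\<^sup>2 * k \<phi> t))"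
    using uV AE_space[of ?I]
  proof eventually_elim
    case (elim t)
    then have t: "t \<in> {0<..<T}" by simp
    have \<sigma>R: "\<sigma> t \<in> R" using t by (auto simp: R_def)
    note uH = V_space_H12[OF elim(1)] and \<sigma>H = H12_0_H12[OF RH[OF \<sigma>R]] and PH = H12_0_H12[OF \<Psi>H[of t]]
    have \<sigma>sum: "\<sigma> t = (\<lambda>x. \<Sum>\<phi>\<in>R. indicator (A \<phi>) t *\<^sub>R \<phi> x)"
    proof
      fix x
      have "(\<Sum>\<phi>\<in>R. indicator (A \<phi>) t *\<^sub>R \<phi> x) = (\<Sum>\<phi>\<in>R. if \<phi> = \<sigma> t then \<sigma> t x else 0)"
        using t by (intro sum.cong) (auto simp: A_def indicator_def)
      then show "\<sigma> t x = (\<Sum>\<phi>\<in>R. indicator (A \<phi>) t *\<^sub>R \<phi> x)" using fin \<sigma>R by simp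
    qed
    have "?N (\<lambda>x. \<sigma> t x - \<Psi> t x) \<le> (\<Sum>\<phi>\<in>R. \<bar>indicator (A \<phi>) t - c \<phi> t\<bar> * ?N \<phi>)"
      unfolding \<sigma>sum \<Psi>_def using H12_0_sum(2)[OF D RH, where K=R and c="\<lambda>\<phi>. indicator (A \<phi>) t - c \<phi> t"]
      by (simp add: sum_subtractf scaleR_left_diff_distrib)
    then have "(?N (\<lambda>x. \<sigma> t x - \<Psi> t x))\<^sup>2 \<le> (\<Sum>\<phi>\<in>R. 1 * (\<bar>indicator (A \<phi>) t - c \<phi> t\<bar> * ?N \<phi>))\<^sup>2"
      by (intro power_mono) auto
    also have "\<dots> \<le> (\<Sum>\<phi>\<in>R. 1\<^sup>2) * (\<Sum>\<phi>\<in>R. (\<bar>indicator (A \<phi>) t - c \<phi> t\<bar> * ?N \<phi>)\<^sup>2)"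
      by (rule Cauchy_Schwarz_ineq_sum)
    also have "\<dots> = real (card R) * (\<Sum>\<phi>\<in>R. (?N \<phi>)\<^sup>2 * k \<phi> t)"
      by (simp add: power_mult_distrib k_def mult.commute)
    also have "\<dots> \<le> n * (\<Sum>\<phi>\<in>R. (?N \<phi>)\<^sup>2 * k \<phi> t)"
      unfolding n_def k_def by (intro mult_right_mono sum_nonneg) auto
    finally have s: "(?N (\<lambda>x. \<sigma> t x - \<Psi> t x))\<^sup>2 \<le> n * (\<Sum>\<phi>\<in>R. (?N \<phi>)\<^sup>2 * k \<phi> t)" .
    have "(?N (\<lambda>x. u t x - \<Psi> t x))\<^sup>2 \<le> (?N (\<lambda>x. u t x - \<sigma> t x) + ?N (\<lambda>x. \<sigma> t x - \<Psi> t x))\<^sup>2"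
      by (intro power_mono H12_norm_triangle_diff D uH \<sigma>H PH) auto
    also have "\<dots> \<le> 2 * (?N (\<lambda>x. u t x - \<sigma> t x))\<^sup>2 + 2 * (?N (\<lambda>x. \<sigma> t x - \<Psi> t x))\<^sup>2"
      using zero_le_power2[of "?N (\<lambda>x. u t x - \<sigma> t x) - ?N (\<lambda>x. \<sigma> t x - \<Psi> t x)"] by (simp add: power2_eq_square algebra_simps)
    finally show ?case using s by linarith
  qed
  have wi: "integrable ?I (\<lambda>t. 2 * (?N (\<lambda>x. u t x - \<sigma> t x))\<^sup>2 + 2 * (n * (\<Sum>\<phi>\<in>R. (?N \<phi>)\<^sup>2 * k \<phi> t)))"
    using \<sigma>(3) ki by (intro Bochner_Integration.integrable_add integrable_mult_right Bochner_Integration.integrable_sum) auto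
  have i: "integrable ?I (\<lambda>t. (?N (\<lambda>x. u t x - \<Psi> t x))\<^sup>2)"
    by (rule Bochner_Integration.integrable_bound[OF wi]) (use \<Psi>m le in \<open>auto elim!: eventually_mono\<close>)
  have "(LINT t|?I. (?N (\<lambda>x. u t x - \<Psi> t x))\<^sup>2)
      \<le> (LINT t|?I. 2 * (?N (\<lambda>x. u t x - \<sigma> t x))\<^sup>2 + 2 * (n * (\<Sum>\<phi>\<in>R. (?N \<phi>)\<^sup>2 * k \<phi> t)))"
    by (rule integral_mono_AE[OF i wi le])
  also have "\<dots> = 2 * (LINT t|?I. (?N (\<lambda>x. u t x - \<sigma> t x))\<^sup>2) + 2 * (n * (\<Sum>\<phi>\<in>R. (?N \<phi>)\<^sup>2 * (LINT t|?I. k \<phi> t)))"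
    using \<sigma>(3) ki by (simp add: Bochner_Integration.integral_sum)
  also have "\<dots> < \<delta>"
  proof -
    have "(\<Sum>\<phi>\<in>R. (?N \<phi>)\<^sup>2 * (LINT t|?I. k \<phi> t)) \<le> (\<Sum>\<phi>\<in>R. (?N \<phi>)\<^sup>2 * \<eta>)"
      using less_imp_le[OF c(3)] unfolding k_def by (intro sum_mono mult_left_mono) auto
    also have "\<dots> \<le> Q * \<eta>" using \<eta> unfolding Q_def sum_distrib_right[symmetric] by (intro mult_right_mono) auto
    finally have "n * (\<Sum>\<phi>\<in>R. (?N \<phi>)\<^sup>2 * (LINT t|?I. k \<phi> t)) \<le> n * (Q * \<eta>)" using n by (intro mult_left_mono) auto
    also have "\<dots> = \<delta> / 4" using n Q by (simp add: \<eta>_def)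
    finally show ?thesis using \<sigma>(4) by linarith
  qed
  finally have lt: "(LINT t|?I. (?N (\<lambda>x. u t x - \<Psi> t x))\<^sup>2) < \<delta>" .
  show "\<exists>\<Psi>. (\<forall>t. \<Psi> t \<in> H12_0 D) \<and>
     (\<forall>e>0. \<exists>d>0. \<forall>s\<in>{0<..<T}. \<forall>t\<in>{0<..<T}. \<bar>s - t\<bar> < d \<longrightarrow> ?N (\<lambda>x. \<Psi> s x - \<Psi> t x) < e) \<and>
     integrable ?I (\<lambda>t. (?N (\<lambda>x. u t x - \<Psi> t x))\<^sup>2) \<and> (LINT t|?I. (?N (\<lambda>x. u t x - \<Psi> t x))\<^sup>2) < \<delta>"
    using \<Psi>H unif i lt by blast
qed

lemma tendsto_by_bound:
  fixes f :: "nat \<Rightarrow> real"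
  assumes "\<And>n. norm (f n - l) \<le> g n" "g \<longlonglongrightarrow> 0"
  shows "f \<longlonglongrightarrow> l"
  by (rule LIM_zero_cancel, rule Lim_null_comparison[OF always_eventually assms(2)]) (use assms(1) in blast)

text \<open>
  Along simple functions the values are simple functions; the multilinear bounds give convergence
  almost everywhere.
\<close>

lemma measurable_trilinear_path:
  fixes T :: real
  assumes D: "open D" and \<delta>: "\<delta> > 0"
    and v: "strongly_measurable_on {0<..<T} (Lp_on D (3 + \<delta>)) (Lp_norm D (3 + \<delta>)) v"
    and u: "strongly_measurable_on {0<..<T} (V_space D) (H12_norm D) u" and \<phi>: "\<phi> \<in> V_space D"
  shows "(\<lambda>t. trilinear D (v t) \<phi> (u t)) \<in> borel_measurable (lebesgue_on {0<..<T})"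
    and "(\<lambda>t. trilinear D (v t) (u t) \<phi>) \<in> borel_measurable (lebesgue_on {0<..<T})"
    and "(\<lambda>t. stokes_op D (u t) \<phi>) \<in> borel_measurable (lebesgue_on {0<..<T})"
proof -
  let ?I = "lebesgue_on {0<..<T}" and ?p = "3 + \<delta>" and ?N = "H12_norm D"
  define K where "K = 2 * sqrt (3 * 110592 powr (1 / ?p))"
  have bd: "\<bar>trilinear D w g f\<bar> \<le> K * Lp_norm D ?p w * ?N g * ?N f" if "w \<in> Lp_on D ?p" "g \<in> H12_0 D" "f \<in> H12 D" for w g f
    unfolding K_def by (rule trilinear_bound_H12[OF D \<delta> that])
  obtain s where s: "\<And>n. simple_function ?I (s n)" "\<And>n. s n ` {0<..<T} \<subseteq> V_space D"
    and sl: "AE t in ?I. (\<lambda>n. ?N (\<lambda>x. s n t x - u t x)) \<longlonglongrightarrow> 0"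
    and uV: "AE t in ?I. u t \<in> V_space D"
    using u by (auto simp: strongly_measurable_on_def)
  obtain \<sigma> where \<sigma>: "\<And>n. simple_function ?I (\<sigma> n)" "\<And>n. \<sigma> n ` {0<..<T} \<subseteq> Lp_on D ?p"
    and \<sigma>l: "AE t in ?I. (\<lambda>n. Lp_norm D ?p (\<lambda>x. \<sigma> n t x - v t x)) \<longlonglongrightarrow> 0"
    and vL: "AE t in ?I. v t \<in> Lp_on D ?p"
    using v by (auto simp: strongly_measurable_on_def)
  have \<phi>0: "\<phi> \<in> H12_0 D" and \<phi>1: "\<phi> \<in> H12 D" using \<phi> by (auto intro: V_space_H12 V_space_H12_0)
  have p: "?p > 0" using \<delta> by simp
  have good: "AE t in ?I. t \<in> {0<..<T}" using AE_space[of ?I] by simp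
  have S: "{0<..<T} \<in> sets lebesgue" by simp
  have Nlim: "(\<lambda>n. ?N (s n t)) \<longlonglongrightarrow> ?N (u t)"
    if t: "t \<in> {0<..<T}" "u t \<in> V_space D" "(\<lambda>n. ?N (\<lambda>x. s n t x - u t x)) \<longlonglongrightarrow> 0" for t
  proof (rule LIM_zero_cancel, rule Lim_null_comparison[OF always_eventually t(3)], rule allI)
    fix n
    have sH: "s n t \<in> H12 D" using t(1) s(2)[of n] by (intro V_space_H12) auto
    note uH = V_space_H12[OF t(2)]
    show "norm (?N (s n t) - ?N (u t)) \<le> ?N (\<lambda>x. s n t x - u t x)"
      using H12_norm_diff_lipschitz[OF D sH uH H12_0_H12[OF zero_H12_0(1)[OF D]]] by simp
  qed
  have sV: "s n t \<in> V_space D" if "t \<in> {0<..<T}" for n t using that s(2)[of n] by blast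
  have \<sigma>L: "\<sigma> n t \<in> Lp_on D ?p" if "t \<in> {0<..<T}" for n t using that \<sigma>(2)[of n] by blast
  show "(\<lambda>t. trilinear D (v t) \<phi> (u t)) \<in> borel_measurable ?I"
  proof (rule lebesgue_on_measurable_AE_limit[OF S, where f="\<lambda>n t. trilinear D (\<sigma> n t) \<phi> (s n t)"])
    show "(\<lambda>t. trilinear D (\<sigma> n t) \<phi> (s n t)) \<in> borel_measurable ?I" for n
      by (rule borel_measurable_simple_function[OF simple_function_compose2[OF \<sigma>(1) s(1), of "\<lambda>w f. trilinear D w \<phi> f"]])
    show "AE t in ?I. (\<lambda>n. trilinear D (\<sigma> n t) \<phi> (s n t)) \<longlonglongrightarrow> trilinear D (v t) \<phi> (u t)"
      using uV vL sl \<sigma>l good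
    proof eventually_elim
      case (elim t)
      have le: "norm (trilinear D (\<sigma> n t) \<phi> (s n t) - trilinear D (v t) \<phi> (u t))
         \<le> K * Lp_norm D ?p (\<lambda>x. \<sigma> n t x - v t x) * ?N \<phi> * ?N (s n t) + K * Lp_norm D ?p (v t) * ?N \<phi> * ?N (\<lambda>x. s n t x - u t x)" for n
      proof -
        note a = \<sigma>L[OF elim(5), of n] and b = V_space_H12[OF sV[OF elim(5)], of n] and c = V_space_H12[OF elim(1)]
        have "trilinear D (\<sigma> n t) \<phi> (s n t) - trilinear D (v t) \<phi> (u t)
            = trilinear D (\<lambda>x. \<sigma> n t x - v t x) \<phi> (s n t) + trilinear D (v t) \<phi> (\<lambda>x. s n t x - u t x)"
          using trilinear_diff1[OF D \<delta> a \<phi>0 b elim(2)] trilinear_diff3[OF D \<delta> elim(2) \<phi>0 b c] by simp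
        then show ?thesis
          using bd[OF Lp_on_diff[OF a elim(2) p] \<phi>0 b] bd[OF elim(2) \<phi>0 H12_diff(1)[OF D b c]] by simp
      qed
      have "(\<lambda>n. K * Lp_norm D ?p (\<lambda>x. \<sigma> n t x - v t x) * ?N \<phi> * ?N (s n t) + K * Lp_norm D ?p (v t) * ?N \<phi> * ?N (\<lambda>x. s n t x - u t x))
          \<longlonglongrightarrow> K * 0 * ?N \<phi> * ?N (u t) + K * Lp_norm D ?p (v t) * ?N \<phi> * 0" (is "?lim \<longlonglongrightarrow> _")
        by (intro tendsto_intros elim Nlim)
      then have "?lim \<longlonglongrightarrow> 0" by (simp only: mult_zero_right mult_zero_left add_0)
      then show ?case by (rule tendsto_by_bound[OF le])
    qed
  qed
  show "(\<lambda>t. trilinear D (v t) (u t) \<phi>) \<in> borel_measurable ?I"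
  proof (rule lebesgue_on_measurable_AE_limit[OF S, where f="\<lambda>n t. trilinear D (\<sigma> n t) (s n t) \<phi>"])
    show "(\<lambda>t. trilinear D (\<sigma> n t) (s n t) \<phi>) \<in> borel_measurable ?I" for n
      by (rule borel_measurable_simple_function[OF simple_function_compose2[OF \<sigma>(1) s(1), of "\<lambda>w f. trilinear D w f \<phi>"]])
    show "AE t in ?I. (\<lambda>n. trilinear D (\<sigma> n t) (s n t) \<phi>) \<longlonglongrightarrow> trilinear D (v t) (u t) \<phi>"
      using uV vL sl \<sigma>l good
    proof eventually_elim
      case (elim t)
      have le: "norm (trilinear D (\<sigma> n t) (s n t) \<phi> - trilinear D (v t) (u t) \<phi>)
         \<le> K * Lp_norm D ?p (\<lambda>x. \<sigma> n t x - v t x) * ?N (s n t) * ?N \<phi> + K * Lp_norm D ?p (v t) * ?N (\<lambda>x. s n t x - u t x) * ?N \<phi>" for n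
      proof -
        note a = \<sigma>L[OF elim(5), of n] and b = V_space_H12_0[OF sV[OF elim(5)], of n] and c = V_space_H12_0[OF elim(1)]
        have "trilinear D (\<sigma> n t) (s n t) \<phi> - trilinear D (v t) (u t) \<phi>
            = trilinear D (\<lambda>x. \<sigma> n t x - v t x) (s n t) \<phi> + trilinear D (v t) (\<lambda>x. s n t x - u t x) \<phi>"
          using trilinear_diff1[OF D \<delta> a b \<phi>1 elim(2)] trilinear_diff2[OF D \<delta> elim(2) b \<phi>1 c] by simp
        then show ?thesis
          using bd[OF Lp_on_diff[OF a elim(2) p] b \<phi>1] bd[OF elim(2) H12_0_diff[OF D b c] \<phi>1] by simp
      qed
      have "(\<lambda>n. K * Lp_norm D ?p (\<lambda>x. \<sigma> n t x - v t x) * ?N (s n t) * ?N \<phi> + K * Lp_norm D ?p (v t) * ?N (\<lambda>x. s n t x - u t x) * ?N \<phi>)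
          \<longlonglongrightarrow> K * 0 * ?N (u t) * ?N \<phi> + K * Lp_norm D ?p (v t) * 0 * ?N \<phi>" (is "?lim \<longlonglongrightarrow> _")
        by (intro tendsto_intros elim Nlim)
      then have "?lim \<longlonglongrightarrow> 0" by (simp only: mult_zero_right mult_zero_left add_0)
      then show ?case by (rule tendsto_by_bound[OF le])
    qed
  qed
  show "(\<lambda>t. stokes_op D (u t) \<phi>) \<in> borel_measurable ?I"
  proof (rule lebesgue_on_measurable_AE_limit[OF S, where f="\<lambda>n t. stokes_op D (s n t) \<phi>"])
    show "(\<lambda>t. stokes_op D (s n t) \<phi>) \<in> borel_measurable ?I" for n
      by (rule borel_measurable_simple_function[OF simple_function_compose1[OF s(1), of "\<lambda>f. stokes_op D f \<phi>"]])
    show "AE t in ?I. (\<lambda>n. stokes_op D (s n t) \<phi>) \<longlonglongrightarrow> stokes_op D (u t) \<phi>"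
      using uV sl good
    proof eventually_elim
      case (elim t)
      have le: "norm (stokes_op D (s n t) \<phi> - stokes_op D (u t) \<phi>) \<le> ?N \<phi> * ?N (\<lambda>x. s n t x - u t x)" for n
      proof -
        note b = V_space_H12[OF sV[OF elim(3)], of n] and c = V_space_H12[OF elim(1)]
        have "stokes_op D (s n t) \<phi> - stokes_op D (u t) \<phi> = stokes_op D \<phi> (\<lambda>x. s n t x - u t x)"
          using stokes_op_diff_right[OF D \<phi>1 b c] by (simp add: stokes_op_commute[of D \<phi>])
        then show ?thesis using stokes_op_bound[OF D \<phi>1 H12_diff(1)[OF D b c]] by simp
      qed
      have "(\<lambda>n. ?N \<phi> * ?N (\<lambda>x. s n t x - u t x)) \<longlonglongrightarrow> ?N \<phi> * 0" (is "?lim \<longlonglongrightarrow> _") by (intro tendsto_intros elim)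
      then have "?lim \<longlonglongrightarrow> 0" by (simp only: mult_zero_right mult_zero_left add_0)
      then show ?case by (rule tendsto_by_bound[OF le])
    qed
  qed
qed

section \<open>Time reversal\<close>

text \<open>
  The map \<open>t \<mapsto> T - t\<close> preserves the measure on \<open>(0, T)\<close>.
\<close>

lemma distr_reflection:
  fixes T :: real
  shows "distr (lebesgue_on {0<..<T}) (lebesgue_on {0<..<T}) (\<lambda>t. T - t) = lebesgue_on {0<..<T}"
    and "(\<lambda>t. T - t) \<in> measurable (lebesgue_on {0<..<T}) (lebesgue_on {0<..<T})"
proof -
  let ?I = "lebesgue_on {0<..<T}"
  (* the affine substitution with slope -1 has density 1 *)
  have aff: "lebesgue = density (distr lebesgue lebesgue (\<lambda>x. T + (-1) * x)) (\<lambda>_. ennreal \<bar>-1::real\<bar>)"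
    by (rule lebesgue_real_affine) simp
  have l: "distr lebesgue lebesgue (\<lambda>x. T - x) = lebesgue"
    using aff by (simp add: density_1)
  have lm: "(\<lambda>x. T - x) \<in> measurable lebesgue lebesgue"
    using lebesgue_affine_measurable[of "\<lambda>_. -1" T] by simp
  show m: "(\<lambda>t. T - t) \<in> measurable ?I ?I"
    by (rule measurable_restrict_space3[OF lm]) auto
  show "distr ?I ?I (\<lambda>t. T - t) = ?I"
  proof (rule measure_eqI)
    fix A assume "A \<in> sets (distr ?I ?I (\<lambda>t. T - t))"
    then have A: "A \<in> sets lebesgue" "A \<subseteq> {0<..<T}" by (auto simp: sets_restrict_space_iff)
    have AI: "A \<in> sets ?I" using A by (simp add: sets_restrict_space_iff)
    (* the interval is symmetric under the reflection *)
    have pre: "(\<lambda>t. T - t) -` A \<inter> {0<..<T} = (\<lambda>t. T - t) -` A" using A(2) by force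
    have "emeasure (distr ?I ?I (\<lambda>t. T - t)) A = emeasure ?I ((\<lambda>t. T - t) -` A \<inter> {0<..<T})"
      using m AI by (subst emeasure_distr) auto
    also have "\<dots> = emeasure lebesgue ((\<lambda>t. T - t) -` A)"
      unfolding pre using pre by (subst emeasure_restrict_space) auto
    also have "\<dots> = emeasure (distr lebesgue lebesgue (\<lambda>x. T - x)) A"
      using lm A(1) by (subst emeasure_distr) auto
    also have "\<dots> = emeasure ?I A" unfolding l using A by (subst emeasure_restrict_space) auto
    finally show "emeasure (distr ?I ?I (\<lambda>t. T - t)) A = emeasure ?I A" .
  qed simp
qed

lemma AE_reflect:
  fixes T :: real
  assumes "AE t in lebesgue_on {0<..<T}. P t"
  shows "AE t in lebesgue_on {0<..<T}. P (T - t)"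
proof -
  have "AE t in distr (lebesgue_on {0<..<T}) (lebesgue_on {0<..<T}) (\<lambda>t. T - t). P t"
    unfolding distr_reflection(1) by (rule assms)
  then show ?thesis by (rule AE_distrD[OF distr_reflection(2)])
qed

lemma integral_reflect_interval:
  fixes f :: "real \<Rightarrow> real"
  shows "integrable (lebesgue_on {0<..<T}) f \<Longrightarrow> integrable (lebesgue_on {0<..<T}) (\<lambda>t. f (T - t))"
    and "integrable (lebesgue_on {0<..<T}) f \<Longrightarrow> (LINT t|lebesgue_on {0<..<T}. f (T - t)) = (LINT t|lebesgue_on {0<..<T}. f t)"
proof -
  let ?I = "lebesgue_on {0<..<T}"
  assume f: "integrable ?I f"
  then have fm: "f \<in> borel_measurable ?I" by simp
  have "integrable (distr ?I ?I (\<lambda>t. T - t)) f" unfolding distr_reflection(1) by (rule f)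
  then show "integrable ?I (\<lambda>t. f (T - t))" by (rule integrable_distr[OF distr_reflection(2)])
  have "(LINT t|distr ?I ?I (\<lambda>t. T - t). f t) = (LINT t|?I. f (T - t))"
    by (rule integral_distr[OF distr_reflection(2) fm])
  then show "(LINT t|?I. f (T - t)) = (LINT t|?I. f t)" unfolding distr_reflection(1) by simp
qed

lemma integral_reflect_subinterval:
  fixes f :: "real \<Rightarrow> real"
  assumes f: "integrable (lebesgue_on {0<..<T}) f" and st: "0 < s" "s < t" "t < T"
  shows "(LINT \<tau>|lebesgue_on {s<..<t}. f (T - \<tau>)) = (LINT \<tau>|lebesgue_on {T - t<..<T - s}. f \<tau>)"
proof -
  let ?k = "\<lambda>\<tau>. f \<tau> * indicator {T - t<..<T - s} \<tau>"
  have k: "integrable (lebesgue_on {0<..<T}) ?k"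
    by (rule integrable_mult_bounded_measurable[OF f, of _ 1])
      (auto simp: indicator_def intro!: borel_measurable_imp_lebesgue_on)
  have "(LINT \<tau>|lebesgue_on {s<..<t}. f (T - \<tau>)) = (LINT \<tau>|lebesgue_on {0<..<T}. ?k (T - \<tau>))"
    using st by (intro lebesgue_on_integral_cong_support) (auto simp: indicator_def)
  also have "\<dots> = (LINT \<tau>|lebesgue_on {0<..<T}. ?k \<tau>)" by (rule integral_reflect_interval(2)[OF k])
  also have "\<dots> = (LINT \<tau>|lebesgue_on {T - t<..<T - s}. f \<tau>)"
    using st by (intro lebesgue_on_integral_cong_support) (auto simp: indicator_def)
  finally show ?thesis .
qed

lemma strongly_measurable_reflect:
  fixes T :: real
  assumes "strongly_measurable_on {0<..<T} X N u"
  shows "strongly_measurable_on {0<..<T} X N (\<lambda>t. u (T - t))"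
proof -
  let ?I = "lebesgue_on {0<..<T}"
  obtain s where s: "\<And>n. simple_function ?I (s n)" "\<And>n. s n ` {0<..<T} \<subseteq> X"
    and lim: "AE t in ?I. (\<lambda>n. N (\<lambda>x. s n t x - u t x)) \<longlonglongrightarrow> 0" and uX: "AE t in ?I. u t \<in> X"
    using assms by (auto simp: strongly_measurable_on_def)
  have "simple_function ?I (\<lambda>t. s n (T - t))" for n
    by (rule simple_function_comp[OF distr_reflection(2) s(1)])
  moreover have "(\<lambda>t. s n (T - t)) ` {0<..<T} \<subseteq> X" for n
  proof
    fix f assume "f \<in> (\<lambda>t. s n (T - t)) ` {0<..<T}"
    then obtain t where "t \<in> {0<..<T}" "f = s n (T - t)" by blast
    then show "f \<in> X" using s(2)[of n] by (auto simp: image_subset_iff)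
  qed
  ultimately show ?thesis
    unfolding strongly_measurable_on_def
    by (intro conjI exI[of _ "\<lambda>n t. s n (T - t)"] allI AE_reflect[OF lim] AE_reflect[OF uX])
qed

lemma approximable_reflect:
  assumes "approximable D T u"
  shows "approximable D T (\<lambda>t. u (T - t))"
  unfolding approximable_def
proof (intro allI impI)
  fix \<delta> :: real assume "\<delta> > 0"
  then obtain \<Psi> where \<Psi>: "\<forall>t. \<Psi> t \<in> H12_0 D"
    "\<forall>e>0. \<exists>d>0. \<forall>s\<in>{0<..<T}. \<forall>t\<in>{0<..<T}. \<bar>s - t\<bar> < d \<longrightarrow> H12_norm D (\<lambda>x. \<Psi> s x - \<Psi> t x) < e"
    "integrable (lebesgue_on {0<..<T}) (\<lambda>t. (H12_norm D (\<lambda>x. u t x - \<Psi> t x))\<^sup>2)"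
    "(LINT t|lebesgue_on {0<..<T}. (H12_norm D (\<lambda>x. u t x - \<Psi> t x))\<^sup>2) < \<delta>"
    using assms unfolding approximable_def by blast
  have c: "\<exists>d>0. \<forall>s\<in>{0<..<T}. \<forall>t\<in>{0<..<T}. \<bar>s - t\<bar> < d \<longrightarrow> H12_norm D (\<lambda>x. \<Psi> (T - s) x - \<Psi> (T - t) x) < e" if e: "e > 0" for e
  proof -
    obtain d where d: "d > 0" "\<forall>s\<in>{0<..<T}. \<forall>t\<in>{0<..<T}. \<bar>s - t\<bar> < d \<longrightarrow> H12_norm D (\<lambda>x. \<Psi> s x - \<Psi> t x) < e"
      using \<Psi>(2)[rule_format, OF e] by blast
    show ?thesis
    proof (intro exI[of _ d] conjI ballI impI d(1))
      fix s t assume "s \<in> {0<..<T}" "t \<in> {0<..<T}" "\<bar>s - t\<bar> < d"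
      then have "T - s \<in> {0<..<T}" "T - t \<in> {0<..<T}" "\<bar>(T - s) - (T - t)\<bar> < d" by auto
      then show "H12_norm D (\<lambda>x. \<Psi> (T - s) x - \<Psi> (T - t) x) < e" using d(2) by blast
    qed
  qed
  show "\<exists>\<Psi>. (\<forall>t. \<Psi> t \<in> H12_0 D) \<and>
     (\<forall>e>0. \<exists>d>0. \<forall>s\<in>{0<..<T}. \<forall>t\<in>{0<..<T}. \<bar>s - t\<bar> < d \<longrightarrow> H12_norm D (\<lambda>x. \<Psi> s x - \<Psi> t x) < e) \<and>
     integrable (lebesgue_on {0<..<T}) (\<lambda>t. (H12_norm D (\<lambda>x. u (T - t) x - \<Psi> t x))\<^sup>2) \<and>
     (LINT t|lebesgue_on {0<..<T}. (H12_norm D (\<lambda>x. u (T - t) x - \<Psi> t x))\<^sup>2) < \<delta>"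
  proof (intro exI[of _ "\<lambda>t. \<Psi> (T - t)"] conjI allI impI)
    show "\<Psi> (T - t) \<in> H12_0 D" for t using \<Psi>(1) by blast
    show "integrable (lebesgue_on {0<..<T}) (\<lambda>t. (H12_norm D (\<lambda>x. u (T - t) x - \<Psi> (T - t) x))\<^sup>2)"
      by (rule integral_reflect_interval(1)[OF \<Psi>(3)])
    show "(LINT t|lebesgue_on {0<..<T}. (H12_norm D (\<lambda>x. u (T - t) x - \<Psi> (T - t) x))\<^sup>2) < \<delta>"
      unfolding integral_reflect_interval(2)[OF \<Psi>(3)] by (rule \<Psi>(4))
  qed (rule c)
qed

text \<open>
  Reversal of time changes the sign of the derivative.
\<close>

lemma evolution_reflect:
  assumes ev: "evolution D T M u r m"
  shows "evolution D T M (\<lambda>t. u (T - t)) (\<lambda>\<tau> \<phi>. - r (T - \<tau>) \<phi>) (\<lambda>\<tau>. m (T - \<tau>))"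
  unfolding evolution_def
proof (intro conjI ballI allI impI)
  show "u (T - t) \<in> Lp_on D 2" if "t \<in> {0..T}" for t using that by (intro evolution_L2[OF ev]) auto
  show "continuous_on {0..T} (\<lambda>t. L2_inner D (u (T - t)) g)" if "g \<in> Lp_on D 2" for g
    by (rule continuous_on_compose2[OF evolution_weakly_continuous[OF ev that]]) (auto intro!: continuous_intros)
  show "AE t in lebesgue_on {0<..<T}. u (T - t) \<in> V_space D \<and> Lp_norm D 2 (u (T - t)) \<le> M"
    by (rule AE_reflect[OF evolution_AE[OF ev]])
  show "integrable (lebesgue_on {0<..<T}) (\<lambda>\<tau>. - r (T - \<tau>) \<phi>)" if "\<phi> \<in> V_space D" for \<phi>
    using integral_reflect_interval(1)[OF evolution_rate_integrable[OF ev that]] by simp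
  show "L2_inner D (u (T - t)) \<phi> - L2_inner D (u (T - s)) \<phi> = (LINT \<tau>|lebesgue_on {s<..<t}. - r (T - \<tau>) \<phi>)"
    if \<phi>: "\<phi> \<in> V_space D" and st: "0 < s \<and> s < t \<and> t < T" for \<phi> s t
    using integral_reflect_subinterval[OF evolution_rate_integrable[OF ev \<phi>], of s t]
      evolution_increment[OF ev \<phi>, of "T - t" "T - s"] st by simp
  show "integrable (lebesgue_on {0<..<T}) (\<lambda>\<tau>. m (T - \<tau>))" by (rule integral_reflect_interval(1)[OF evolution_m(1)[OF ev]])
  show "m (T - \<tau>) \<ge> 0" for \<tau> by (rule evolution_m(2)[OF ev])
  show "\<exists>C\<ge>0. AE \<tau> in lebesgue_on {0<..<T}. rate_bound D M e C (\<lambda>\<phi>. - r (T - \<tau>) \<phi>) (m (T - \<tau>))" if e: "e > 0" for e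
  proof -
    obtain C where C: "C \<ge> 0" "AE \<tau> in lebesgue_on {0<..<T}. rate_bound D M e C (r \<tau>) (m \<tau>)"
      using evolution_modulus[OF ev e] by blast
    have neg: "rate_bound D M e C l a \<Longrightarrow> rate_bound D M e C (\<lambda>\<phi>. - l \<phi>) a" for l a
      by (simp add: rate_bound_def abs_minus_commute)
    show ?thesis
      proof (intro exI[of _ C] conjI C(1))
      show "AE \<tau> in lebesgue_on {0<..<T}. rate_bound D M e C (\<lambda>\<phi>. - r (T - \<tau>) \<phi>) (m (T - \<tau>))"
        using AE_reflect[where P="\<lambda>\<tau>. rate_bound D M e C (r \<tau>) (m \<tau>)", OF C(2)]
        by eventually_elim (rule neg)
    qed
  qed
  show "integrable (lebesgue_on {0<..<T}) (\<lambda>\<tau>. (H12_norm D (u (T - \<tau>)))\<^sup>2)"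
    by (rule integral_reflect_interval(1)[OF evolution_square_integrable[OF ev]])
  show "integrable (lebesgue_on {0<..<T}) (\<lambda>\<tau>. (H12_norm D (\<lambda>x. u (T - \<tau>) x - \<phi> x))\<^sup>2)" if "\<phi> \<in> V_space D" for \<phi>
    by (rule integral_reflect_interval(1)[OF evolution_distance_integrable[OF ev that]])
  show "approximable D T (\<lambda>t. u (T - t))" by (rule approximable_reflect[OF evolution_approximable[OF ev]])
qed

section \<open>The two evolution equations\<close>

text \<open>
  The weak continuity in \<open>H\<close> allows to evaluate the equation at all times; everything
  else in the notion of an evolution is a property of functions in \<open>L\<^sup>2(0,T;V)\<close>.
\<close>

lemma weak_solution_evolution:
  fixes T :: real
  assumes D: "open D" and u: "u \<in> Bochner_Lp 2 {0<..<T} (V_space D) (H12_norm D)"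
    and M: "AE t in lebesgue_on {0<..<T}. Lp_norm D 2 (u t) \<le> M"
    and wc: "u \<in> weakly_continuous_functions {0..T} (H_space D) (Lp_norm D 2)"
    and r: "\<And>\<phi>. \<phi> \<in> V_space D \<Longrightarrow> integrable (lebesgue_on {0<..<T}) (\<lambda>\<tau>. r \<tau> \<phi>)"
    and eq: "\<And>\<psi> \<phi>. \<psi> \<in> test_functions {0<..<T} \<Longrightarrow> \<phi> \<in> V_space D \<Longrightarrow>
        - (LINT t|lebesgue_on {0<..<T}. deriv \<psi> t * L2_inner D (u t) \<phi>) = (LINT t|lebesgue_on {0<..<T}. \<psi> t * r t \<phi>)"
    and m: "integrable (lebesgue_on {0<..<T}) m" "\<And>\<tau>. m \<tau> \<ge> 0"
    and modulus: "\<And>e. e > 0 \<Longrightarrow> \<exists>C\<ge>0. AE \<tau> in lebesgue_on {0<..<T}. rate_bound D M e C (r \<tau>) (m \<tau>)"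
  shows "evolution D T M u r m"
proof -
  let ?I = "lebesgue_on {0<..<T}"
  have sm: "strongly_measurable_on {0<..<T} (V_space D) (H12_norm D) u" using u by (simp add: Bochner_Lp_def)
  have uV: "AE t in ?I. u t \<in> V_space D" using sm by (simp add: strongly_measurable_on_def)
  have HL: "f \<in> Lp_on D 2" if "f \<in> H_space D" for f using that by (simp add: H_space_def)
  have uH: "u t \<in> Lp_on D 2" if "t \<in> {0..T}" for t
    using wc that by (intro HL) (simp add: weakly_continuous_functions_def)
  have cont: "continuous_on {0..T} (\<lambda>t. L2_inner D (u t) g)" if g: "g \<in> Lp_on D 2" for g
  proof -
    have l: "(\<lambda>f. L2_inner D f g) \<in> bounded_functionals (H_space D) (Lp_norm D 2)"
      unfolding bounded_functionals_def
    proof (intro CollectI conjI ballI allI exI[of _ "Lp_norm D 2 g"])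
      show "L2_inner D (\<lambda>x. a *\<^sub>R f x + b *\<^sub>R h x) g = a * L2_inner D f g + b * L2_inner D h g"
        if "f \<in> H_space D" "h \<in> H_space D" for f h a b
        by (rule L2_inner_lincomb_left[OF HL[OF that(1)] HL[OF that(2)] g])
      show "\<bar>L2_inner D f g\<bar> \<le> Lp_norm D 2 g * Lp_norm D 2 f" if "f \<in> H_space D" for f
        using L2_inner_bound[OF HL[OF that] g] by (simp add: mult.commute)
    qed
    have "\<forall>l\<in>bounded_functionals (H_space D) (Lp_norm D 2). continuous_on {0..T} (\<lambda>t. l (u t))"
      using wc by (simp add: weakly_continuous_functions_def)
    from bspec[OF this l] show ?thesis .
  qed
  have dist: "integrable ?I (\<lambda>\<tau>. (H12_norm D (\<lambda>x. u \<tau> x - \<phi> x))\<^sup>2)" if \<phi>: "\<phi> \<in> V_space D" for \<phi>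
  proof (rule Bochner_Integration.integrable_bound)
    show "integrable ?I (\<lambda>\<tau>. 2 * (H12_norm D (u \<tau>))\<^sup>2 + 2 * (H12_norm D \<phi>)\<^sup>2)"
      using Bochner_Lp_2_norm_measurable(2)[OF u H12_norm_nonneg] integrable_const_interval by auto
    have "(\<lambda>t. H12_norm D (\<lambda>x. u t x - \<phi> x)) \<in> borel_measurable ?I"
      by (rule strongly_measurable_distance[OF D sm V_space_H12_0[OF \<phi>]]) simp
    then show "(\<lambda>\<tau>. (H12_norm D (\<lambda>x. u \<tau> x - \<phi> x))\<^sup>2) \<in> borel_measurable ?I" by simp
    show "AE \<tau> in ?I. norm ((H12_norm D (\<lambda>x. u \<tau> x - \<phi> x))\<^sup>2) \<le> norm (2 * (H12_norm D (u \<tau>))\<^sup>2 + 2 * (H12_norm D \<phi>)\<^sup>2)"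
      using uV
    proof eventually_elim
      case (elim t)
      then show ?case using H12_norm_diff_square[OF D V_space_H12[OF elim] V_space_H12[OF \<phi>]] by simp
    qed
  qed
  have inc: "L2_inner D (u t) \<phi> - L2_inner D (u s) \<phi> = (LINT \<tau>|lebesgue_on {s<..<t}. r \<tau> \<phi>)"
    if \<phi>: "\<phi> \<in> V_space D" and st: "0 < s" "s < t" "t < T" for \<phi> s t
    by (rule distributional_derivative_imp_integral[OF cont[OF V_space_Lp[OF \<phi>]] r[OF \<phi>] eq[OF _ \<phi>] st])
  show ?thesis
    unfolding evolution_def
  proof (intro conjI ballI allI impI)
    show "AE t in ?I. u t \<in> V_space D \<and> Lp_norm D 2 (u t) \<le> M" using uV M by eventually_elim simp
    show "integrable ?I (\<lambda>\<tau>. (H12_norm D (u \<tau>))\<^sup>2)" by (rule Bochner_Lp_2_norm_measurable(2)[OF u H12_norm_nonneg])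
    show "approximable D T u" by (rule Bochner_approximable[OF D u])
  qed (use uH cont r inc m modulus dist in blast)+
qed

text \<open>
  Insert factors \<open>e\<close> and \<open>C\<close> into the pointwise bound for
  \<open>x\<^sup>\<alpha> y\<^sup>\<beta> z\<^sup>\<gamma>\<close>: \<open>C\<close> is determined
  by \<open>e\<^sup>\<alpha> e\<^sup>\<beta> C\<^sup>\<gamma> = K + 1\<close>, where the summand 1
  keeps \<open>C\<close> positive when \<open>K = 0\<close>.
\<close>

lemma weighted_Young:
  fixes K e \<alpha> \<beta> \<gamma> :: real
  assumes K: "K \<ge> 0" and e: "e > 0" and w: "\<alpha> > 0" "\<beta> > 0" "\<gamma> > 0" "\<alpha> + \<beta> + \<gamma> = 1"
  shows "\<exists>C\<ge>0. \<forall>x\<ge>0. \<forall>y\<ge>0. \<forall>z\<ge>0. K * (x powr \<alpha> * y powr \<beta> * z powr \<gamma>) \<le> e * (x + y) + C * z"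
proof -
  define C where "C = ((K + 1) * e powr (- (\<alpha> + \<beta>))) powr (1 / \<gamma>)"
  have C0: "C \<ge> 0" by (simp add: C_def)
  have pos: "(K + 1) * e powr (- (\<alpha> + \<beta>)) > 0" using K e by simp
  have Cg: "C powr \<gamma> = (K + 1) * e powr (- (\<alpha> + \<beta>))"
    unfolding C_def powr_powr using w(3) pos by simp
  have "K * (x powr \<alpha> * y powr \<beta> * z powr \<gamma>) \<le> e * (x + y) + C * z"
    if x: "x \<ge> 0" and y: "y \<ge> 0" and z: "z \<ge> 0" for x y z
  proof -
    have "K * (x powr \<alpha> * y powr \<beta> * z powr \<gamma>) \<le> (K + 1) * (x powr \<alpha> * y powr \<beta> * z powr \<gamma>)"
      by (intro mult_right_mono) auto
    also have "K + 1 = e powr \<alpha> * e powr \<beta> * C powr \<gamma>"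
    proof -
      have "e powr \<alpha> * e powr \<beta> * e powr (- (\<alpha> + \<beta>)) = 1" using e by (simp add: powr_add[symmetric])
      then have "(K + 1) * (e powr \<alpha> * e powr \<beta> * e powr (- (\<alpha> + \<beta>))) = K + 1" by simp
      then show ?thesis unfolding Cg by (simp only: mult.left_commute mult.assoc)
    qed
    also have "(e powr \<alpha> * e powr \<beta> * C powr \<gamma>) * (x powr \<alpha> * y powr \<beta> * z powr \<gamma>)
        = (e * x) powr \<alpha> * (e * y) powr \<beta> * (C * z) powr \<gamma>"
      using e x y z C0 by (simp add: powr_mult)
    also have "\<dots> \<le> e * x + e * y + C * z"
      by (rule powr_product_le_sum) (use e x y z C0 w in auto)
    finally show ?thesis by (simp add: algebra_simps)
  qed
  then show ?thesis using C0 by blast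
qed

text \<open>
  The difference of the two sides is a square.
\<close>

lemma Stokes_Young:
  assumes D: "open D" and e: "e > 0" and f: "f \<in> H12 D" and \<phi>: "\<phi> \<in> H12 D" and \<psi>: "\<psi> \<in> H12 D" and \<nu>: "\<nu> \<ge> 0"
  shows "\<bar>\<nu> * stokes_op D f \<phi> - \<nu> * stokes_op D f \<psi>\<bar> \<le> e * (H12_norm D f)\<^sup>2 + \<nu>\<^sup>2 / (4 * e) * (H12_norm D (\<lambda>x. \<phi> x - \<psi> x))\<^sup>2"
proof -
  let ?x = "H12_norm D f" and ?d = "H12_norm D (\<lambda>x. \<phi> x - \<psi> x)"
  have "\<nu> * stokes_op D f \<phi> - \<nu> * stokes_op D f \<psi> = \<nu> * stokes_op D f (\<lambda>x. \<phi> x - \<psi> x)"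
    by (simp add: stokes_op_diff_right[OF D f \<phi> \<psi>] right_diff_distrib)
  then have "\<bar>\<nu> * stokes_op D f \<phi> - \<nu> * stokes_op D f \<psi>\<bar> \<le> \<nu> * (?x * ?d)"
    using stokes_op_bound[OF D f H12_diff(1)[OF D \<phi> \<psi>]] \<nu> by (simp add: abs_mult mult_left_mono)
  also have "\<nu> * (?x * ?d) = e * ?x\<^sup>2 + \<nu>\<^sup>2 / (4 * e) * ?d\<^sup>2 - (2 * e * ?x - \<nu> * ?d)\<^sup>2 / (4 * e)"
    using e by (simp add: power2_eq_square field_simps)
  also have "\<dots> \<le> e * ?x\<^sup>2 + \<nu>\<^sup>2 / (4 * e) * ?d\<^sup>2" using e by simp
  finally show ?thesis .
qed

text \<open>
  The reciprocal of \<open>2 + 6/\<delta>\<close> is \<open>\<delta>/(2(3+\<delta>))\<close>.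
  Together with \<open>1/2\<close>, for the norm that enters linearly, and with half of the
  interpolation exponent \<open>3/(3+\<delta>)\<close>, the three exponents in Young's inequality
  add up to one.
\<close>

lemma Young_exponents:
  assumes \<delta>: "(\<delta>::real) > 0"
  shows "\<delta> / (2 * (3 + \<delta>)) > 0" "3 / (2 * (3 + \<delta>)) > 0" "\<delta> / (2 * (3 + \<delta>)) + 3 / (2 * (3 + \<delta>)) = 1 / 2"
    and "v \<ge> 0 \<Longrightarrow> (v powr (2 + 6 / \<delta>)) powr (\<delta> / (2 * (3 + \<delta>))) = v"
    and "d \<ge> 0 \<Longrightarrow> (d\<^sup>2) powr (3 / (2 * (3 + \<delta>))) = d powr (3 / (3 + \<delta>))"
    and "d \<ge> 0 \<Longrightarrow> (d\<^sup>2) powr (1 / 2) = d"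
proof -
  show "\<delta> / (2 * (3 + \<delta>)) > 0" "3 / (2 * (3 + \<delta>)) > 0" using \<delta> by auto
  have "\<delta> / (2 * (3 + \<delta>)) + 3 / (2 * (3 + \<delta>)) = (3 + \<delta>) / (2 * (3 + \<delta>))" by (simp add: add_divide_distrib)
  then show "\<delta> / (2 * (3 + \<delta>)) + 3 / (2 * (3 + \<delta>)) = 1 / 2" using \<delta> by simp
  have "2 + 6 / \<delta> = 2 * (3 + \<delta>) / \<delta>" using \<delta> by (simp add: field_simps)
  then have "(2 + 6 / \<delta>) * (\<delta> / (2 * (3 + \<delta>))) = 1" using \<delta> by simp
  then show "v \<ge> 0 \<Longrightarrow> (v powr (2 + 6 / \<delta>)) powr (\<delta> / (2 * (3 + \<delta>))) = v" by (simp only: powr_powr powr_one)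
  show "(d\<^sup>2) powr (3 / (2 * (3 + \<delta>))) = d powr (3 / (3 + \<delta>))" if "d \<ge> 0"
  proof -
    have "d\<^sup>2 = d powr 2" using that by simp
    then have "(d\<^sup>2) powr (3 / (2 * (3 + \<delta>))) = d powr (2 * (3 / (2 * (3 + \<delta>))))" by (simp only: powr_powr)
    also have "2 * (3 / (2 * (3 + \<delta>))) = 3 / (3 + \<delta>)" using \<delta> by (simp add: field_simps)
    finally show ?thesis .
  qed
  show "(d\<^sup>2) powr (1 / 2) = d" if "d \<ge> 0" using that by (simp add: powr_half_sqrt)
qed

text \<open>
  The difference of the test fields is the argument with the interpolated norm, and its norm in
  \<open>H\<close> is at most \<open>2 M\<close>; so Young's inequality is used with the exponent
  \<open>3/(2(3+\<delta>))\<close> on the squared distance.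
\<close>

lemma B_drift_modulus:
  assumes D: "open D" and \<delta>: "\<delta> > 0" and e: "e > 0" and \<nu>: "\<nu> \<ge> 0"
  shows "\<exists>C\<ge>0. \<forall>w\<in>Lp_on D (3 + \<delta>). \<forall>f\<in>V_space D.
     rate_bound D M e C (\<lambda>\<phi>. - \<nu> * stokes_op D f \<phi> + trilinear D w \<phi> f)
       (Lp_norm D (3 + \<delta>) w powr (2 + 6 / \<delta>) + (H12_norm D f)\<^sup>2)"
proof -
  let ?p = "3 + \<delta>"
  define K where "K = 2 * sqrt (3 * 110592 powr (1 / ?p)) * (2 * \<bar>M\<bar>) powr (\<delta> / ?p)"
  have K: "K \<ge> 0" by (simp add: K_def)
  have e2: "e / 2 > 0" using e by simp
  note Y = Young_exponents[OF \<delta>]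
  have sum1: "\<delta> / (2 * ?p) + 1 / 2 + 3 / (2 * ?p) = 1" using Y(3) by linarith
  obtain C where C: "C \<ge> 0" "\<forall>x\<ge>0. \<forall>y\<ge>0. \<forall>z\<ge>0.
      K * (x powr (\<delta> / (2 * ?p)) * y powr (1 / 2) * z powr (3 / (2 * ?p))) \<le> e / 2 * (x + y) + C * z"
    using weighted_Young[OF K e2 Y(1) _ Y(2) sum1] by auto
  define C' where "C' = C + \<nu>\<^sup>2 / (4 * (e / 2))"
  have C': "C' \<ge> 0" using C(1) e by (simp add: C'_def)
  show ?thesis
    unfolding rate_bound_def
  proof (intro exI[of _ C'] conjI C' ballI impI)
    fix w f \<phi> \<psi> :: field3
    assume w: "w \<in> Lp_on D ?p" and f: "f \<in> V_space D" and \<phi>: "\<phi> \<in> V_space D" and \<psi>: "\<psi> \<in> V_space D"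
      and M: "Lp_norm D 2 \<phi> \<le> M" "Lp_norm D 2 \<psi> \<le> M"
    let ?g = "\<lambda>x. \<phi> x - \<psi> x"
    let ?v = "Lp_norm D ?p w" and ?x = "H12_norm D f" and ?d = "H12_norm D ?g"
    have g: "?g \<in> H12_0 D" by (rule H12_0_diff[OF D V_space_H12_0[OF \<phi>] V_space_H12_0[OF \<psi>]])
    have "Lp_norm D 2 ?g \<le> Lp_norm D 2 \<phi> + Lp_norm D 2 \<psi>"
      using V_space_Lp[OF \<phi>] V_space_Lp[OF \<psi>] unfolding Lp_norm_2 Lp_on_2_iff by (rule l2_diff_triangle)
    then have gM: "Lp_norm D 2 ?g \<le> 2 * \<bar>M\<bar>" using M by linarith
    have "\<bar>trilinear D w ?g f\<bar> \<le> 2 * sqrt (3 * 110592 powr (1 / ?p)) * ?v * Lp_norm D 2 ?g powr (\<delta> / ?p) * ?d powr (3 / ?p) * ?x"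
      by (rule trilinear_bound[OF D \<delta> w g V_space_H12[OF f]])
    also have "\<dots> \<le> 2 * sqrt (3 * 110592 powr (1 / ?p)) * ?v * (2 * \<bar>M\<bar>) powr (\<delta> / ?p) * ?d powr (3 / ?p) * ?x"
      using \<delta> by (intro mult_right_mono mult_left_mono powr_mono2 gM) auto
    also have "\<dots> = K * ((?v powr (2 + 6 / \<delta>)) powr (\<delta> / (2 * ?p)) * (?x\<^sup>2) powr (1 / 2) * (?d\<^sup>2) powr (3 / (2 * ?p)))"
      unfolding Y(4)[OF Lp_norm_nonneg] Y(5)[OF H12_norm_nonneg] Y(6)[OF H12_norm_nonneg] K_def by (simp only: mult.assoc mult.commute mult.left_commute)
    also have "\<dots> \<le> e / 2 * (?v powr (2 + 6 / \<delta>) + ?x\<^sup>2) + C * ?d\<^sup>2"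
      by (rule C(2)[rule_format]) simp_all
    finally have t: "\<bar>trilinear D w \<phi> f - trilinear D w \<psi> f\<bar> \<le> e / 2 * (?v powr (2 + 6 / \<delta>) + ?x\<^sup>2) + C * ?d\<^sup>2"
      unfolding trilinear_diff2[OF D \<delta> w V_space_H12_0[OF \<phi>] V_space_H12[OF f] V_space_H12_0[OF \<psi>]] .
    have a: "\<bar>\<nu> * stokes_op D f \<phi> - \<nu> * stokes_op D f \<psi>\<bar> \<le> e / 2 * ?x\<^sup>2 + \<nu>\<^sup>2 / (4 * (e / 2)) * ?d\<^sup>2"
      by (rule Stokes_Young[OF D e2 V_space_H12[OF f] V_space_H12[OF \<phi>] V_space_H12[OF \<psi>] \<nu>])
    have "0 \<le> e / 2 * ?v powr (2 + 6 / \<delta>)" using e by simp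
    then show "\<bar>(- \<nu> * stokes_op D f \<phi> + trilinear D w \<phi> f) - (- \<nu> * stokes_op D f \<psi> + trilinear D w \<psi> f)\<bar>
       \<le> e * (?v powr (2 + 6 / \<delta>) + ?x\<^sup>2) + C' * ?d\<^sup>2"
      using t a unfolding C'_def distrib_left distrib_right by linarith
  qed
qed

text \<open>
  Compared with the previous lemma the roles are exchanged: the solution itself is the argument with
  the interpolated norm, and the difference of the test fields enters linearly through its curl.
\<close>

lemma curl_drift_modulus:
  assumes D: "open D" and \<delta>: "\<delta> > 0" and e: "e > 0" and \<nu>: "\<nu> \<ge> 0"
  shows "\<exists>C\<ge>0. \<forall>w\<in>Lp_on D (3 + \<delta>). \<forall>f\<in>V_space D. Lp_norm D 2 f \<le> M \<longrightarrow>
     rate_bound D M e C (\<lambda>\<phi>. - \<nu> * stokes_op D f \<phi> + trilinear D w f \<phi>)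
       (Lp_norm D (3 + \<delta>) w powr (2 + 6 / \<delta>) + (H12_norm D f)\<^sup>2)"
proof -
  let ?p = "3 + \<delta>"
  define K where "K = 2 * sqrt (3 * 110592 powr (1 / ?p)) * \<bar>M\<bar> powr (\<delta> / ?p)"
  have K: "K \<ge> 0" by (simp add: K_def)
  have e2: "e / 2 > 0" using e by simp
  note Y = Young_exponents[OF \<delta>]
  have sum1: "\<delta> / (2 * ?p) + 3 / (2 * ?p) + 1 / 2 = 1" using Y(3) by linarith
  obtain C where C: "C \<ge> 0" "\<forall>x\<ge>0. \<forall>y\<ge>0. \<forall>z\<ge>0.
      K * (x powr (\<delta> / (2 * ?p)) * y powr (3 / (2 * ?p)) * z powr (1 / 2)) \<le> e / 2 * (x + y) + C * z"
    using weighted_Young[OF K e2 Y(1,2) _ sum1] by auto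
  define C' where "C' = C + \<nu>\<^sup>2 / (4 * (e / 2))"
  have C': "C' \<ge> 0" using C(1) e by (simp add: C'_def)
  show ?thesis
    unfolding rate_bound_def
  proof (intro exI[of _ C'] conjI C' ballI impI)
    fix w f \<phi> \<psi> :: field3
    assume w: "w \<in> Lp_on D ?p" and f: "f \<in> V_space D" and \<phi>: "\<phi> \<in> V_space D" and \<psi>: "\<psi> \<in> V_space D"
      and M: "Lp_norm D 2 f \<le> M"
    let ?g = "\<lambda>x. \<phi> x - \<psi> x"
    let ?v = "Lp_norm D ?p w" and ?x = "H12_norm D f" and ?d = "H12_norm D ?g"
    have g: "?g \<in> H12 D" by (rule H12_diff(1)[OF D V_space_H12[OF \<phi>] V_space_H12[OF \<psi>]])
    have fM: "Lp_norm D 2 f \<le> \<bar>M\<bar>" using M by linarith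
    have "\<bar>trilinear D w f ?g\<bar> \<le> 2 * sqrt (3 * 110592 powr (1 / ?p)) * ?v * Lp_norm D 2 f powr (\<delta> / ?p) * ?x powr (3 / ?p) * ?d"
      by (rule trilinear_bound[OF D \<delta> w V_space_H12_0[OF f] g])
    also have "\<dots> \<le> 2 * sqrt (3 * 110592 powr (1 / ?p)) * ?v * \<bar>M\<bar> powr (\<delta> / ?p) * ?x powr (3 / ?p) * ?d"
      using \<delta> by (intro mult_right_mono mult_left_mono powr_mono2 fM) auto
    also have "\<dots> = K * ((?v powr (2 + 6 / \<delta>)) powr (\<delta> / (2 * ?p)) * (?x\<^sup>2) powr (3 / (2 * ?p)) * (?d\<^sup>2) powr (1 / 2))"
      unfolding Y(4)[OF Lp_norm_nonneg] Y(5)[OF H12_norm_nonneg] Y(6)[OF H12_norm_nonneg] K_def by (simp only: mult.assoc mult.commute mult.left_commute)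
    also have "\<dots> \<le> e / 2 * (?v powr (2 + 6 / \<delta>) + ?x\<^sup>2) + C * ?d\<^sup>2"
      by (rule C(2)[rule_format]) simp_all
    finally have t: "\<bar>trilinear D w f \<phi> - trilinear D w f \<psi>\<bar> \<le> e / 2 * (?v powr (2 + 6 / \<delta>) + ?x\<^sup>2) + C * ?d\<^sup>2"
      unfolding trilinear_diff3[OF D \<delta> w V_space_H12_0[OF f] V_space_H12[OF \<phi>] V_space_H12[OF \<psi>]] .
    have a: "\<bar>\<nu> * stokes_op D f \<phi> - \<nu> * stokes_op D f \<psi>\<bar> \<le> e / 2 * ?x\<^sup>2 + \<nu>\<^sup>2 / (4 * (e / 2)) * ?d\<^sup>2"
      by (rule Stokes_Young[OF D e2 V_space_H12[OF f] V_space_H12[OF \<phi>] V_space_H12[OF \<psi>] \<nu>])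
    have "0 \<le> e / 2 * ?v powr (2 + 6 / \<delta>)" using e by simp
    then show "\<bar>(- \<nu> * stokes_op D f \<phi> + trilinear D w f \<phi>) - (- \<nu> * stokes_op D f \<psi> + trilinear D w f \<psi>)\<bar>
       \<le> e * (?v powr (2 + 6 / \<delta>) + ?x\<^sup>2) + C' * ?d\<^sup>2"
      using t a unfolding C'_def distrib_left distrib_right by linarith
  qed
qed

text \<open>
  Here \<open>2 + 6/\<delta> \<ge> 2\<close> makes the square of the norm of \<open>v\<close>
  integrable in time.
\<close>

lemma drift_integrable:
  fixes T :: real
  assumes D: "open D" and \<delta>: "\<delta> > 0"
    and v: "v \<in> Bochner_Lp (2 + 6 / \<delta>) {0<..<T} (Lp_on D (3 + \<delta>)) (Lp_norm D (3 + \<delta>))"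
    and u: "u \<in> Bochner_Lp 2 {0<..<T} (V_space D) (H12_norm D)" and \<phi>: "\<phi> \<in> V_space D"
  shows "integrable (lebesgue_on {0<..<T}) (\<lambda>t. - \<nu> * stokes_op D (u t) \<phi> + trilinear D (v t) \<phi> (u t))"
    and "integrable (lebesgue_on {0<..<T}) (\<lambda>t. - \<nu> * stokes_op D (u t) \<phi> + trilinear D (v t) (u t) \<phi>)"
proof -
  let ?I = "lebesgue_on {0<..<T}" and ?p = "3 + \<delta>" and ?N = "H12_norm D"
  define K where "K = 2 * sqrt (3 * 110592 powr (1 / ?p))"
  have K: "K \<ge> 0" by (simp add: K_def)
  have sv: "strongly_measurable_on {0<..<T} (Lp_on D ?p) (Lp_norm D ?p) v"
    and vi: "integrable ?I (\<lambda>t. Lp_norm D ?p (v t) powr (2 + 6 / \<delta>))" using v by (auto simp: Bochner_Lp_def)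
  have su: "strongly_measurable_on {0<..<T} (V_space D) ?N u" using u by (simp add: Bochner_Lp_def)
  have ui: "integrable ?I (\<lambda>t. (?N (u t))\<^sup>2)" by (rule Bochner_Lp_2_norm_measurable(2)[OF u H12_norm_nonneg])
  have uV: "AE t in ?I. u t \<in> V_space D" and vL: "AE t in ?I. v t \<in> Lp_on D ?p"
    using su sv by (auto simp: strongly_measurable_on_def)
  note m = measurable_trilinear_path[OF D \<delta> sv su \<phi>]
  have si: "integrable ?I (\<lambda>t. stokes_op D (u t) \<phi>)"
  proof (rule Bochner_Integration.integrable_bound)
    show "integrable ?I (\<lambda>t. ((?N (u t))\<^sup>2 + 1) * ?N \<phi>)" using ui integrable_const_interval by auto
    show "AE t in ?I. norm (stokes_op D (u t) \<phi>) \<le> norm (((?N (u t))\<^sup>2 + 1) * ?N \<phi>)"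
      using uV
    proof eventually_elim
      case (elim t)
      have "?N (u t) \<le> (?N (u t))\<^sup>2 + 1"
      proof -
        have "2 * ?N (u t) \<le> (?N (u t))\<^sup>2 + 1"
          using zero_le_power2[of "?N (u t) - 1"] by (simp add: power2_eq_square algebra_simps)
        then show ?thesis using H12_norm_nonneg[of D "u t"] by linarith
      qed
      then have "?N (u t) * ?N \<phi> \<le> ((?N (u t))\<^sup>2 + 1) * ?N \<phi>" by (intro mult_right_mono) auto
      then show ?case using stokes_op_bound[OF D V_space_H12[OF elim] V_space_H12[OF \<phi>]] by simp
    qed
  qed (rule m(3))
  define b where "b t = K * ?N \<phi> * (Lp_norm D ?p (v t) powr (2 + 6 / \<delta>) + 1 + (?N (u t))\<^sup>2)" for t
  have bi: "integrable ?I b" unfolding b_def using vi ui integrable_const_interval by auto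
  have le: "K * x * y * ?N \<phi> \<le> K * ?N \<phi> * (x powr (2 + 6 / \<delta>) + 1 + y\<^sup>2)" if "x \<ge> 0" "y \<ge> 0" for x y
  proof -
    have "x\<^sup>2 \<le> x powr (2 + 6 / \<delta>) + 1"
    proof (cases "x \<le> 1")
      case True
      then have "x\<^sup>2 \<le> 1" using that by (simp add: power_le_one)
      then show ?thesis using powr_ge_zero[of x "2 + 6 / \<delta>"] by linarith
    next
      case False
      then have "x powr 2 \<le> x powr (2 + 6 / \<delta>)" using \<delta> by (intro powr_mono) auto
      then show ?thesis using False by simp
    qed
    moreover have "x * y \<le> x\<^sup>2 + y\<^sup>2"
    proof -
      have "2 * (x * y) \<le> x\<^sup>2 + y\<^sup>2" using sum_squares_bound[of x y] by (simp add: mult.assoc)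
      moreover have "0 \<le> x * y" using that by simp
      ultimately show ?thesis by linarith
    qed
    ultimately have "x * y \<le> x powr (2 + 6 / \<delta>) + 1 + y\<^sup>2" by linarith
    then have "(K * ?N \<phi>) * (x * y) \<le> (K * ?N \<phi>) * (x powr (2 + 6 / \<delta>) + 1 + y\<^sup>2)" using K by (intro mult_left_mono) auto
    then show ?thesis by (simp only: mult.assoc mult.commute mult.left_commute)
  qed
  have b0: "b t \<ge> 0" for t unfolding b_def using K by (intro mult_nonneg_nonneg add_nonneg_nonneg) auto
  have "integrable ?I (\<lambda>t. trilinear D (v t) \<phi> (u t))"
  proof (rule Bochner_Integration.integrable_bound[OF bi m(1)])
    show "AE t in ?I. norm (trilinear D (v t) \<phi> (u t)) \<le> norm (b t)"
      using uV vL
    proof eventually_elim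
      case (elim t)
      have "\<bar>trilinear D (v t) \<phi> (u t)\<bar> \<le> K * Lp_norm D ?p (v t) * ?N \<phi> * ?N (u t)"
        unfolding K_def by (rule trilinear_bound_H12[OF D \<delta> elim(2) V_space_H12_0[OF \<phi>] V_space_H12[OF elim(1)]])
      also have "\<dots> = K * Lp_norm D ?p (v t) * ?N (u t) * ?N \<phi>" by simp
      also have "\<dots> \<le> b t" unfolding b_def by (rule le) auto
      finally show ?case using b0[of t] by simp
    qed
  qed
  then show "integrable ?I (\<lambda>t. - \<nu> * stokes_op D (u t) \<phi> + trilinear D (v t) \<phi> (u t))" using si by simp
  have "integrable ?I (\<lambda>t. trilinear D (v t) (u t) \<phi>)"
  proof (rule Bochner_Integration.integrable_bound[OF bi m(2)])
    show "AE t in ?I. norm (trilinear D (v t) (u t) \<phi>) \<le> norm (b t)"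
      using uV vL
    proof eventually_elim
      case (elim t)
      have "\<bar>trilinear D (v t) (u t) \<phi>\<bar> \<le> K * Lp_norm D ?p (v t) * ?N (u t) * ?N \<phi>"
        unfolding K_def by (rule trilinear_bound_H12[OF D \<delta> elim(2) V_space_H12_0[OF elim(1)] V_space_H12[OF \<phi>]])
      also have "\<dots> \<le> b t" unfolding b_def by (rule le) auto
      finally show ?case using b0[of t] by simp
    qed
  qed
  then show "integrable ?I (\<lambda>t. - \<nu> * stokes_op D (u t) \<phi> + trilinear D (v t) (u t) \<phi>)" using si by simp
qed

theorem theorem2p7:
  fixes D :: "(real^3) set" and T \<nu> :: real
    and F0 G0 :: "real^3 \<Rightarrow> real^3"
    and v F G :: "real \<Rightarrow> real^3 \<Rightarrow> real^3"
  assumes "admissible_domain D"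
    and "T > 0" and "\<nu> > 0"
    and "F0 \<in> H_space D" and "G0 \<in> H_space D"
    and "v \<in> (\<Union>\<delta>\<in>{0<..}. Bochner_Lp (2 + 6 / \<delta>) {0<..<T} (Lp_on D (3 + \<delta>)) (Lp_norm D (3 + \<delta>)))"
    and "is_solution D T (\<lambda>t u \<phi>. - \<nu> * stokes_op D u \<phi> - B_op D (v t) u \<phi>) F0 F"
    and "is_solution D T (\<lambda>t u \<phi>. - \<nu> * stokes_op D u \<phi> + curl_cross_op D (v (T - t)) u \<phi>) G0 G"
  shows "\<forall>t\<in>{0..T}. L2_inner D (F t) (G (T - t)) = L2_inner D (F 0) (G T)"
proof -
  have D: "open D" using assms(1) by (auto simp: admissible_domain_def)
  note T = assms(2)
  have \<nu>: "\<nu> \<ge> 0" using assms(3) by simp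
  obtain \<delta> where \<delta>: "\<delta> > 0" and v: "v \<in> Bochner_Lp (2 + 6 / \<delta>) {0<..<T} (Lp_on D (3 + \<delta>)) (Lp_norm D (3 + \<delta>))"
    using assms(6) by auto
  let ?I = "lebesgue_on {0<..<T}" and ?p = "3 + \<delta>" and ?P = "2 + 6 / \<delta>"
  define vr where "vr t = v (T - t)" for t
  have vr: "vr \<in> Bochner_Lp ?P {0<..<T} (Lp_on D ?p) (Lp_norm D ?p)"
    using v strongly_measurable_reflect integral_reflect_interval(1)[of T "\<lambda>t. Lp_norm D ?p (v t) powr ?P"]
    unfolding Bochner_Lp_def vr_def[abs_def] by blast
  have vL: "AE t in ?I. w t \<in> Lp_on D ?p" and vi: "integrable ?I (\<lambda>t. Lp_norm D ?p (w t) powr ?P)"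
    if "w \<in> Bochner_Lp ?P {0<..<T} (Lp_on D ?p) (Lp_norm D ?p)" for w
    using that by (auto simp: Bochner_Lp_def strongly_measurable_on_def)
  have F: "F \<in> Bochner_Lp 2 {0<..<T} (V_space D) (H12_norm D)" "F \<in> Bochner_Linf {0<..<T} (H_space D) (Lp_norm D 2)"
    "F \<in> weakly_continuous_functions {0..T} (H_space D) (Lp_norm D 2)"
    and Feq: "\<And>\<psi> \<phi>. \<psi> \<in> test_functions {0<..<T} \<Longrightarrow> \<phi> \<in> V_space D \<Longrightarrow>
      - (LINT t|?I. deriv \<psi> t * L2_inner D (F t) \<phi>) = (LINT t|?I. \<psi> t * (- \<nu> * stokes_op D (F t) \<phi> + trilinear D (v t) \<phi> (F t)))"
    using assms(7) by (auto simp: is_solution_def B_op_def trilinear_def)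
  have G: "G \<in> Bochner_Lp 2 {0<..<T} (V_space D) (H12_norm D)" "G \<in> Bochner_Linf {0<..<T} (H_space D) (Lp_norm D 2)"
    "G \<in> weakly_continuous_functions {0..T} (H_space D) (Lp_norm D 2)"
    and Geq: "\<And>\<psi> \<phi>. \<psi> \<in> test_functions {0<..<T} \<Longrightarrow> \<phi> \<in> V_space D \<Longrightarrow>
      - (LINT t|?I. deriv \<psi> t * L2_inner D (G t) \<phi>) = (LINT t|?I. \<psi> t * (- \<nu> * stokes_op D (G t) \<phi> + trilinear D (vr t) (G t) \<phi>))"
    using assms(8) by (auto simp: is_solution_def curl_cross_op_def trilinear_def vr_def)
  obtain MF MG where MF: "AE t in ?I. Lp_norm D 2 (F t) \<le> MF" and MG: "AE t in ?I. Lp_norm D 2 (G t) \<le> MG"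
    using F(2) G(2) by (auto simp: Bochner_Linf_def)
  define M where "M = max MF MG"
  have FM: "AE t in ?I. Lp_norm D 2 (F t) \<le> M" using MF by eventually_elim (simp add: M_def)
  have GM: "AE t in ?I. Lp_norm D 2 (G t) \<le> M" using MG by eventually_elim (simp add: M_def)
  have uV: "AE t in ?I. u t \<in> V_space D" if "u \<in> Bochner_Lp 2 {0<..<T} (V_space D) (H12_norm D)" for u
    using that by (simp add: Bochner_Lp_def strongly_measurable_on_def)
  have evF: "evolution D T M F (\<lambda>\<tau> \<phi>. - \<nu> * stokes_op D (F \<tau>) \<phi> + trilinear D (v \<tau>) \<phi> (F \<tau>))
      (\<lambda>\<tau>. Lp_norm D ?p (v \<tau>) powr ?P + (H12_norm D (F \<tau>))\<^sup>2)"
  proof (rule weak_solution_evolution[OF D F(1) FM F(3) drift_integrable(1)[OF D \<delta> v F(1)] Feq])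
    show "integrable ?I (\<lambda>\<tau>. Lp_norm D ?p (v \<tau>) powr ?P + (H12_norm D (F \<tau>))\<^sup>2)"
      using vi[OF v] Bochner_Lp_2_norm_measurable(2)[OF F(1) H12_norm_nonneg] by simp
    fix e :: real assume "e > 0"
    from B_drift_modulus[OF D \<delta> this \<nu>, of M] obtain C where C: "C \<ge> 0"
      "\<forall>w\<in>Lp_on D ?p. \<forall>f\<in>V_space D. rate_bound D M e C (\<lambda>\<phi>. - \<nu> * stokes_op D f \<phi> + trilinear D w \<phi> f) (Lp_norm D ?p w powr ?P + (H12_norm D f)\<^sup>2)" by blast
    have "AE \<tau> in ?I. rate_bound D M e C (\<lambda>\<phi>. - \<nu> * stokes_op D (F \<tau>) \<phi> + trilinear D (v \<tau>) \<phi> (F \<tau>)) (Lp_norm D ?p (v \<tau>) powr ?P + (H12_norm D (F \<tau>))\<^sup>2)"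
      using uV[OF F(1)] vL[OF v] by eventually_elim (use C(2) in blast)
    with C(1) show "\<exists>C\<ge>0. AE \<tau> in ?I. rate_bound D M e C (\<lambda>\<phi>. - \<nu> * stokes_op D (F \<tau>) \<phi> + trilinear D (v \<tau>) \<phi> (F \<tau>)) (Lp_norm D ?p (v \<tau>) powr ?P + (H12_norm D (F \<tau>))\<^sup>2)" by blast
  qed simp_all
  have evG: "evolution D T M G (\<lambda>\<tau> \<phi>. - \<nu> * stokes_op D (G \<tau>) \<phi> + trilinear D (vr \<tau>) (G \<tau>) \<phi>)
      (\<lambda>\<tau>. Lp_norm D ?p (vr \<tau>) powr ?P + (H12_norm D (G \<tau>))\<^sup>2)"
  proof (rule weak_solution_evolution[OF D G(1) GM G(3) drift_integrable(2)[OF D \<delta> vr G(1)] Geq])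
    show "integrable ?I (\<lambda>\<tau>. Lp_norm D ?p (vr \<tau>) powr ?P + (H12_norm D (G \<tau>))\<^sup>2)"
      using vi[OF vr] Bochner_Lp_2_norm_measurable(2)[OF G(1) H12_norm_nonneg] by simp
    fix e :: real assume "e > 0"
    from curl_drift_modulus[OF D \<delta> this \<nu>, of M] obtain C where C: "C \<ge> 0"
      "\<forall>w\<in>Lp_on D ?p. \<forall>f\<in>V_space D. Lp_norm D 2 f \<le> M \<longrightarrow> rate_bound D M e C (\<lambda>\<phi>. - \<nu> * stokes_op D f \<phi> + trilinear D w f \<phi>) (Lp_norm D ?p w powr ?P + (H12_norm D f)\<^sup>2)" by blast
    have "AE \<tau> in ?I. rate_bound D M e C (\<lambda>\<phi>. - \<nu> * stokes_op D (G \<tau>) \<phi> + trilinear D (vr \<tau>) (G \<tau>) \<phi>) (Lp_norm D ?p (vr \<tau>) powr ?P + (H12_norm D (G \<tau>))\<^sup>2)"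
      using uV[OF G(1)] vL[OF vr] GM by eventually_elim (use C(2) in blast)
    with C(1) show "\<exists>C\<ge>0. AE \<tau> in ?I. rate_bound D M e C (\<lambda>\<phi>. - \<nu> * stokes_op D (G \<tau>) \<phi> + trilinear D (vr \<tau>) (G \<tau>) \<phi>) (Lp_norm D ?p (vr \<tau>) powr ?P + (H12_norm D (G \<tau>))\<^sup>2)" by blast
  qed simp_all
  show ?thesis
  proof
    fix t assume t: "t \<in> {0..T}"
    have "L2_inner D (F t) (G (T - t)) = L2_inner D (F 0) (G (T - 0))"
    proof (rule evolution_pairing_constant[OF D T evF evolution_reflect[OF evG] _ t])
      show "AE \<tau> in ?I. (- \<nu> * stokes_op D (F \<tau>) (G (T - \<tau>)) + trilinear D (v \<tau>) (G (T - \<tau>)) (F \<tau>))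
          + - (- \<nu> * stokes_op D (G (T - \<tau>)) (F \<tau>) + trilinear D (vr (T - \<tau>)) (G (T - \<tau>)) (F \<tau>)) = 0"
        by (intro AE_I2) (simp add: vr_def stokes_op_commute[of D "F _"])
    qed
    then show "L2_inner D (F t) (G (T - t)) = L2_inner D (F 0) (G T)" by simp
  qed
qed

end
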